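(* Assume $\mathrm{char}\,k\neq2$. Let $V$ be a $2n$-dimensional $k$-vector space ($n\ge1$) with a nondegenerate alternating bilinear form, and let $\mathcal C$ be a regular semisimple conjugacy class in $\mathfrak{sp}(V_F)$ (under $Sp(V_F)$). Then there is a representative $N\in\mathcal C$ almost commuting with a $Q'_{Sp}$-action if and only if $h_{\mathcal C}(\mu)$ is a homogeneous polynomial (of degree $n$) in $\mu$ and $\pi^q$ for some nonzero $q\in\frac1n\mathbf Z$. In this case, $\mathcal C$ is nil if and only if $q>0$.
   Context: $k$ is an algebraically closed field, $F=k((\pi))$, $A=k[[\pi]]$, $V_F=V\otimes_kF$. An element $N\in\mathfrak{sp}(V_F)$ is regular semisimple if its eigenvalues in an algebraic closure $\overline F$ are $\pm a_1,\dots,\pm a_n$ with the $a_i^2$ distinct and nonzero. For semisimple $N$, $\mathrm{char}_N(\mu)=\prod_{i=1}^n(\mu^2-a_i^2)$ and $h_N\in F[\mu]$ is the polynomial of degree $n$ with $h_N(\mu^2)=\mathrm{char}_N(\mu)$; $h_{\mathcal C}=h_N$ for $N\in\mathcal C$. An element is nil (topologically nilpotent) if it is conjugate to some $N'\in\mathfrak{sp}(V_A)$, $V_A=V\otimes_kA$, whose image in $\mathfrak{sp}(V)$ ($\pi\mapsto0$) is nilpotent. $k^*$ acts on $F$ by $k$-algebra automorphisms with $\lambda\cdot\pi^m=\lambda^m\pi^m$, inducing $N\mapsto N^\lambda$ on $\mathfrak{sp}(V_F)$. The group $Q'_{Sp}=PSp(V)\times k^*$ (where $PSp(V)=PGSp(V)$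 is the adjoint group) acts on $\mathfrak{sp}(V_F)$ by $(g,\lambda)\cdot N=\mathrm{Ad}(g)N^\lambda$. A $Q'_{Sp}$-action is given by an algebraic homomorphism $f:k^*\to Q'_{Sp}$. It almost commutes with $N$ if for some nonzero integer $s$, $f(\lambda)\cdot N=\lambda^sN$ for all $\lambda\in k^*$. "A homogeneous polynomial of degree $n$ in $\mu$ and $\pi^q$" means an expression $\sum_{i=0}^nc_i\pi^{qi}\mu^{n-i}$ with $c_i\in k$ (where, as the coefficients lie in $F$, $c_i\neq0$ implies $qi\in\mathbf Z$). *)

theory Defs
  imports
    "Jordan_Normal_Form.Char_Poly"
    "HOL-Algebra.Coset"
    "HOL-Algebra.Algebraic_Closure_Type"
    "HOL-Computational_Algebra.Formal_Laurent_Series"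
begin

text \<open>
  A basis of \<open>V\<close> is fixed, so that \<open>V = k\<^sup>2\<^sup>n\<close>, and the form is given by an arbitrary Gram matrix \<open>J\<close>.
  For \<open>R = k, A, F\<close> with \<open>A = k[[\<pi>]]\<close> (\<^typ>\<open>'k fps\<close>) and \<open>F = k((\<pi>))\<close> (\<^typ>\<open>'k fls\<close>),
  endomorphisms of \<open>V\<^sub>R\<close> are \<open>2n \<times> 2n\<close> matrices over \<open>R\<close>.
\<close>

definition symplectic_form :: "nat \<Rightarrow> 'a::field mat \<Rightarrow> bool" where
  "symplectic_form n J \<longleftrightarrow> J \<in> carrier_mat (2 * n) (2 * n) \<and>
     (\<forall>v \<in> carrier_vec (2 * n). v \<bullet> (J *\<^sub>v v) = 0) \<and>
     (\<forall>v \<in> carrier_vec (2 * n).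
        (\<forall>w \<in> carrier_vec (2 * n). v \<bullet> (J *\<^sub>v w) = 0) \<longrightarrow> v = 0\<^sub>v (2 * n))"

definition sp :: "nat \<Rightarrow> 'a::comm_ring_1 mat \<Rightarrow> 'a mat set" where
  "sp n J = {N \<in> carrier_mat (2 * n) (2 * n). transpose_mat N * J + J * N = 0\<^sub>m (2 * n) (2 * n)}"

definition GL :: "nat \<Rightarrow> 'a::field mat monoid" where
  "GL d = units_of (ring_mat TYPE('a) d ())"

definition Sp :: "nat \<Rightarrow> 'a::field mat \<Rightarrow> 'a mat monoid" where
  "Sp n J = GL (2 * n) \<lparr>carrier := {g \<in> carrier (GL (2 * n)). transpose_mat g * J * g = J}\<rparr>"

definition GSp :: "nat \<Rightarrow> 'a::field mat \<Rightarrow> 'a mat monoid" where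
  "GSp n J = GL (2 * n) \<lparr>carrier :=
     {g \<in> carrier (GL (2 * n)). \<exists>c. c \<noteq> 0 \<and> transpose_mat g * J * g = c \<cdot>\<^sub>m J}\<rparr>"

definition scalar_mats :: "nat \<Rightarrow> 'a::field mat set" where
  "scalar_mats n = {c \<cdot>\<^sub>m 1\<^sub>m (2 * n) | c. c \<noteq> 0}"

text \<open>
  The \<open>k\<close>-points of \<open>PSp(V) = PGSp(V)\<close>; over an algebraically closed field these are the
  cosets of the scalars in \<open>GSp(V)\<close>.
\<close>

definition PGSp :: "nat \<Rightarrow> 'a::field mat \<Rightarrow> 'a mat set monoid" where
  "PGSp n J = GSp n J Mod scalar_mats n"

definition Gm :: "'a::field monoid" where
  "Gm = \<lparr>carrier = {x. x \<noteq> 0}, mult = (*), one = 1\<rparr>"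

definition Q_Sp :: "nat \<Rightarrow> 'a::field mat \<Rightarrow> ('a mat set \<times> 'a) monoid" where
  "Q_Sp n J = PGSp n J \<times>\<times> Gm"

definition Ad :: "nat \<Rightarrow> 'a::field mat \<Rightarrow> 'a mat \<Rightarrow> 'a mat" where
  "Ad n g N = g * N * inv\<^bsub>GL (2 * n)\<^esub> g"


subsection \<open>The action of \<open>Q'\<close> on matrices over \<open>F\<close>\<close>

text \<open>The automorphism of \<open>F\<close> given by \<open>\<lambda>\<close>, sending \<open>\<Sum> a\<^sub>m \<pi>\<^sup>m\<close> to \<open>\<Sum> a\<^sub>m \<lambda>\<^sup>m \<pi>\<^sup>m\<close>.\<close>

definition fls_rotate :: "'a::field \<Rightarrow> 'a fls \<Rightarrow> 'a fls" where
  "fls_rotate l x = Abs_fls (\<lambda>m. l powi m * fls_nth x m)"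

lemma fls_rotate_nth [simp]: "fls_nth (fls_rotate l x) m = l powi m * fls_nth x m"
proof -
  have "\<forall>\<^sub>\<infinity>n::nat. l powi (- int n) * fls_nth x (- int n) = 0"
    by (rule MOST_mono[OF CollectD[OF fls_nth[of x]]]) simp
  then show ?thesis
    unfolding fls_rotate_def by (simp add: Abs_fls_inverse)
qed

text \<open>
  Any representative of the coset may be used, since scalars act trivially under \<^const>\<open>Ad\<close>
  (lemma \<open>Q_act_eq\<close> below).
\<close>

definition Q_act :: "nat \<Rightarrow> 'a::field mat set \<times> 'a \<Rightarrow> 'a fls mat \<Rightarrow> 'a fls mat" where
  "Q_act n x N =
     Ad n (map_mat fls_const (SOME g. g \<in> fst x)) (map_mat (fls_rotate (snd x)) N)"


subsection \<open>Algebraic homomorphisms \<open>k\<^sup>* \<rightarrow> Q'\<close>\<close>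

text \<open>
  The coordinate ring of \<open>GL\<^sub>d \<times> k\<^sup>*\<close>, as functions on pairs \<open>(g, t)\<close>. Since \<open>GSp(V) \<times> k\<^sup>*\<close> is
  closed in it, restriction gives all regular functions on \<open>GSp(V) \<times> k\<^sup>*\<close>.
\<close>

inductive_set coord_ring :: "nat \<Rightarrow> ('a::field mat \<times> 'a \<Rightarrow> 'a) set" for d :: nat where
  const: "(\<lambda>_. c) \<in> coord_ring d"
| entry: "i < d \<Longrightarrow> j < d \<Longrightarrow> (\<lambda>(g, t). g $$ (i, j)) \<in> coord_ring d"
| det_inv: "(\<lambda>(g, t). inverse (det g)) \<in> coord_ring d"
| t: "(\<lambda>(g, t). t) \<in> coord_ring d"
| t_inv: "(\<lambda>(g, t). inverse t) \<in> coord_ring d"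
| add: "p \<in> coord_ring d \<Longrightarrow> q \<in> coord_ring d \<Longrightarrow> (\<lambda>x. p x + q x) \<in> coord_ring d"
| mult: "p \<in> coord_ring d \<Longrightarrow> q \<in> coord_ring d \<Longrightarrow> (\<lambda>x. p x * q x) \<in> coord_ring d"

text \<open>
  \<open>Q'\<close> is the quotient variety of \<open>GSp(V) \<times> k\<^sup>*\<close> by the scalars: its regular functions are the
  scalar-invariant regular functions, i.e. the functions that become regular when pulled back
  to \<open>GSp(V) \<times> k\<^sup>*\<close>.
\<close>

definition regular_Q :: "nat \<Rightarrow> 'a::field mat \<Rightarrow> ('a mat set \<times> 'a \<Rightarrow> 'a) \<Rightarrow> bool" where
  "regular_Q n J \<psi> \<longleftrightarrow> (\<exists>p \<in> coord_ring (2 * n). \<forall>g \<in> carrier (GSp n J). \<forall>t \<in> carrier Gm.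
     \<psi> (scalar_mats n #>\<^bsub>GSp n J\<^esub> g, t) = p (g, t))"

text \<open>Regular functions on \<open>k\<^sup>*\<close>, i.e. Laurent polynomials in the coordinate.\<close>

definition regular_Gm :: "('a::field \<Rightarrow> 'a) \<Rightarrow> bool" where
  "regular_Gm \<phi> \<longleftrightarrow> (\<exists>p m. \<forall>l \<in> carrier Gm. \<phi> l = poly p l / l ^ m)"

definition Q_action :: "nat \<Rightarrow> 'a::field mat \<Rightarrow> ('a \<Rightarrow> 'a mat set \<times> 'a) \<Rightarrow> bool" where
  "Q_action n J f \<longleftrightarrow> f \<in> hom Gm (Q_Sp n J) \<and>
     (\<forall>\<psi>. regular_Q n J \<psi> \<longrightarrow> regular_Gm (\<lambda>l. \<psi> (f l)))"

definition almost_commutes :: "nat \<Rightarrow> ('a::field \<Rightarrow> 'a mat set \<times> 'a) \<Rightarrow> 'a fls mat \<Rightarrow> bool" where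
  "almost_commutes n f N \<longleftrightarrow> (\<exists>s::int. s \<noteq> 0 \<and>
     (\<forall>l \<in> carrier Gm. Q_act n (f l) N = fls_const (l powi s) \<cdot>\<^sub>m N))"


subsection \<open>Regular semisimple classes in \<open>sp(V\<^sub>F)\<close>\<close>

abbreviation (input) sp_F :: "nat \<Rightarrow> 'a::field mat \<Rightarrow> 'a fls mat set" where
  "sp_F n J \<equiv> sp n (map_mat fls_const J)"

abbreviation (input) sp_A :: "nat \<Rightarrow> 'a::field mat \<Rightarrow> 'a fps mat set" where
  "sp_A n J \<equiv> sp n (map_mat fps_const J)"

definition conj_class :: "nat \<Rightarrow> 'a::field mat \<Rightarrow> 'a fls mat \<Rightarrow> 'a fls mat set" where
  "conj_class n J N = {Ad n g N | g. g \<in> carrier (Sp n (map_mat fls_const J))}"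

definition regular_semisimple :: "nat \<Rightarrow> 'a::field fls mat \<Rightarrow> bool" where
  "regular_semisimple n N \<longleftrightarrow> (\<exists>a :: nat \<Rightarrow> 'a fls alg_closure.
     {x. eigenvalue (map_mat to_ac N) x} = a ` {..<n} \<union> (\<lambda>i. - a i) ` {..<n} \<and>
     inj_on (\<lambda>i. (a i)\<^sup>2) {..<n} \<and> (\<forall>i<n. a i \<noteq> 0))"

definition regular_semisimple_class :: "nat \<Rightarrow> 'a::field mat \<Rightarrow> 'a fls mat set \<Rightarrow> bool" where
  "regular_semisimple_class n J C \<longleftrightarrow>
     (\<exists>N \<in> sp_F n J. regular_semisimple n N \<and> C = conj_class n J N)"

text \<open>
  The polynomial \<open>h\<close> with \<open>h(\<mu>\<^sup>2) = char(\<mu>)\<close>; it is unique (lemma \<open>h_poly_eqI\<close> below), and its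
  degree is forced to be \<open>n\<close>.
\<close>

definition h_poly :: "'a::field fls mat \<Rightarrow> 'a fls poly" where
  "h_poly N = (THE h. h \<circ>\<^sub>p Polynomial.monom 1 2 = char_poly N)"

definition h_class :: "'a::field fls mat set \<Rightarrow> 'a fls poly" where
  "h_class C = (THE h. \<forall>N \<in> C. h = h_poly N)"

definition nil_elem :: "nat \<Rightarrow> 'a::field mat \<Rightarrow> 'a fls mat \<Rightarrow> bool" where
  "nil_elem n J N \<longleftrightarrow> (\<exists>M \<in> sp_A n J. map_mat fps_to_fls M \<in> conj_class n J N \<and>
     (\<exists>m. map_mat (\<lambda>x. fps_nth x 0) M ^\<^sub>m m = 0\<^sub>m (2 * n) (2 * n)))"

definition nil_class :: "nat \<Rightarrow> 'a::field mat \<Rightarrow> 'a fls mat set \<Rightarrow> bool" where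
  "nil_class n J C \<longleftrightarrow> (\<forall>N \<in> C. nil_elem n J N)"

text \<open>
  \<open>h = \<Sum> c\<^sub>i \<pi>\<^sup>q\<^sup>i \<mu>\<^sup>n\<^sup>-\<^sup>i\<close>. When \<open>q i\<close> is not an integer the coefficient \<open>c\<^sub>i\<close> is zero and the
  floor is irrelevant.
\<close>

definition homogeneous_in_pi_pow :: "nat \<Rightarrow> rat \<Rightarrow> 'a::field fls poly \<Rightarrow> bool" where
  "homogeneous_in_pi_pow n q h \<longleftrightarrow> (\<exists>c :: nat \<Rightarrow> 'a.
     (\<forall>i\<le>n. c i \<noteq> 0 \<longrightarrow> q * of_nat i \<in> \<int>) \<and>
     h = (\<Sum>i\<le>n. Polynomial.monom (fls_const (c i) * fls_X_intpow \<lfloor>q * of_nat i\<rfloor>) (n - i)))"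


subsection \<open>Well-definedness\<close>

lemma pcompose_square_inj:
  fixes g h :: "'a::idom poly"
  assumes "g \<circ>\<^sub>p Polynomial.monom 1 2 = h \<circ>\<^sub>p Polynomial.monom 1 2"
  shows "g = h"
proof -
  have "(g - h) \<circ>\<^sub>p Polynomial.monom 1 2 = 0"
    using assms by (simp add: pcompose_diff)
  then have "g - h = 0"
    by (rule pcompose_eq_0) (simp add: Polynomial.degree_monom_eq)
  then show ?thesis by simp
qed

lemma h_poly_eqI: "h \<circ>\<^sub>p Polynomial.monom 1 2 = char_poly N \<Longrightarrow> h_poly N = h"
  unfolding h_poly_def by (rule the_equality) (auto intro: pcompose_square_inj)

lemma smult_smult_mat: "a \<cdot>\<^sub>m (b \<cdot>\<^sub>m M) = (a * b) \<cdot>\<^sub>m (M :: 'a::field mat)"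
  by (rule eq_matI) simp_all

lemma one_smult_mat: "1 \<cdot>\<^sub>m M = (M :: 'a::field mat)"
  by (rule eq_matI) simp_all

lemma carrier_GL:
  "g \<in> carrier (GL d) \<longleftrightarrow>
     g \<in> carrier_mat d d \<and> (\<exists>h \<in> carrier_mat d d. h * g = 1\<^sub>m d \<and> g * h = 1\<^sub>m d)"
  by (auto simp: GL_def units_of_def Units_def ring_mat_simps)

lemma group_GL: "group (GL d :: 'a::field mat monoid)"
proof -
  interpret R: ring "ring_mat TYPE('a) d ()" by (rule ring_mat)
  show ?thesis unfolding GL_def by (rule R.units_group)
qed

lemma GL_mult [simp]: "x \<otimes>\<^bsub>GL d\<^esub> y = x * y"
  by (simp add: GL_def units_of_def ring_mat_simps)

lemma GL_one [simp]: "\<one>\<^bsub>GL d\<^esub> = 1\<^sub>m d"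
  by (simp add: GL_def units_of_def ring_mat_simps)

lemma GL_inv_eqI:
  assumes "g \<in> carrier_mat d d" "h \<in> carrier_mat d d" "h * g = 1\<^sub>m d" "g * h = 1\<^sub>m d"
  shows "inv\<^bsub>GL d\<^esub> g = h"
proof -
  have "g \<in> carrier (GL d)" "h \<in> carrier (GL d)"
    unfolding carrier_GL using assms by blast+
  then show ?thesis
    by (intro group.inv_equality[OF group_GL]) (use assms in simp_all)
qed

lemma h_poly_conj_class:
  fixes N :: "'a::field fls mat"
  assumes "N \<in> carrier_mat (2 * n) (2 * n)" "N' \<in> conj_class n J N"
  shows "h_poly N' = h_poly N"
proof -
  obtain g where g: "g \<in> carrier (Sp n (map_mat fls_const J))" "N' = Ad n g N"
    using assms by (auto simp: conj_class_def)
  then obtain h where h: "g \<in> carrier_mat (2 * n) (2 * n)" "h \<in> carrier_mat (2 * n) (2 * n)"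
      "h * g = 1\<^sub>m (2 * n)" "g * h = 1\<^sub>m (2 * n)"
    by (auto simp: Sp_def carrier_GL)
  have "N' = g * N * h"
    using g h by (simp add: Ad_def GL_inv_eqI)
  then have "similar_mat_wit N' N g h"
    using h assms by (auto simp: similar_mat_wit_def Let_def)
  then have "char_poly N' = char_poly N"
    by (intro char_poly_similar) (auto simp: similar_mat_def)
  then show ?thesis by (simp add: h_poly_def)
qed

lemma h_class_conj_class:
  fixes N :: "'a::field fls mat"
  assumes "N \<in> carrier_mat (2 * n) (2 * n)" "N' \<in> conj_class n J N"
  shows "h_class (conj_class n J N) = h_poly N'"
  unfolding h_class_def
proof (rule the_equality)
  show "\<forall>M \<in> conj_class n J N. h_poly N' = h_poly M"
    using h_poly_conj_class[OF assms(1)] assms(2) by simp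
qed (use assms(2) in blast)

lemma subgroup_GSp:
  fixes J :: "'a::field mat"
  assumes J: "J \<in> carrier_mat (2 * n) (2 * n)"
  shows "subgroup (carrier (GSp n J)) (GL (2 * n))"
proof (rule group.subgroupI[OF group_GL])
  let ?d = "2 * n"
  show "carrier (GSp n J) \<subseteq> carrier (GL ?d)"
    by (auto simp: GSp_def)
  have "1\<^sub>m ?d \<in> carrier (GSp n J)"
    using J by (auto simp: GSp_def carrier_GL intro!: exI[of _ 1] bexI[of _ "1\<^sub>m ?d"])
  then show "carrier (GSp n J) \<noteq> {}" by blast
next
  let ?d = "2 * n"
  fix g assume "g \<in> carrier (GSp n J)"
  then obtain c h where g: "g \<in> carrier_mat ?d ?d" "h \<in> carrier_mat ?d ?d" "h * g = 1\<^sub>m ?d"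
      "g * h = 1\<^sub>m ?d" "c \<noteq> 0" "transpose_mat g * J * g = c \<cdot>\<^sub>m J"
    by (auto simp: GSp_def carrier_GL)
  have tt: "transpose_mat h * transpose_mat g = 1\<^sub>m ?d"
    using transpose_mult[OF g(1,2)] g(4) by simp
  have "transpose_mat h * (transpose_mat g * J * g) * h
      = (transpose_mat h * transpose_mat g) * J * (g * h)"
    using g(1,2) J by (simp add: assoc_mult_mat[of _ ?d ?d _ ?d _ ?d])
  also have "\<dots> = J" using J tt g by simp
  finally have "c \<cdot>\<^sub>m (transpose_mat h * J * h) = J"
    unfolding g(6) using g J
    by (simp add: mult_smult_distrib[of _ ?d ?d _ ?d] mult_smult_assoc_mat[of _ ?d ?d _ ?d])
  then have "inverse c \<cdot>\<^sub>m (c \<cdot>\<^sub>m (transpose_mat h * J * h)) = inverse c \<cdot>\<^sub>m J"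
    by (rule arg_cong)
  then have "transpose_mat h * J * h = inverse c \<cdot>\<^sub>m J"
    using g(5) by (simp add: smult_smult_mat one_smult_mat)
  moreover have "inv\<^bsub>GL ?d\<^esub> g = h" using g by (simp add: GL_inv_eqI)
  ultimately show "inv\<^bsub>GL ?d\<^esub> g \<in> carrier (GSp n J)"
    using g unfolding GSp_def by (auto simp: carrier_GL intro!: exI[of _ "inverse c"])
next
  let ?d = "2 * n"
  fix g h assume "g \<in> carrier (GSp n J)" "h \<in> carrier (GSp n J)"
  then obtain c e where g: "g \<in> carrier_mat ?d ?d" "h \<in> carrier_mat ?d ?d"
      "g \<in> carrier (GL ?d)" "h \<in> carrier (GL ?d)" "c \<noteq> 0" "e \<noteq> 0"
      "transpose_mat g * J * g = c \<cdot>\<^sub>m J" "transpose_mat h * J * h = e \<cdot>\<^sub>m J"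
    by (auto simp: GSp_def carrier_GL)
  have "transpose_mat (g * h) * J * (g * h) = transpose_mat h * (transpose_mat g * J * g) * h"
    using g(1,2) J by (simp add: transpose_mult[of _ ?d ?d _ ?d] assoc_mult_mat[of _ ?d ?d _ ?d _ ?d])
  also have "\<dots> = c \<cdot>\<^sub>m (transpose_mat h * J * h)"
    unfolding g(7) using g J by (simp add: mult_smult_distrib[of _ ?d ?d _ ?d] mult_smult_assoc_mat[of _ ?d ?d _ ?d])
  also have "\<dots> = (c * e) \<cdot>\<^sub>m J" using g by (auto intro!: eq_matI)
  finally show "g \<otimes>\<^bsub>GL ?d\<^esub> h \<in> carrier (GSp n J)"
    using g group.is_monoid[OF group_GL, THEN monoid.m_closed, of g ?d h]
    by (auto simp: GSp_def intro!: exI[of _ "c * e"])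
qed

lemma group_GSp:
  fixes J :: "'a::field mat"
  assumes "J \<in> carrier_mat (2 * n) (2 * n)"
  shows "group (GSp n J)"
proof -
  have "GSp n J = GL (2 * n) \<lparr>carrier := carrier (GSp n J)\<rparr>"
    by (simp add: GSp_def)
  then show ?thesis
    using subgroup.subgroup_is_group[OF subgroup_GSp[OF assms] group_GL] by simp
qed

lemma scalar_mats_mult:
  assumes "g \<in> carrier_mat (2 * n) (2 * n)"
  shows "(c \<cdot>\<^sub>m 1\<^sub>m (2 * n)) * g = c \<cdot>\<^sub>m g" "g * (c \<cdot>\<^sub>m 1\<^sub>m (2 * n)) = c \<cdot>\<^sub>m (g :: 'a::field mat)"
  using assms by (simp_all add: mult_smult_distrib[of _ "2*n" "2*n" _ "2*n"]
      mult_smult_assoc_mat[of _ "2*n" "2*n" _ "2*n"])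

lemma GSp_mult [simp]: "x \<otimes>\<^bsub>GSp n J\<^esub> y = x * y"
  by (simp add: GSp_def)

lemma GSp_one [simp]: "\<one>\<^bsub>GSp n J\<^esub> = 1\<^sub>m (2 * n)"
  by (simp add: GSp_def)

lemma scalar_mats_subset:
  fixes J :: "'a::field mat"
  assumes J: "J \<in> carrier_mat (2 * n) (2 * n)"
  shows "scalar_mats n \<subseteq> carrier (GSp n J)"
proof
  let ?d = "2 * n"
  fix x :: "'a mat" assume "x \<in> scalar_mats n"
  then obtain c where c: "x = c \<cdot>\<^sub>m 1\<^sub>m ?d" "c \<noteq> 0" by (auto simp: scalar_mats_def)
  let ?y = "inverse c \<cdot>\<^sub>m 1\<^sub>m ?d :: 'a mat"
  have "x \<in> carrier (GL ?d)"
    unfolding carrier_GL using c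
    by (auto intro!: bexI[of _ ?y] eq_matI simp: scalar_mats_mult)
  moreover have "transpose_mat x = x" using c by (auto intro!: eq_matI)
  then have "transpose_mat x * J * x = (c * c) \<cdot>\<^sub>m J"
    using c J by (auto simp: scalar_mats_mult intro!: eq_matI)
  ultimately show "x \<in> carrier (GSp n J)"
    using c by (auto simp: GSp_def intro!: exI[of _ "c * c"])
qed

lemma normal_scalar_mats:
  fixes J :: "'a::field mat"
  assumes J: "J \<in> carrier_mat (2 * n) (2 * n)"
  shows "scalar_mats n \<lhd> GSp n J"
proof -
  let ?d = "2 * n"
  interpret G: group "GSp n J" using group_GSp[OF J] .
  have sub: "subgroup (scalar_mats n) (GSp n J)"
  proof (rule G.subgroupI)
    show "scalar_mats n \<subseteq> carrier (GSp n J)" by (rule scalar_mats_subset[OF J])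
    have "1 \<cdot>\<^sub>m 1\<^sub>m ?d \<in> (scalar_mats n :: 'a mat set)"
      unfolding scalar_mats_def mem_Collect_eq by (rule exI[of _ 1]) simp
    then show "scalar_mats n \<noteq> ({} :: 'a mat set)" by blast
  next
    fix a :: "'a mat" assume a: "a \<in> scalar_mats n"
    then obtain c where c: "a = c \<cdot>\<^sub>m 1\<^sub>m ?d" "c \<noteq> 0" by (auto simp: scalar_mats_def)
    let ?y = "inverse c \<cdot>\<^sub>m 1\<^sub>m ?d :: 'a mat"
    have y: "?y \<in> scalar_mats n" using c by (auto simp: scalar_mats_def)
    have "?y \<otimes>\<^bsub>GSp n J\<^esub> a = \<one>\<^bsub>GSp n J\<^esub>"
      using c by (auto simp: scalar_mats_mult intro!: eq_matI)
    then have "inv\<^bsub>GSp n J\<^esub> a = ?y"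
      using a y scalar_mats_subset[OF J] by (intro G.inv_equality) auto
    with y show "inv\<^bsub>GSp n J\<^esub> a \<in> scalar_mats n" by simp
  next
    fix a b :: "'a mat" assume "a \<in> scalar_mats n" "b \<in> scalar_mats n"
    then obtain c e where c: "a = c \<cdot>\<^sub>m 1\<^sub>m ?d" "c \<noteq> 0" "b = e \<cdot>\<^sub>m 1\<^sub>m ?d" "e \<noteq> 0"
      by (auto simp: scalar_mats_def)
    have "a \<otimes>\<^bsub>GSp n J\<^esub> b = (c * e) \<cdot>\<^sub>m 1\<^sub>m ?d"
      using c by (auto simp: scalar_mats_mult intro!: eq_matI)
    with c show "a \<otimes>\<^bsub>GSp n J\<^esub> b \<in> scalar_mats n"
      by (auto simp: scalar_mats_def intro!: exI[of _ "c * e"])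
  qed
  show ?thesis
  proof (rule G.normalI[OF sub], rule ballI)
    fix x assume "x \<in> carrier (GSp n J)"
    then have x: "x \<in> carrier_mat ?d ?d" by (auto simp: GSp_def carrier_GL)
    show "scalar_mats n #>\<^bsub>GSp n J\<^esub> x = x <#\<^bsub>GSp n J\<^esub> scalar_mats n"
      unfolding r_coset_def l_coset_def scalar_mats_def using x
      by (auto simp: scalar_mats_mult)
  qed
qed

lemma group_Q_Sp:
  fixes J :: "'a::field mat"
  assumes "J \<in> carrier_mat (2 * n) (2 * n)"
  shows "group (Q_Sp n J)"
proof -
  have "group (Gm :: 'a monoid)"
    by (rule groupI) (auto simp: Gm_def intro: exI[of _ "inverse _"])
  then show ?thesis
    unfolding Q_Sp_def PGSp_def
    by (intro DirProd_group normal.factorgroup_is_group normal_scalar_mats assms)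
qed

lemma Ad_smult:
  fixes g N :: "'a::field mat"
  assumes "g \<in> carrier (GL (2 * n))" "N \<in> carrier_mat (2 * n) (2 * n)" "c \<noteq> 0"
  shows "Ad n (c \<cdot>\<^sub>m g) N = Ad n g N"
proof -
  let ?d = "2 * n"
  obtain h where h: "g \<in> carrier_mat ?d ?d" "h \<in> carrier_mat ?d ?d" "h * g = 1\<^sub>m ?d"
      "g * h = 1\<^sub>m ?d"
    using assms by (auto simp: carrier_GL)
  have "inv\<^bsub>GL ?d\<^esub> (c \<cdot>\<^sub>m g) = inverse c \<cdot>\<^sub>m h"
    using h assms(3) by (intro GL_inv_eqI)
      (auto simp: mult_smult_distrib[of _ ?d ?d _ ?d] mult_smult_assoc_mat[of _ ?d ?d _ ?d]
        intro!: eq_matI)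
  moreover have "inv\<^bsub>GL ?d\<^esub> g = h" using h by (simp add: GL_inv_eqI)
  moreover have "(c \<cdot>\<^sub>m g) * N * (inverse c \<cdot>\<^sub>m h) = c \<cdot>\<^sub>m (inverse c \<cdot>\<^sub>m (g * N * h))"
    using h assms smult_smult_mat[of c "inverse c"] smult_smult_mat[of "inverse c" c]
    by (simp add: mult_smult_distrib[of _ ?d ?d _ ?d] mult_smult_assoc_mat[of _ ?d ?d _ ?d])
  moreover have "\<dots> = g * N * h" using h assms by (auto intro!: eq_matI)
  ultimately show ?thesis by (simp add: Ad_def)
qed

lemma map_fls_const_GL:
  assumes "g \<in> carrier (GL d)"
  shows "map_mat fls_const (g :: 'a::field mat) \<in> carrier (GL d)"
proof -
  interpret semiring_hom "fls_const :: 'a \<Rightarrow> 'a fls"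
    by unfold_locales (auto simp: fls_plus_const fls_const_mult_const)
  obtain h where h: "g \<in> carrier_mat d d" "h \<in> carrier_mat d d" "h * g = 1\<^sub>m d" "g * h = 1\<^sub>m d"
    using assms by (auto simp: carrier_GL)
  have "map_mat fls_const h * map_mat fls_const g = 1\<^sub>m d"
    "map_mat fls_const g * map_mat fls_const h = 1\<^sub>m d"
    using h by (metis mat_hom_mult mat_hom_one)+
  then show ?thesis unfolding carrier_GL using h by auto
qed

lemma Q_act_eq:
  fixes J :: "'a::field mat" and N :: "'a fls mat"
  assumes "J \<in> carrier_mat (2 * n) (2 * n)" "N \<in> carrier_mat (2 * n) (2 * n)"
    and g: "g \<in> carrier (GSp n J)"
  shows "Q_act n (scalar_mats n #>\<^bsub>GSp n J\<^esub> g, l) N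
    = Ad n (map_mat fls_const g) (map_mat (fls_rotate l) N)"
proof -
  let ?P = "scalar_mats n #>\<^bsub>GSp n J\<^esub> g"
  have gc: "g \<in> carrier (GL (2 * n))" "g \<in> carrier_mat (2 * n) (2 * n)"
    using g by (auto simp: GSp_def carrier_GL)
  have P: "?P = {c \<cdot>\<^sub>m g | c. c \<noteq> 0}"
    using gc by (auto simp: r_coset_def scalar_mats_def scalar_mats_mult)
  have "1 \<cdot>\<^sub>m g \<in> ?P" unfolding P mem_Collect_eq by (rule exI[of _ 1]) simp
  then have "(SOME x. x \<in> ?P) \<in> ?P" by (rule someI)
  then obtain c where c: "(SOME x. x \<in> ?P) = c \<cdot>\<^sub>m g" "c \<noteq> 0" unfolding P by auto
  have "map_mat fls_const (c \<cdot>\<^sub>m g) = fls_const c \<cdot>\<^sub>m map_mat fls_const g"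
    by (auto intro!: eq_matI simp: fls_const_mult_const)
  then show ?thesis
    using c gc assms Ad_smult[OF map_fls_const_GL[OF gc(1)], of "map_mat (fls_rotate l) N" "fls_const c"]
    by (simp add: Q_act_def fls_const_nonzero)
qed

end

theory Submission
  imports Defs "HOL-Library.Function_Algebras"
begin

text \<open>
  If \<open>f(\<lambda>) = ([g(\<lambda>)], \<lambda>\<^sup>r)\<close> almost commutes with \<open>N\<close> with exponent \<open>s\<close>, then comparing characteristic
  polynomials of \<open>N\<^sup>\<lambda>\<close> and \<open>\<lambda>\<^sup>s N\<close> shows that \<open>\<pi>\<^sup>e \<mu>\<^sup>n\<^sup>-\<^sup>i\<close> can occur in \<open>h\<close> only if \<open>re = 2si\<close>, so \<open>h\<close> is
  homogeneous with \<open>q = 2s/r\<close>.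

  Conversely let \<open>q = m/b\<close> in lowest terms. Then \<open>char(\<mu>) = \<Prod>\<^sub>j (\<mu>\<^sup>2\<^sup>b - \<alpha>\<^sub>j \<pi>\<^sup>m)\<close> with distinct nonzero \<open>\<alpha>\<^sub>j\<close>,
  and \<open>V\<^sub>F\<close> is the orthogonal sum of the kernels \<open>W\<^sub>j\<close> of \<open>N\<^sup>2\<^sup>b - \<alpha>\<^sub>j \<pi>\<^sup>m\<close>. On \<open>W\<^sub>j\<close> the operator \<open>N\<^sup>2\<close> generates a
  copy of \<open>K = k((\<pi>\<^sup>1\<^sup>/\<^sup>b))\<close>, and since every element of \<open>K\<close> is a norm from \<open>K[N]\<close>, there is a \<open>v\<^sub>j\<close> in \<open>W\<^sub>j\<close>
  with \<open>\<langle>v\<^sub>j, N\<^sup>i v\<^sub>j\<rangle> = \<delta>\<^sub>i\<^sub>,\<^sub>2\<^sub>b\<^sub>-\<^sub>1\<close> for \<open>i < 2b\<close>. In the basis \<open>N\<^sup>i v\<^sub>j\<close> the form is constant and depends only on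
  \<open>n\<close> and \<open>b\<close>, and \<open>N\<close> is a sum of companion matrices that almost commutes with the diagonal action of weight
  \<open>mi\<close> on \<open>N\<^sup>i v\<^sub>j\<close> and \<open>\<lambda>\<^sup>2\<^sup>b\<close> on \<open>\<pi>\<close>. A constant change of basis moves the form back to the given one. If
  \<open>q > 0\<close> this representative is integral and nilpotent modulo \<open>\<pi>\<close>; conversely, for a nil class the
  coefficient \<open>c\<^sub>n \<pi>\<^sup>q\<^sup>n = h(0)\<close>, a determinant, vanishes modulo \<open>\<pi>\<close>.
\<close>

subsection \<open>Norms in \<open>k((t))\<close>\<close>

text \<open>Hensel lifting of \<open>a\<close> to a square root of \<open>u\<close>: in degree
  \<open>n + 1\<close> the equation \<open>s^2 = u\<close> is linear in the new coefficient, with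
  factor \<open>2 * a\<close> from the two extreme terms of the convolution.\<close>

function fps_sqrt_coeff :: "'a::field \<Rightarrow> 'a fps \<Rightarrow> nat \<Rightarrow> 'a" where
  "fps_sqrt_coeff a u 0 = a"
| "fps_sqrt_coeff a u (Suc n) =
     (fps_nth u (Suc n) - (\<Sum>i\<in>{1..n}. fps_sqrt_coeff a u i * fps_sqrt_coeff a u (Suc n - i))) / (2 * a)"
  by pat_completeness auto
termination
  by (relation "measure (\<lambda>(a, u, n). n)") auto

lemma fps_is_square:
  fixes u :: "'a::field fps"
  assumes "(2 :: 'a) \<noteq> 0" "a \<noteq> 0" "fps_nth u 0 = a\<^sup>2"
  shows "\<exists>s. s\<^sup>2 = u"
proof
  show "(Abs_fps (fps_sqrt_coeff a u))\<^sup>2 = u"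
  proof (rule fps_ext)
    fix n
    show "fps_nth ((Abs_fps (fps_sqrt_coeff a u))\<^sup>2) n = fps_nth u n"
    proof (cases n)
      case 0
      then show ?thesis using assms by (simp add: power2_eq_square fps_mult_nth)
    next
      case (Suc m)
      let ?f = "\<lambda>i. fps_sqrt_coeff a u i * fps_sqrt_coeff a u (Suc m - i)"
      have "fps_nth ((Abs_fps (fps_sqrt_coeff a u))\<^sup>2) n = (\<Sum>i=0..Suc m. ?f i)"
        by (simp add: power2_eq_square fps_mult_nth Suc)
      also have "\<dots> = ?f 0 + (\<Sum>i=1..m. ?f i) + ?f (Suc m)"
        by (simp add: sum.atLeast_Suc_atMost)
      also have "?f 0 = a * fps_sqrt_coeff a u (Suc m)" by simp
      also have "?f (Suc m) = a * fps_sqrt_coeff a u (Suc m)" by simp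
      finally have *: "fps_nth ((Abs_fps (fps_sqrt_coeff a u))\<^sup>2) n =
          2 * a * fps_sqrt_coeff a u (Suc m) + (\<Sum>i=1..m. ?f i)"
        by (simp add: algebra_simps del: fps_sqrt_coeff.simps)
      show ?thesis unfolding * using assms by (simp add: Suc)
    qed
  qed
qed

text \<open>An even power of the variable is a square, and the constant term of the remaining unit
  has a nonzero square root because \<open>'k\<close> is algebraically closed; Hensel lifting does
  the rest.\<close>

lemma fls_is_square:
  fixes z :: "'k::alg_closed_field fls"
  assumes two: "(2 :: 'k) \<noteq> 0" and ev: "even (fls_subdegree z)"
  shows "\<exists>s. s\<^sup>2 = z"
proof (cases "z = 0")
  case False
  let ?u = "fls_base_factor_to_fps z"
  have u0: "fps_nth ?u 0 \<noteq> 0" using False by simp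
  obtain a where a: "a ^ 2 = fps_nth ?u 0"
    using nth_root_exists[of 2 "fps_nth ?u 0"] by auto
  with u0 have "a \<noteq> 0" by auto
  then obtain s where s: "s\<^sup>2 = ?u" using fps_is_square[OF two _ a[symmetric]] by blast
  obtain e where e: "fls_subdegree z = 2 * e" using ev by blast
  have "(fls_X_intpow e * fps_to_fls s)\<^sup>2 = fls_X_intpow (fls_subdegree z) * fps_to_fls ?u"
    unfolding s[symmetric] fps_to_fls_power power_mult_distrib fls_X_intpow_power e by simp
  also have "\<dots> = z"
    by (metis fls_X_intpow_times_conv_shift(1) fls_conv_base_factor_to_fps_shift_subdegree)
  finally show ?thesis by blast
qed (auto intro: exI[of _ 0])

text \<open>Even valuation suffices for being a square, which leaves three cases: \<open>z\<close>
  is a square; \<open>- z / g\<close> is one; or \<open>g\<close> is one and the form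
  \<open>x^2 - g y^2\<close> is a hyperbolic plane.\<close>

lemma fls_norm_surj:
  fixes g z :: "'k::alg_closed_field fls"
  assumes two: "(2 :: 'k) \<noteq> 0" and "g \<noteq> 0"
  shows "\<exists>x y. z = x\<^sup>2 - g * y\<^sup>2"
proof -
  have two': "(2 :: 'k fls) \<noteq> 0"
    using two by (metis fls_const_eq_0_iff fls_const_numeral)
  consider "even (fls_subdegree z)" | "z \<noteq> 0" "odd (fls_subdegree z)" "odd (fls_subdegree g)"
    | "even (fls_subdegree g)" by fastforce
  then show ?thesis
  proof cases
    case 1
    then obtain s where "s\<^sup>2 = z" using fls_is_square[OF two] by blast
    then show ?thesis by (intro exI[of _ s] exI[of _ 0]) simp
  next
    case 2
    then have "even (fls_subdegree (- z / g))"
      using assms(2) by (simp add: fls_divide_subdegree)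
    then obtain s where "s\<^sup>2 = - z / g" using fls_is_square[OF two] by blast
    then show ?thesis using assms(2) by (intro exI[of _ 0] exI[of _ s]) simp
  next
    case 3
    then obtain s where s: "s\<^sup>2 = g" using fls_is_square[OF two] by blast
    with assms(2) have "s \<noteq> 0" by auto
    \<comment> \<open>The witnesses solve \<open>x - s * y = 1\<close> and
      \<open>x + s * y = z\<close>.\<close>
    have "((z + 1) / 2)\<^sup>2 - g * ((z - 1) / (2 * s))\<^sup>2 = ((z + 1)\<^sup>2 - (z - 1)\<^sup>2) / 2\<^sup>2"
      unfolding s[symmetric] power_divide power_mult_distrib using \<open>s \<noteq> 0\<close>
      by (simp add: diff_divide_distrib del: power_numeral)
    also have "(z + 1)\<^sup>2 - (z - 1)\<^sup>2 = 2\<^sup>2 * z" by (simp add: power2_eq_square algebra_simps)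
    finally have "z = ((z + 1) / 2)\<^sup>2 - g * ((z - 1) / (2 * s))\<^sup>2"
      using two' by (metis nonzero_mult_div_cancel_left power_not_zero)
    then show ?thesis by blast
  qed
qed

text \<open>With \<open>F\<close> embedded in \<open>K = k((t))\<close> by
  \<open>\<pi> = t^b\<close>, this is the \<open>F\<close>-linear projection of \<open>K\<close>
  onto \<open>F\<close> along the powers of \<open>t\<close> with exponent not divisible by
  \<open>b\<close>. It takes the place of the trace from \<open>K\<close> to \<open>F\<close>, which
  vanishes when the characteristic divides \<open>b\<close>.\<close>

definition fls_section :: "nat \<Rightarrow> 'a::zero fls \<Rightarrow> 'a fls" where
  "fls_section b z = Abs_fls (\<lambda>e. fls_nth z (int b * e))"

lemma fls_section_nth [simp]:
  assumes "b > 0"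
  shows "fls_nth (fls_section b z) e = fls_nth z (int b * e)"
proof -
  have "\<exists>N. \<forall>e<N. fls_nth z (int b * e) = 0"
  proof (intro exI allI impI)
    fix e assume e: "e < min 0 (fls_subdegree z)"
    then have "int b * e \<le> 1 * e"
      using assms by (intro mult_right_mono_neg) auto
    then have "int b * e < fls_subdegree z" using e by linarith
    then show "fls_nth z (int b * e) = 0" by simp
  qed
  then show ?thesis unfolding fls_section_def
    by (auto intro: nth_Abs_fls_lower_bound)
qed

lemma fls_section_add: "b > 0 \<Longrightarrow> fls_section b (x + y) = fls_section b x + fls_section b (y :: 'a::comm_monoid_add fls)"
  by (rule fls_eqI) simp

lemma fls_section_0: "b > 0 \<Longrightarrow> fls_section b 0 = 0"
  by (rule fls_eqI) simp

lemma fls_section_sum: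
  "b > 0 \<Longrightarrow> fls_section b (\<Sum>i\<in>A. f i :: 'a::comm_monoid_add fls) = (\<Sum>i\<in>A. fls_section b (f i))"
  by (induction A rule: infinite_finite_induct) (simp_all add: fls_section_add fls_section_0)

text \<open>Summands outside the natural range vanish, so the range may be widened until two
  convolutions can be compared term by term.\<close>

lemma fls_times_nth_bounds:
  fixes f g :: "'a::semiring_0 fls"
  assumes "lo \<le> fls_subdegree f" "n - fls_subdegree g \<le> hi"
  shows "fls_nth (f * g) n = (\<Sum>i=lo..hi. fls_nth f i * fls_nth g (n - i))"
  unfolding fls_times_nth(2)
  by (rule sum.mono_neutral_left) (use assms in \<open>auto simp: not_le\<close>)

text \<open>Only exponents divisible by \<open>b\<close> occur in
  \<open>fls_compose_power f b\<close>; dividing these indices by \<open>b\<close> turns the left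
  convolution into the right one. This is the \<open>F\<close>-linearity of the projection.\<close>

lemma fls_section_compose_mult:
  fixes f z :: "'a::idom fls"
  assumes b: "b > 0"
  shows "fls_section b (fls_compose_power f b * z) = f * fls_section b z"
proof (rule fls_eqI)
  fix e
  let ?s = "fls_section b z"
  \<comment> \<open>The absolute values make \<open>lo \<le> 0 \<le> hi\<close>, so multiplying the
    bounds by \<open>b\<close> only widens the range, and one pair of bounds serves both
    convolutions.\<close>
  define lo where "lo = - \<bar>fls_subdegree f\<bar> - \<bar>fls_subdegree (fls_compose_power f b)\<bar>"
  define hi where "hi = \<bar>e\<bar> * int b + \<bar>fls_subdegree z\<bar> + \<bar>fls_subdegree ?s\<bar>"
  have le: "x \<le> x * int b" if "x \<ge> 0" for x
    using mult_left_mono[of 1 "int b" x] that b by simp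
  have lo: "lo \<le> 0" "lo \<le> fls_subdegree f" "lo \<le> fls_subdegree (fls_compose_power f b)"
    unfolding lo_def by linarith+
  have hi: "hi \<ge> 0" "e * int b - fls_subdegree z \<le> hi" "e - fls_subdegree ?s \<le> hi"
    unfolding hi_def using le[of "\<bar>e\<bar>"] mult_right_mono[of e "\<bar>e\<bar>" "int b"] by linarith+
  have "int b * lo \<le> lo" "hi \<le> int b * hi"
    using le[of "-lo"] le[of hi] lo(1) hi(1) by (simp_all add: mult.commute)
  then have A: "int b * lo \<le> fls_subdegree (fls_compose_power f b)"
      "int b * e - fls_subdegree z \<le> int b * hi" "lo \<le> fls_subdegree f" "e - fls_subdegree ?s \<le> hi"
    using lo hi by (simp_all add: mult.commute)
  have "fls_nth (fls_section b (fls_compose_power f b * z)) e =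
      (\<Sum>i=int b*lo..int b*hi. fls_nth (fls_compose_power f b) i * fls_nth z (int b * e - i))"
    using b A by (simp add: fls_times_nth_bounds)
  also have "\<dots> = (\<Sum>i\<in>(*) (int b) ` {lo..hi}. fls_nth (fls_compose_power f b) i * fls_nth z (int b * e - i))"
    by (rule sum.mono_neutral_right)
       (use b in \<open>auto simp: fls_nth_compose_power dvd_def image_iff elim!: ballE[where x = "_ div int b"]\<close>)
  also have "\<dots> = (\<Sum>i=lo..hi. fls_nth f i * fls_nth ?s (e - i))"
    using b by (subst sum.reindex) (auto simp: inj_on_def fls_nth_compose_power algebra_simps)
  also have "\<dots> = fls_nth (f * ?s) e"
    using A by (simp add: fls_times_nth_bounds)
  finally show "fls_nth (fls_section b (fls_compose_power f b * z)) e = fls_nth (f * ?s) e" .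
qed

lemma fls_const_X_power_int:
  fixes c :: "'a::field"
  shows "(fls_const c * fls_X_intpow m) powi i = fls_const (c powi i) * fls_X_intpow (m * i)"
proof -
  have "fls_X_intpow m powi i = (fls_X_intpow (m * i) :: 'a fls)"
    by (metis fls_X_power_int power_int_mult)
  then show ?thesis by (simp add: power_int_mult_distrib fls_const_power_int)
qed

subsection \<open>The normal form on a single block\<close>

lemma fls_nth_mult_monom:
  fixes x :: "'a::comm_semiring_1 fls"
  shows "fls_nth (x * (fls_const c * fls_X_intpow k)) n = c * fls_nth x (n - k)"
proof -
  have "x * (fls_const c * fls_X_intpow k) = fls_const c * (fls_X_intpow k * x)"
    by (simp only: mult_ac)
  also have "fls_X_intpow k * x = fls_shift (- k) x"
    by (rule fls_X_intpow_times_conv_shift(1))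
  finally show ?thesis by simp
qed

text \<open>An abstract block: \<open>W\<close> plays the role of one \<open>W_j\<close>.
  Coprimality of \<open>m\<close> and \<open>b\<close> makes \<open>X^b - \<alpha> \<pi>^m\<close>
  irreducible over \<open>F\<close>, which is why \<open>N^2\<close> generates a field on
  \<open>W\<close>.\<close>

locale pure_skew_operator = vector_space scale
  for scale :: "'k::alg_closed_field fls \<Rightarrow> 'v::ab_group_add \<Rightarrow> 'v" (infixr "*s" 75) +
  fixes N :: "'v \<Rightarrow> 'v" and B :: "'v \<Rightarrow> 'v \<Rightarrow> 'k fls" and W :: "'v set"
    and b :: nat and m :: int and \<alpha> :: 'k
  assumes N_add: "N (x + y) = N x + N y" and N_scale: "N (c *s x) = c *s N x"
    and B_add_left: "B (x + y) z = B x z + B y z" and B_add_right: "B x (y + z) = B x y + B x z"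
    and B_scale_left: "B (c *s x) y = c * B x y"
    and B_alt: "B x x = 0" and B_skew: "B (N x) y = - B x (N y)"
    and W_add: "x \<in> W \<Longrightarrow> y \<in> W \<Longrightarrow> x + y \<in> W" and W_scale: "x \<in> W \<Longrightarrow> c *s x \<in> W"
    and W_N: "x \<in> W \<Longrightarrow> N x \<in> W"
    and W_nondeg: "x \<in> W \<Longrightarrow> x \<noteq> 0 \<Longrightarrow> \<exists>y\<in>W. B y x \<noteq> 0"
    and W_nontriv: "\<exists>x\<in>W. x \<noteq> 0"
    and W_pow: "x \<in> W \<Longrightarrow> (N ^^ (2 * b)) x = (fls_const \<alpha> * fls_X_intpow m) *s x"
    and two: "(2 :: 'k) \<noteq> 0" and b_pos: "b > 0" and coprime: "coprime m (int b)" and \<alpha>: "\<alpha> \<noteq> 0"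
begin

sublocale N: additive N by standard (rule N_add)

lemma B_anti: "B x y = - B y x"
proof -
  have "B (x + y) x + B (x + y) y = 0" by (simp only: B_alt flip: B_add_right)
  then show ?thesis by (simp add: B_add_left B_add_right B_alt eq_neg_iff_add_eq_0 add.commute)
qed

lemma B_scale_right: "B x (c *s y) = c * B x y"
  using B_anti[of x] B_anti[of y] by (metis B_scale_left mult_minus_right)

lemma B_sum_left: "B (\<Sum>i\<in>A. f i) y = (\<Sum>i\<in>A. B (f i) y)"
proof -
  interpret additive "\<lambda>x. B x y" by standard (rule B_add_left)
  show ?thesis by (rule sum)
qed

lemma B_sum_right: "B y (\<Sum>i\<in>A. f i) = (\<Sum>i\<in>A. B y (f i))"
proof -
  interpret additive "B y" by standard (rule B_add_right)
  show ?thesis by (rule sum)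
qed

lemma Npow_add: "(N ^^ i) (x + y) = (N ^^ i) x + (N ^^ i) y"
  by (induction i) (simp_all add: N_add)

lemma Npow_scale: "(N ^^ i) (c *s x) = c *s (N ^^ i) x"
  by (induction i) (simp_all add: N_scale)

lemma Npow_W: "x \<in> W \<Longrightarrow> (N ^^ i) x \<in> W"
  by (induction i) (simp_all add: W_N)

lemma Npow_swap: "(N ^^ i) (N x) = N ((N ^^ i) x)"
  by (simp add: funpow_swap1)

lemma B_Npow: "B ((N ^^ i) x) y = (- 1) ^ i * B x ((N ^^ i) y)"
  by (induction i arbitrary: y) (simp_all add: B_skew Npow_swap)

text \<open>Moving half of the factors to the other side leaves \<open>B y y\<close> with
  \<open>y = N^i x\<close>.\<close>

lemma B_Npow_even: "B x ((N ^^ (2 * i)) x) = 0"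
  using B_Npow[of i x "(N ^^ i) x"] by (simp add: B_alt mult_2 funpow_add)

text \<open>
  On \<open>W\<close> the operator \<open>N\<^sup>2\<close> generates the field \<open>K = k((\<pi>\<^sup>1\<^sup>/\<^sup>b))\<close>: with \<open>t = \<pi>\<^sup>1\<^sup>/\<^sup>b\<close> it acts as
  \<open>\<gamma> = \<beta> t\<^sup>m\<close>, and \<open>1, \<gamma>, \<dots>, \<gamma>\<^sup>b\<^sup>-\<^sup>1\<close> is an \<open>F\<close>-basis of \<open>K\<close>.
\<close>

definition \<beta> :: 'k where "\<beta> = (SOME x. x ^ b = \<alpha>)"

definition \<gamma> :: "'k fls" where "\<gamma> = fls_const \<beta> * fls_X_intpow m"

lemma \<beta>: "\<beta> ^ b = \<alpha>"
  unfolding \<beta>_def by (rule someI_ex) (use nth_root_exists[of b \<alpha>] b_pos in auto)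

lemma \<beta>_nz: "\<beta> \<noteq> 0"
  using \<beta> \<alpha> b_pos by auto

lemma \<gamma>_nz: "\<gamma> \<noteq> 0"
  unfolding \<gamma>_def using \<beta>_nz by simp

lemma \<gamma>_pow_b: "\<gamma> ^ b = fls_compose_power (fls_const \<alpha> * fls_X_intpow m) b"
  using b_pos by (simp add: \<gamma>_def power_mult_distrib fls_X_intpow_power \<beta> flip: fls_const_power)

abbreviation \<tau> :: "'k fls \<Rightarrow> 'k fls" where "\<tau> \<equiv> fls_section b"
abbreviation \<iota> :: "'k fls \<Rightarrow> 'k fls" where "\<iota> f \<equiv> fls_compose_power f b"

lemma \<gamma>_powi: "\<gamma> powi i = fls_const (\<beta> powi i) * fls_X_intpow (m * i)"
  unfolding \<gamma>_def by (rule fls_const_X_power_int)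

lemma \<gamma>_powi_nth: "fls_nth (\<gamma> powi i) e = (if e = m * i then \<beta> powi i else 0)"
  by (simp add: \<gamma>_powi)

text \<open>\<open>\<gamma> powi i\<close> is a monomial of exponent \<open>m * i\<close>, and
  coprimality keeps this from being a multiple of \<open>b\<close>. With \<open>\<tau> 1 = 1\<close>
  it follows that the families \<open>\<gamma> ^ r\<close> and
  \<open>\<gamma> powi (- int r)\<close>, \<open>r < b\<close>, are dual for the pairing
  \<open>\<tau> (x * y)\<close>.\<close>

lemma \<tau>_\<gamma>_eq_0: "i \<noteq> 0 \<Longrightarrow> \<bar>i\<bar> < int b \<Longrightarrow> \<tau> (\<gamma> powi i) = 0"
proof (rule fls_eqI)
  fix e assume "i \<noteq> 0" "\<bar>i\<bar> < int b"
  then have "\<not> int b dvd m * i"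
    using coprime by (metis coprime_commute coprime_dvd_mult_right_iff dvd_imp_le_int abs_of_nat not_le)
  then have "int b * e \<noteq> m * i" by (metis dvd_triv_left)
  then show "fls_nth (\<tau> (\<gamma> powi i)) e = fls_nth 0 e"
    using b_pos by (simp add: \<gamma>_powi_nth)
qed

lemma \<tau>_1: "\<tau> 1 = 1"
  using b_pos by (intro fls_eqI) simp

text \<open>The coordinates are read off with the dual basis. The term of index \<open>r\<close>
  contributes exactly the exponents congruent to \<open>m * r\<close> modulo \<open>b\<close>, and
  every residue class is hit once.\<close>

lemma K_expansion: "z = (\<Sum>r<b. \<iota> (\<tau> (z * \<gamma> powi (- int r))) * \<gamma> ^ r)"
proof (rule fls_eqI)
  fix e
  obtain u v where uv: "u * m + v * int b = 1"
    using coprime by (metis bezout_int coprime_iff_gcd_eq_1)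
  \<comment> \<open>By the Bezout relation \<open>u\<close> inverts \<open>m\<close> modulo
    \<open>b\<close>, so this is the only \<open>r < b\<close> with \<open>m * r\<close> congruent
    to \<open>e\<close>.\<close>
  let ?r = "nat ((u * e) mod int b)"
  have r: "?r < b" using b_pos by (simp add: nat_less_iff)
  have nth: "fls_nth (\<iota> (\<tau> (z * \<gamma> powi (- int r))) * \<gamma> ^ r) e =
      (if int b dvd e - m * int r then fls_nth z e else 0)" if "r < b" for r
  proof -
    have nth1: "\<gamma> ^ r = fls_const (\<beta> ^ r) * fls_X_intpow (m * int r)"
      using \<gamma>_powi[of "int r"] by simp
    have "\<gamma> powi (- int r) = fls_const (inverse \<beta> ^ r) * fls_X_intpow (- (m * int r))"
      unfolding \<gamma>_powi by (simp add: power_int_minus power_inverse)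
    then have nth2: "fls_nth (z * \<gamma> powi (- int r)) i = inverse \<beta> ^ r * fls_nth z (i + m * int r)" for i
      using fls_nth_mult_monom[of z "inverse \<beta> ^ r" "- (m * int r)"] by simp
    show ?thesis
      using b_pos \<beta>_nz
      by (simp only: nth1 nth2 fls_nth_mult_monom fls_nth_compose_power[OF b_pos] fls_section_nth[OF b_pos])
        (simp add: power_inverse)
  qed
  have iff: "int b dvd e - m * int r \<longleftrightarrow> r = ?r" if "r < b" for r
  proof
    assume "r = ?r"
    then have "int r = (u * e) mod int b" using b_pos by simp
    then obtain w where "u * e = int b * w + int r" by (metis mult_div_mod_eq)
    moreover have "e = m * (u * e) + int b * v * e"
      using arg_cong[OF uv, of "\<lambda>x. x * e"] by (simp add: algebra_simps)
    ultimately have "e - m * int r = int b * (v * e + m * w)" by (simp add: algebra_simps)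
    then show "int b dvd e - m * int r" by simp
  next
    assume "int b dvd e - m * int r"
    then obtain w where w: "e - m * int r = int b * w" by (auto elim: dvdE)
    have "int r = u * (e - int b * w) + v * int b * int r"
      using arg_cong[OF uv, of "\<lambda>x. x * int r"] w by (simp add: algebra_simps)
    then have "int r = u * e + int b * (v * int r - u * w)" by (simp add: algebra_simps)
    then have "int r mod int b = (u * e) mod int b" by (metis mod_mult_self2)
    then show "r = ?r" using that by simp
  qed
  have "fls_nth (\<Sum>r<b. \<iota> (\<tau> (z * \<gamma> powi (- int r))) * \<gamma> ^ r) e =
      (\<Sum>r<b. if r = ?r then fls_nth z e else 0)"
    unfolding fls_nth_sum by (intro sum.cong) (use nth iff in auto)
  also have "\<dots> = fls_nth z e" using r by simp
  finally show "fls_nth z e = fls_nth (\<Sum>r<b. \<iota> (\<tau> (z * \<gamma> powi (- int r))) * \<gamma> ^ r) e" ..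
qed

text \<open>The action of \<open>K\<close> in which \<open>\<gamma>\<close> acts as
  \<open>N^2\<close>, through the coordinates of \<open>z\<close> in the basis
  \<open>\<gamma> ^ r\<close>. It is defined on all vectors and is a module structure on
  \<open>W\<close>, where \<open>N^(2b)\<close> is the scalar
  \<open>\<alpha> \<pi>^m\<close>.\<close>

definition act :: "'k fls \<Rightarrow> 'v \<Rightarrow> 'v" (infixr "\<triangleright>" 75) where
  "z \<triangleright> v = (\<Sum>r<b. \<tau> (z * \<gamma> powi (- int r)) *s (N ^^ (2 * r)) v)"

lemma act_add_left: "(y + z) \<triangleright> v = y \<triangleright> v + z \<triangleright> v"
  using b_pos by (simp add: act_def distrib_right fls_section_add scale_left_distrib sum.distrib)

lemma act_add_right: "z \<triangleright> (v + w) = z \<triangleright> v + z \<triangleright> w"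
  by (simp add: act_def Npow_add scale_right_distrib sum.distrib)

lemma act_0_left: "0 \<triangleright> v = 0"
  using b_pos by (simp add: act_def fls_section_0)

lemma act_sum_left: "(\<Sum>i\<in>A. f i) \<triangleright> v = (\<Sum>i\<in>A. f i \<triangleright> v)"
  by (induction A rule: infinite_finite_induct) (simp_all add: act_add_left act_0_left)

lemma W_0: "0 \<in> W"
  using W_nontriv W_scale[of _ 0] by auto

lemma act_W: "v \<in> W \<Longrightarrow> z \<triangleright> v \<in> W"
proof -
  assume v: "v \<in> W"
  have "(\<Sum>r\<in>A. \<tau> (z * \<gamma> powi (- int r)) *s (N ^^ (2 * r)) v) \<in> W" if "finite A" for A
    using that by (induction A) (use v in \<open>simp_all add: W_0 W_add W_scale Npow_W\<close>)
  then show ?thesis by (simp add: act_def)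
qed

lemma act_compose: "(\<iota> f * z) \<triangleright> v = f *s (z \<triangleright> v)"
  using b_pos by (simp add: act_def mult.assoc fls_section_compose_mult scale_sum_right)

lemma act_N: "z \<triangleright> N v = N (z \<triangleright> v)"
  by (simp add: act_def N.sum N_scale Npow_swap)

lemma act_self_adjoint: "B (z \<triangleright> v) w = B v (z \<triangleright> w)"
  by (simp add: act_def B_sum_left B_sum_right B_scale_left B_scale_right B_Npow)

lemma act_1: "1 \<triangleright> v = v"
proof -
  have "1 \<triangleright> v = (\<Sum>r<b. if r = 0 then v else 0)"
    unfolding act_def by (intro sum.cong) (auto simp: \<tau>_\<gamma>_eq_0 \<tau>_1)
  then show ?thesis using b_pos by simp
qed

text \<open>Multiplication by \<open>\<gamma>\<close> shifts the coordinates by one place. The top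
  one wraps around with the factor \<open>\<gamma> ^ b\<close>, the image of
  \<open>\<alpha> \<pi>^m\<close> in \<open>K\<close>, and on \<open>W\<close> this scalar is
  \<open>N^(2b)\<close>.\<close>

lemma act_\<gamma>:
  assumes "v \<in> W"
  shows "(\<gamma> * z) \<triangleright> v = N (N (z \<triangleright> v))"
proof -
  obtain c where c: "b = Suc c" using b_pos by (cases b) auto
  have shift: "\<gamma> * z * \<gamma> powi (- int (Suc r)) = z * \<gamma> powi (- int r)" for r
  proof -
    have "\<gamma> powi (- int r) = \<gamma> * \<gamma> powi (- int (Suc r))"
      using \<gamma>_nz by (simp flip: power_int_add_1')
    then show ?thesis by (simp add: mult_ac)
  qed
  have "\<gamma> * z = \<gamma> ^ b * (z * \<gamma> powi (- int c))"
    using \<gamma>_nz by (simp add: c power_int_minus field_simps)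
  then have last: "\<tau> (\<gamma> * z) = (fls_const \<alpha> * fls_X_intpow m) * \<tau> (z * \<gamma> powi (- int c))"
    by (simp only: \<gamma>_pow_b fls_section_compose_mult[OF b_pos])
  have "(\<gamma> * z) \<triangleright> v = \<tau> (\<gamma> * z) *s v + (\<Sum>r<c. \<tau> (z * \<gamma> powi (- int r)) *s (N ^^ (2 * Suc r)) v)"
    unfolding act_def by (subst (1) c) (simp only: sum.lessThan_Suc_shift shift, simp)
  also have "\<tau> (\<gamma> * z) *s v = \<tau> (z * \<gamma> powi (- int c)) *s (N ^^ (2 * Suc c)) v"
    using W_pow[OF assms] by (simp only: c[symmetric] last scale_scale) (simp only: mult.commute)
  also have "\<dots> + (\<Sum>r<c. \<tau> (z * \<gamma> powi (- int r)) *s (N ^^ (2 * Suc r)) v) =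
      (\<Sum>r<b. \<tau> (z * \<gamma> powi (- int r)) *s (N ^^ (2 * Suc r)) v)"
    unfolding c by simp
  also have "\<dots> = N (N (z \<triangleright> v))" by (simp add: act_def N.sum N_scale)
  finally show ?thesis .
qed

lemma act_\<gamma>_pow: "v \<in> W \<Longrightarrow> (\<gamma> ^ i * z) \<triangleright> v = (N ^^ (2 * i)) (z \<triangleright> v)"
  by (induction i) (simp_all add: act_\<gamma> mult.assoc)

text \<open>Expanding the left factor \<open>y\<close> reduces the claim to scalars from
  \<open>F\<close> and powers of \<open>\<gamma>\<close>.\<close>

lemma act_mult:
  assumes "v \<in> W"
  shows "(y * z) \<triangleright> v = y \<triangleright> z \<triangleright> v"
proof -
  have "(y * z) \<triangleright> v = (\<Sum>r<b. \<iota> (\<tau> (y * \<gamma> powi (- int r))) * (\<gamma> ^ r * z)) \<triangleright> v"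
    by (subst (1) K_expansion[of y]) (simp only: sum_distrib_right mult.assoc)
  also have "\<dots> = y \<triangleright> z \<triangleright> v"
    unfolding act_sum_left act_compose act_\<gamma>_pow[OF assms] by (simp only: act_def[of y])
  finally show ?thesis .
qed

text \<open>The element of \<open>K\<close> that represents the \<open>F\<close>-linear functional
  taking \<open>z\<close> to \<open>B v (N (z \<triangleright> v))\<close> under the pairing
  \<open>\<tau> (x * y)\<close>; hence the dual basis in its expansion.\<close>

definition form_coeff :: "'v \<Rightarrow> 'k fls" where
  "form_coeff v = (\<Sum>r<b. \<iota> (B v (N ((N ^^ (2 * r)) v))) * \<gamma> powi (- int r))"

lemma form_coeff: "B v (N (z \<triangleright> v)) = \<tau> (form_coeff v * z)"
proof -
  have "\<tau> (form_coeff v * z) = (\<Sum>r<b. \<tau> (\<iota> (B v (N ((N ^^ (2 * r)) v))) * (z * \<gamma> powi (- int r))))"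
    using b_pos by (simp add: form_coeff_def sum_distrib_right sum_distrib_left fls_section_sum mult_ac)
  also have "\<dots> = B v (N (z \<triangleright> v))"
    unfolding fls_section_compose_mult[OF b_pos]
    by (simp add: act_def N.sum N_scale B_sum_right B_scale_right mult.commute)
  finally show ?thesis ..
qed

text \<open>\<open>B u (N v)\<close> is symmetric in \<open>u\<close> and \<open>v\<close>, so in
  characteristic not 2 it vanishes on \<open>W\<close> as soon as its quadratic form does.
  Nondegeneracy then gives \<open>N = 0\<close> on \<open>W\<close>, against the nonzero scalar
  \<open>N^(2b)\<close>.\<close>

lemma exists_anisotropic: "\<exists>v\<in>W. B v (N v) \<noteq> 0"
proof (rule ccontr)
  assume "\<not> ?thesis"
  then have iso: "B v (N v) = 0" if "v \<in> W" for v using that by blast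
  have two': "(2 :: 'k fls) \<noteq> 0" using two by (metis fls_const_eq_0_iff fls_const_numeral)
  have zero: "B u (N v) = 0" if "u \<in> W" "v \<in> W" for u v
  proof -
    have "B (u + v) (N (u + v)) = 0" using that by (intro iso W_add)
    then have "B u (N v) + B v (N u) = 0"
      using that by (simp add: N_add B_add_left B_add_right iso add.commute)
    moreover have "B v (N u) = B u (N v)"
      using B_skew[of v u] B_anti[of "N v" u] by simp
    ultimately have "2 * B u (N v) = 0" by simp
    with two' show ?thesis by simp
  qed
  have N0: "N v = 0" if "v \<in> W" for v
    using W_nondeg[of "N v"] W_N[OF that] zero that by blast
  obtain x where x: "x \<in> W" "x \<noteq> 0" using W_nontriv by blast
  have "(N ^^ (2 * b)) x = 0"
    using b_pos N0[OF Npow_W[OF x(1)]] by (cases b) (simp_all add: N.zero)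
  then show False using W_pow[OF x(1)] x \<alpha> by simp
qed

text \<open>
  Replacing \<open>v\<close> by \<open>(x + y N) v\<close> multiplies the coefficient of the form by the norm
  \<open>x\<^sup>2 - \<gamma> y\<^sup>2\<close> from \<open>K[N]\<close> to \<open>K\<close>, and every element of \<open>K\<close> is a norm.
\<close>

lemma form_coeff_norm:
  assumes v: "v \<in> W" and w: "w = x \<triangleright> v + y \<triangleright> N v"
  shows "B w (N (z \<triangleright> w)) = \<tau> (form_coeff v * (x\<^sup>2 - \<gamma> * y\<^sup>2) * z)"
proof -
  note Wv = v W_N[OF v]
  have "B w (N (z \<triangleright> w)) = B v (N ((x\<^sup>2 * z) \<triangleright> v)) + B v (N ((x * y * z) \<triangleright> N v))
      + (B (N v) (N ((x * y * z) \<triangleright> v)) + B (N v) (N ((y\<^sup>2 * z) \<triangleright> N v)))"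
    unfolding w by (simp add: act_add_right N_add B_add_left B_add_right act_self_adjoint
        act_N[symmetric] Wv W_N[OF Wv(2)] act_mult[symmetric] power2_eq_square mult_ac)
  \<comment> \<open>The cross terms cancel because \<open>N\<close> is skew and commutes with the
    action of \<open>K\<close>.\<close>
  also have "B v (N ((x * y * z) \<triangleright> N v)) + B (N v) (N ((x * y * z) \<triangleright> v)) = 0"
    by (simp add: B_skew act_N)
  then have "B v (N ((x\<^sup>2 * z) \<triangleright> v)) + B v (N ((x * y * z) \<triangleright> N v))
      + (B (N v) (N ((x * y * z) \<triangleright> v)) + B (N v) (N ((y\<^sup>2 * z) \<triangleright> N v))) =
      B v (N ((x\<^sup>2 * z) \<triangleright> v)) + B (N v) (N ((y\<^sup>2 * z) \<triangleright> N v))"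
    by (simp add: algebra_simps)
  \<comment> \<open>Skewness turns this into \<open>N^2 = \<gamma>\<close> with a minus sign, the
    source of the term \<open>- \<gamma> * y^2\<close> in the norm.\<close>
  also have "B (N v) (N ((y\<^sup>2 * z) \<triangleright> N v)) = - B v (N ((\<gamma> * (y\<^sup>2 * z)) \<triangleright> v))"
    by (simp add: B_skew act_N act_\<gamma>[OF v])
  also have "B v (N ((x\<^sup>2 * z) \<triangleright> v)) + - B v (N ((\<gamma> * (y\<^sup>2 * z)) \<triangleright> v)) =
      \<tau> (form_coeff v * (x\<^sup>2 * z)) + \<tau> (- (form_coeff v * (\<gamma> * (y\<^sup>2 * z))))"
    using b_pos by (simp add: form_coeff) (intro fls_eqI, simp)
  also have "\<dots> = \<tau> (form_coeff v * (x\<^sup>2 - \<gamma> * y\<^sup>2) * z)"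
    using b_pos by (simp add: fls_section_add[symmetric] algebra_simps)
  finally show ?thesis .
qed

text \<open>Choosing the norm so that the form coefficient of \<open>w\<close> becomes
  \<open>\<gamma> powi (- int (b - 1))\<close> turns the pairing with the odd power
  \<open>2 * l + 1\<close> into \<open>\<tau>\<close> of \<open>\<gamma>\<close> to the power
  \<open>l - (b - 1)\<close>, which is nonzero only for \<open>l = b - 1\<close>. Even powers pair
  to zero by skewness.\<close>

theorem exists_normalized_cyclic:
  "\<exists>v\<in>W. \<forall>i<2*b. B v ((N ^^ i) v) = (if i = 2 * b - 1 then 1 else 0)"
proof -
  obtain v where v: "v \<in> W" "B v (N v) \<noteq> 0" using exists_anisotropic by blast
  have nz: "form_coeff v \<noteq> 0"
    using form_coeff[of v 1] v(2) b_pos by (auto simp: act_1 fls_section_0)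
  obtain x y where xy: "\<gamma> powi (- int (b - 1)) / form_coeff v = x\<^sup>2 - \<gamma> * y\<^sup>2"
    using fls_norm_surj[OF two \<gamma>_nz] by blast
  define w where "w = x \<triangleright> v + y \<triangleright> N v"
  have w: "w \<in> W" unfolding w_def using v by (intro W_add act_W W_N)
  have "form_coeff v * (x\<^sup>2 - \<gamma> * y\<^sup>2) = \<gamma> powi (- int (b - 1))"
    using nz by (simp flip: xy)
  then have form: "B w (N (z \<triangleright> w)) = \<tau> (\<gamma> powi (- int (b - 1)) * z)" for z
    using form_coeff_norm[OF v(1) w_def, of z] by simp
  have odd: "B w ((N ^^ (2 * l + 1)) w) = (if l = b - 1 then 1 else 0)" if "l < b" for l
  proof -
    have "B w ((N ^^ (2 * l + 1)) w) = B w (N ((\<gamma> ^ l) \<triangleright> w))"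
      using act_\<gamma>_pow[OF w, of l 1] by (simp add: act_1)
    also have "\<dots> = \<tau> (\<gamma> powi (int l - int (b - 1)))"
      unfolding form using \<gamma>_nz by (simp add: power_int_diff power_int_minus field_simps)
    also have "\<dots> = (if l = b - 1 then 1 else 0)"
      using that by (auto simp: \<tau>_1 intro!: \<tau>_\<gamma>_eq_0)
    finally show ?thesis .
  qed
  have "B w ((N ^^ i) w) = (if i = 2 * b - 1 then 1 else 0)" if "i < 2 * b" for i
  proof (cases "even i")
    case True
    then obtain l where "i = 2 * l" by blast
    moreover have "i \<noteq> 2 * b - 1" using True b_pos that by presburger
    ultimately show ?thesis by (simp add: B_Npow_even)
  next
    case False
    then obtain l where l: "i = 2 * l + 1" by (elim oddE)
    then have "l < b" "i = 2 * b - 1 \<longleftrightarrow> l = b - 1" using that by auto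
    then show ?thesis using odd[of l] l by simp
  qed
  with w show ?thesis by blast
qed

end

subsection \<open>Linear operators given by matrices\<close>

locale linear_endomorphism = vector_space scale
  for scale :: "'f::field \<Rightarrow> 'v::ab_group_add \<Rightarrow> 'v" (infixr "*s" 75) +
  fixes N :: "'v \<Rightarrow> 'v"
  assumes N_add: "N (x + y) = N x + N y" and N_scale: "N (c *s x) = c *s N x"
begin

sublocale N: additive N by standard (rule N_add)

definition peval :: "'f poly \<Rightarrow> 'v \<Rightarrow> 'v" where
  "peval p v = fold_coeffs (\<lambda>a w. a *s v + N w) p 0"

lemma peval_0 [simp]: "peval 0 v = 0"
  by (simp add: peval_def)

lemma peval_pCons [simp]: "peval (pCons a p) v = a *s v + N (peval p v)"
  by (cases "p = 0 \<and> a = 0") (auto simp: peval_def N.zero)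

lemma peval_add: "peval (p + q) v = peval p v + peval q v"
proof (induction p arbitrary: q)
  case (pCons a p)
  then show ?case by (cases q) (simp add: scale_left_distrib N_add)
qed simp

lemma peval_diff: "peval (p - q) v = peval p v - peval q v"
  using peval_add[of "p - q" q v] by simp

lemma peval_smult: "peval (Polynomial.smult c p) v = c *s peval p v"
  by (induction p) (simp_all add: scale_right_distrib N_scale)

lemma peval_mult: "peval (p * q) v = peval p (peval q v)"
  by (induction p) (simp_all add: peval_add peval_smult)

lemma peval_sum: "peval (\<Sum>i\<in>A. f i) v = (\<Sum>i\<in>A. peval (f i) v)"
  by (induction A rule: infinite_finite_induct) (simp_all add: peval_add)

lemma peval_add_right: "peval p (v + w) = peval p v + peval p w"
  by (induction p) (simp_all add: scale_right_distrib N_add algebra_simps)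

lemma peval_scale_right: "peval p (c *s v) = c *s peval p v"
  by (induction p) (simp_all add: scale_right_distrib N_scale mult.commute)

lemma peval_0_right [simp]: "peval p 0 = 0"
  by (induction p) (simp_all add: N.zero)

lemma peval_sum_right: "peval p (\<Sum>i\<in>A. f i) = (\<Sum>i\<in>A. peval p (f i))"
  by (induction A rule: infinite_finite_induct) (simp_all add: peval_add_right)

lemma peval_monom: "peval (Polynomial.monom c k) v = c *s (N ^^ k) v"
  by (induction k) (simp_all add: monom_0 monom_Suc N_scale N.zero)

text \<open>The adjugate proof, over the module on which the indeterminate acts as \<open>N\<close>:
  each column of \<open>char_poly_matrix A\<close> annihilates the family \<open>e\<close>, and
  multiplying by the adjugate leaves the determinant on the diagonal.\<close>

lemma Cayley_Hamilton:
  assumes A: "A \<in> carrier_mat d d" and l: "l < d"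
    and N_e: "\<And>i. i < d \<Longrightarrow> N (e i) = (\<Sum>j<d. A $$ (j, i) *s e j)"
  shows "peval (char_poly A) (e l) = 0"
proof -
  let ?M = "char_poly_matrix A"
  have M: "?M \<in> carrier_mat d d" using A by simp
  note adj = adj_mat[OF M]
  have entry: "?M $$ (j, i) = (if i = j then [:0, 1:] else 0) - [:A $$ (j, i):]" if "i < d" "j < d" for i j
    using A that by (simp add: char_poly_matrix_def)
  have kill: "(\<Sum>j<d. peval (?M $$ (j, i)) (e j)) = 0" if i: "i < d" for i
  proof -
    have "(\<Sum>j<d. peval (?M $$ (j, i)) (e j)) =
        (\<Sum>j<d. (if j = i then N (e j) else 0) - A $$ (j, i) *s e j)"
      by (intro sum.cong) (auto simp: entry i peval_diff N.zero)
    also have "\<dots> = N (e i) - (\<Sum>j<d. A $$ (j, i) *s e j)"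
      using i by (simp add: sum_subtractf)
    finally show ?thesis using N_e[OF i] by simp
  qed
  have "0 = (\<Sum>i<d. peval (adj_mat ?M $$ (i, l)) (\<Sum>j<d. peval (?M $$ (j, i)) (e j)))"
    by (simp add: kill)
  also have "\<dots> = (\<Sum>i<d. \<Sum>j<d. peval (?M $$ (j, i) * adj_mat ?M $$ (i, l)) (e j))"
    by (simp add: peval_sum_right peval_mult mult.commute[of _ "adj_mat _ $$ _"])
  also have "\<dots> = (\<Sum>j<d. peval ((?M * adj_mat ?M) $$ (j, l)) (e j))"
    using M adj(1) l
    by (subst sum.swap) (simp add: peval_sum scalar_prod_def lessThan_atLeast0)
  also have "\<dots> = (\<Sum>j<d. if j = l then peval (char_poly A) (e j) else 0)"
    unfolding adj(2) using l by (intro sum.cong) (auto simp: char_poly_def)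
  also have "\<dots> = peval (char_poly A) (e l)" using l by simp
  finally show ?thesis ..
qed

lemma Npow_add: "(N ^^ i) (x + y) = (N ^^ i) x + (N ^^ i) y"
  by (induction i) (simp_all add: N_add)

lemma Npow_scale: "(N ^^ i) (c *s x) = c *s (N ^^ i) x"
  by (induction i) (simp_all add: N_scale)

end

text \<open>
  Vectors of dimension \<open>d\<close> are also regarded as functions on \<open>nat\<close> vanishing outside \<open>{..<d}\<close>,
  which, unlike \<^typ>\<open>'a vec\<close>, form an additive group as a type.
\<close>

definition fun_of_vec :: "'a::zero vec \<Rightarrow> nat \<Rightarrow> 'a" where
  "fun_of_vec v = (\<lambda>i. if i < dim_vec v then v $ i else 0)"

definition fscale :: "'a::field \<Rightarrow> (nat \<Rightarrow> 'a) \<Rightarrow> nat \<Rightarrow> 'a" where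
  "fscale c f = (\<lambda>i. c * f i)"

definition mat_op :: "nat \<Rightarrow> 'a::field mat \<Rightarrow> (nat \<Rightarrow> 'a) \<Rightarrow> nat \<Rightarrow> 'a" where
  "mat_op d A f = fun_of_vec (A *\<^sub>v vec d f)"

definition mat_form :: "nat \<Rightarrow> 'a::field mat \<Rightarrow> (nat \<Rightarrow> 'a) \<Rightarrow> (nat \<Rightarrow> 'a) \<Rightarrow> 'a" where
  "mat_form d J f g = vec d f \<bullet> (J *\<^sub>v vec d g)"

lemma fun_sum_apply: "(\<Sum>i\<in>A. f i) x = (\<Sum>i\<in>A. f i x)" for f :: "'i \<Rightarrow> 'x \<Rightarrow> 'a::comm_monoid_add"
  by (induction A rule: infinite_finite_induct) (simp_all add: zero_fun_def)

lemma vec_fun_of_vec: "v \<in> carrier_vec d \<Longrightarrow> vec d (fun_of_vec v) = v"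
  by (auto simp: fun_of_vec_def)

lemma fun_of_vec_vec: "(\<And>i. i \<ge> d \<Longrightarrow> f i = 0) \<Longrightarrow> fun_of_vec (vec d f) = f"
  by (auto simp: fun_of_vec_def)

lemma vec_add_fun: "vec d (f + g) = vec d f + vec d g" for f g :: "nat \<Rightarrow> 'a::plus"
  by (intro eq_vecI) (auto simp: plus_fun_def)

lemma vec_fscale: "vec d (fscale c f) = c \<cdot>\<^sub>v vec d f"
  by (intro eq_vecI) (auto simp: fscale_def)

lemma vec_zero_fun: "vec d (0 :: nat \<Rightarrow> 'a::zero) = 0\<^sub>v d"
  by (intro eq_vecI) (auto simp: zero_fun_def)

interpretation fscale: vector_space "fscale :: 'a::field \<Rightarrow> _"
  by standard (auto simp: fscale_def fun_eq_iff algebra_simps)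

lemma linear_endomorphism_mat_op:
  assumes A: "A \<in> carrier_mat d d"
  shows "linear_endomorphism fscale (mat_op d A)"
proof
  fix f g :: "nat \<Rightarrow> 'a" and c
  show "mat_op d A (f + g) = mat_op d A f + mat_op d A g"
    using A by (auto simp: mat_op_def fun_of_vec_def vec_add_fun fun_eq_iff mult_add_distrib_mat_vec[OF A])
  show "mat_op d A (fscale c f) = fscale c (mat_op d A f)"
    unfolding mat_op_def vec_fscale mult_mat_vec[OF A vec_carrier]
    by (simp add: fun_of_vec_def fscale_def fun_eq_iff)
qed

lemma mat_op_eq_0: "A \<in> carrier_mat d d \<Longrightarrow> i \<ge> d \<Longrightarrow> mat_op d A f i = 0"
  by (simp add: mat_op_def fun_of_vec_def)

lemma vec_mat_op: "A \<in> carrier_mat d d \<Longrightarrow> vec d (mat_op d A f) = A *\<^sub>v vec d f"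
  unfolding mat_op_def by (rule vec_fun_of_vec) simp

lemma vec_mat_op_pow:
  assumes A: "A \<in> carrier_mat d d"
  shows "vec d ((mat_op d A ^^ i) f) = (A ^\<^sub>m i) *\<^sub>v vec d f"
proof (induction i arbitrary: f)
  case (Suc i)
  have "vec d ((mat_op d A ^^ Suc i) f) = (A ^\<^sub>m i) *\<^sub>v (A *\<^sub>v vec d f)"
    by (simp add: Suc funpow_swap1 vec_mat_op[OF A] del: funpow.simps add: funpow_Suc_right)
  also have "\<dots> = (A ^\<^sub>m Suc i) *\<^sub>v vec d f"
    using A by (simp add: assoc_mult_mat_vec[of _ d d _ d])
  finally show ?case .
qed (use A in simp)

lemma mat_form_nondeg:
  assumes "symplectic_form n J" "\<And>i. i \<ge> 2 * n \<Longrightarrow> f i = 0" "f \<noteq> 0"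
  shows "\<exists>g. (\<forall>i\<ge>2*n. g i = 0) \<and> mat_form (2 * n) J f g \<noteq> 0"
proof -
  have "vec (2 * n) f \<noteq> 0\<^sub>v (2 * n)"
  proof
    assume "vec (2 * n) f = 0\<^sub>v (2 * n)"
    then have "f x = 0" for x
      using assms(2)[of x] by (cases "x < 2 * n") (auto dest: arg_cong[where f = "\<lambda>v. vec_index v x"])
    then have "f = 0" by (simp add: fun_eq_iff)
    with assms(3) show False by simp
  qed
  then obtain w where "w \<in> carrier_vec (2 * n)" "vec (2 * n) f \<bullet> (J *\<^sub>v w) \<noteq> 0"
    using assms(1) unfolding symplectic_form_def by (metis vec_carrier)
  then show ?thesis
    by (intro exI[of _ "fun_of_vec w"] conjI) (simp_all add: mat_form_def vec_fun_of_vec, simp add: fun_of_vec_def)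
qed

lemma mat_form_alt: "symplectic_form n J \<Longrightarrow> mat_form (2 * n) J f f = 0"
  by (simp add: symplectic_form_def mat_form_def)

lemma mat_form_bilinear:
  assumes J: "J \<in> carrier_mat d d"
  shows "mat_form d J (f + g) h = mat_form d J f h + mat_form d J g h"
    and "mat_form d J h (f + g) = mat_form d J h f + mat_form d J h g"
    and "mat_form d J (fscale c f) h = c * mat_form d J f h"
    and "mat_form d J h (fscale c f) = c * mat_form d J h f"
  using J by (simp_all add: mat_form_def vec_add_fun vec_fscale add_scalar_prod_distrib[of _ d]
      scalar_prod_add_distrib[of _ d] mult_add_distrib_mat_vec[OF J] mult_mat_vec[OF J])

lemma zero_mult_mat_vec: "v \<in> carrier_vec d \<Longrightarrow> 0\<^sub>m r d *\<^sub>v v = (0\<^sub>v r :: 'a::semiring_0 vec)"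
  by (intro eq_vecI) auto

lemma mat_form_skew:
  assumes J: "J \<in> carrier_mat (2 * n) (2 * n)" and N: "N \<in> sp n J"
  shows "mat_form (2 * n) J (mat_op (2 * n) N f) g = - mat_form (2 * n) J f (mat_op (2 * n) N g)"
proof -
  let ?d = "2 * n"
  have Nc: "N \<in> carrier_mat ?d ?d" and eq: "transpose_mat N * J + J * N = 0\<^sub>m ?d ?d"
    using N by (auto simp: sp_def)
  let ?u = "vec ?d f" and ?v = "vec ?d g"
  have "mat_form ?d J (mat_op ?d N f) g = (J *\<^sub>v ?v) \<bullet> (N *\<^sub>v ?u)"
    using J Nc by (simp add: mat_form_def vec_mat_op comm_scalar_prod[of _ ?d])
  also have "\<dots> = (transpose_mat N *\<^sub>v (J *\<^sub>v ?v)) \<bullet> ?u"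
    using J Nc by (subst transpose_vec_mult_scalar[of _ ?d ?d]) auto
  also have "\<dots> = ?u \<bullet> ((transpose_mat N * J) *\<^sub>v ?v)"
    using J Nc by (simp add: comm_scalar_prod[of _ ?d] assoc_mult_mat_vec[of _ ?d ?d _ ?d])
  finally have 1: "mat_form ?d J (mat_op ?d N f) g = ?u \<bullet> ((transpose_mat N * J) *\<^sub>v ?v)" .
  have 2: "mat_form ?d J f (mat_op ?d N g) = ?u \<bullet> ((J * N) *\<^sub>v ?v)"
    using J Nc by (simp add: mat_form_def vec_mat_op assoc_mult_mat_vec[of _ ?d ?d _ ?d])
  have "?u \<bullet> ((transpose_mat N * J + J * N) *\<^sub>v ?v) = 0"
    unfolding eq by (simp add: zero_mult_mat_vec)
  then have "?u \<bullet> ((transpose_mat N * J) *\<^sub>v ?v) + ?u \<bullet> ((J * N) *\<^sub>v ?v) = 0"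
    using J Nc by (simp add: add_mult_distrib_mat_vec[of _ ?d ?d] scalar_prod_add_distrib[of _ ?d])
  then show ?thesis unfolding 1 2 by (simp add: eq_neg_iff_add_eq_0)
qed

text \<open>The support condition places \<open>f\<close> in the span of the first \<open>d\<close>
  unit vectors, on each of which \<open>Cayley_Hamilton\<close> applies.\<close>

lemma peval_char_poly_mat_op:
  assumes A: "A \<in> carrier_mat d d" and f: "\<And>i. i \<ge> d \<Longrightarrow> f i = 0"
  shows "linear_endomorphism.peval fscale (mat_op d A) (char_poly A) f = 0"
proof -
  interpret linear_endomorphism fscale "mat_op d A" by (rule linear_endomorphism_mat_op[OF A])
  let ?e = "\<lambda>i j. if j = i then 1 else 0 :: 'a"
  have N_e: "mat_op d A (?e i) = (\<Sum>j<d. fscale (A $$ (j, i)) (?e j))" if "i < d" for i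
  proof
    fix k
    have "mat_op d A (?e i) k = (if k < d then A $$ (k, i) else 0)"
      using A that by (auto simp: mat_op_def fun_of_vec_def scalar_prod_def if_distrib cong: if_cong)
    also have "\<dots> = (\<Sum>j<d. fscale (A $$ (j, i)) (?e j)) k"
      by (simp add: fun_sum_apply fscale_def if_distrib cong: if_cong)
    finally show "mat_op d A (?e i) k = (\<Sum>j<d. fscale (A $$ (j, i)) (?e j)) k" .
  qed
  have "f = (\<Sum>i<d. fscale (f i) (?e i))"
    by (rule ext) (auto simp: fun_sum_apply fscale_def f if_distrib cong: if_cong)
  then have "peval (char_poly A) f = (\<Sum>i<d. fscale (f i) (peval (char_poly A) (?e i)))"
    by (metis (no_types, lifting) peval_scale_right peval_sum_right sum.cong)
  also have "\<dots> = 0"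
    by (intro sum.neutral ballI) (simp add: Cayley_Hamilton[OF A _ N_e])
  finally show ?thesis .
qed

subsection \<open>Splitting \<open>V\<^sub>F\<close> into blocks\<close>

lemma fscale_apply: "fscale c f i = c * f i"
  by (simp add: fscale_def)

lemma gram_mat_of_family:
  fixes J :: "'a::field mat" and e :: "nat \<Rightarrow> nat \<Rightarrow> 'a"
  assumes J: "J \<in> carrier_mat d d"
  defines "g \<equiv> mat d d (\<lambda>(r, c). e c r)"
  shows "transpose_mat g * J * g = mat d d (\<lambda>(r, c). mat_form d J (e r) (e c))"
proof (rule eq_matI)
  have g: "g \<in> carrier_mat d d" by (simp add: g_def)
  have col_g: "col g c = vec d (e c)" if "c < d" for c
    using that by (auto simp: g_def)
  fix r c assume "r < dim_row (mat d d (\<lambda>(r, c). mat_form d J (e r) (e c)))"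
    "c < dim_col (mat d d (\<lambda>(r, c). mat_form d J (e r) (e c)))"
  then have rc: "r < d" "c < d" by auto
  have "transpose_mat g * J * g = transpose_mat g * (J * g)"
    using g J by (simp add: assoc_mult_mat[of _ d d _ d _ d])
  then have "(transpose_mat g * J * g) $$ (r, c) = row (transpose_mat g) r \<bullet> col (J * g) c"
    using g J rc by (simp only:) (rule index_mult_mat(1), auto)
  also have "\<dots> = col g r \<bullet> (J *\<^sub>v col g c)"
    unfolding col_mult2[OF J g rc(2)] using g rc by simp
  finally have "(transpose_mat g * J * g) $$ (r, c) = col g r \<bullet> (J *\<^sub>v col g c)" .
  then show "(transpose_mat g * J * g) $$ (r, c) = mat d d (\<lambda>(r, c). mat_form d J (e r) (e c)) $$ (r, c)"
    using rc by (simp add: col_g mat_form_def)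
qed (use assms in auto)

text \<open>The involution taking \<open>i\<close> to \<open>2b - 1 - i\<close> inside each block of
  \<open>2b\<close> indices. It matches each basis vector with the only one that it pairs with
  nontrivially.\<close>

definition mirror :: "nat \<Rightarrow> nat \<Rightarrow> nat" where
  "mirror b r = r div (2 * b) * (2 * b) + (2 * b - 1 - r mod (2 * b))"

text \<open>
  The Gram matrix of the vectors \<open>N\<^sup>i v\<^sub>j\<close> (\<open>i < 2b\<close>), numbered by \<open>2bj + i\<close>, and the matrix of \<open>N\<close> on
  them, where \<open>N\<^sup>2\<^sup>b v\<^sub>j = \<delta>\<^sub>j v\<^sub>j\<close>.
\<close>

definition block_form :: "nat \<Rightarrow> nat \<Rightarrow> 'a::comm_ring_1 mat" where
  "block_form n b = mat (2 * n) (2 * n) (\<lambda>(r, c). if c = mirror b r then (- 1) ^ (r mod (2 * b)) else 0)"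

definition block_shift :: "nat \<Rightarrow> nat \<Rightarrow> (nat \<Rightarrow> 'a) \<Rightarrow> 'a::comm_ring_1 mat" where
  "block_shift n b \<delta> = mat (2 * n) (2 * n) (\<lambda>(r, c).
     if Suc c mod (2 * b) \<noteq> 0 then (if r = Suc c then 1 else 0)
     else if r + 2 * b = Suc c then \<delta> (c div (2 * b)) else 0)"

lemma block_form_carrier: "block_form n b \<in> carrier_mat (2 * n) (2 * n)"
  by (simp add: block_form_def)

lemma block_shift_carrier: "block_shift n b \<delta> \<in> carrier_mat (2 * n) (2 * n)"
  by (simp add: block_shift_def)

lemma block_dims [simp]:
  "dim_row (block_form n b) = 2 * n" "dim_col (block_form n b) = 2 * n"
  "dim_row (block_shift n b \<delta>) = 2 * n" "dim_col (block_shift n b \<delta>) = 2 * n"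
  by (simp_all add: block_form_def block_shift_def)

lemma eq_mirror_iff:
  assumes "b > 0"
  shows "c = mirror b r \<longleftrightarrow> c div (2 * b) = r div (2 * b) \<and> r mod (2 * b) + c mod (2 * b) = 2 * b - 1"
proof -
  have lt: "2 * b - 1 - r mod (2 * b) < 2 * b" "r mod (2 * b) < 2 * b" using assms by auto
  have "mirror b r div (2 * b) = r div (2 * b)" "mirror b r mod (2 * b) = 2 * b - 1 - r mod (2 * b)"
    unfolding mirror_def using lt(1) by simp_all
  moreover have "c = mirror b r \<longleftrightarrow> c div (2 * b) = mirror b r div (2 * b) \<and> c mod (2 * b) = mirror b r mod (2 * b)"
    by (metis div_mult_mod_eq)
  ultimately show ?thesis using lt by auto
qed

interpretation to_ac: inj_comm_ring_hom "to_ac :: 'a::field \<Rightarrow> 'a alg_closure"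
  by standard auto

lemma smult_mat_mult_vec:
  fixes A :: "'a::comm_ring_1 mat"
  assumes "A \<in> carrier_mat r d" "v \<in> carrier_vec d"
  shows "(c \<cdot>\<^sub>m A) *\<^sub>v v = c \<cdot>\<^sub>v (A *\<^sub>v v)"
  using assms by (intro eq_vecI) (auto simp: scalar_prod_def sum_distrib_left mult.assoc)

text \<open>A root \<open>a\<close> of \<open>X^k - \<delta>\<close> in the closure is an
  eigenvalue, so \<open>A^k - \<delta>\<close> is singular there. Singularity is the vanishing of a
  determinant and descends to the base field, although \<open>a\<close> need not lie in it.\<close>

lemma exists_pow_eigenvector:
  fixes A :: "'a::field mat"
  assumes A: "A \<in> carrier_mat d d" and dvd: "(Polynomial.monom 1 k - [:\<delta>:]) dvd char_poly A" and "k > 0"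
  shows "\<exists>w\<in>carrier_vec d. w \<noteq> 0\<^sub>v d \<and> (A ^\<^sub>m k) *\<^sub>v w = \<delta> \<cdot>\<^sub>v w"
proof -
  interpret poly_hom: map_poly_comm_ring_hom "to_ac :: 'a \<Rightarrow> 'a alg_closure" ..
  let ?A = "map_mat to_ac A"
  have A': "?A \<in> carrier_mat d d" using A by simp
  obtain a where a: "a ^ k = to_ac \<delta>" using nth_root_exists[of k "to_ac \<delta>"] \<open>k > 0\<close> by auto
  obtain q where q: "char_poly A = (Polynomial.monom 1 k - [:\<delta>:]) * q" using dvd by (elim dvdE)
  have "map_poly to_ac [:\<delta>:] = [:to_ac \<delta>:]"
    by (intro poly_eqI) (simp add: coeff_map_poly coeff_pCons split: nat.split)
  then have "char_poly ?A = (Polynomial.monom 1 k - [:to_ac \<delta>:]) * map_poly to_ac q"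
    unfolding to_ac.char_poly_hom[OF A] q
    by (simp add: poly_hom.hom_mult poly_hom.hom_minus map_poly_monom)
  then have "poly (char_poly ?A) a = 0" by (simp add: poly_monom a)
  then have "eigenvalue ?A a" by (simp add: eigenvalue_root_char_poly[OF A'])
  then obtain v where v: "eigenvector ?A v a" by (auto simp: eigenvalue_def)
  then have v': "v \<in> carrier_vec d" "v \<noteq> 0\<^sub>v d" using A by (auto simp: eigenvector_def)
  let ?P = "A ^\<^sub>m k + (- \<delta>) \<cdot>\<^sub>m 1\<^sub>m d"
  have P: "?P \<in> carrier_mat d d" using A by simp
  have "map_mat to_ac ?P = ?A ^\<^sub>m k + (- to_ac \<delta>) \<cdot>\<^sub>m 1\<^sub>m d"
    unfolding to_ac.mat_hom_pow[OF A, symmetric] using A by (intro eq_matI) auto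
  then have "map_mat to_ac ?P *\<^sub>v v = (?A ^\<^sub>m k) *\<^sub>v v + (- to_ac \<delta>) \<cdot>\<^sub>v v"
    using A' v' by (simp add: add_mult_distrib_mat_vec[of _ d d] smult_mat_mult_vec[of _ d d])
  also have "\<dots> = 0\<^sub>v d"
    unfolding eigenvector_pow[OF A' v] using v' by (auto simp: a)
  finally have "det (map_mat to_ac ?P) = 0"
    using v' det_0_iff_vec_prod_zero[of "map_mat to_ac ?P" d] P by auto
  then have "det ?P = 0" by simp
  then obtain w where w: "w \<in> carrier_vec d" "w \<noteq> 0\<^sub>v d" "?P *\<^sub>v w = 0\<^sub>v d"
    using det_0_iff_vec_prod_zero[OF P] by blast
  have "?P *\<^sub>v w = (A ^\<^sub>m k) *\<^sub>v w + (- \<delta>) \<cdot>\<^sub>v w"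
    using A w by (simp add: add_mult_distrib_mat_vec[of _ d d] smult_mat_mult_vec[of _ d d])
  with w have eq: "(A ^\<^sub>m k) *\<^sub>v w + (- \<delta>) \<cdot>\<^sub>v w = 0\<^sub>v d" by simp
  have "(A ^\<^sub>m k) *\<^sub>v w = \<delta> \<cdot>\<^sub>v w"
  proof (rule eq_vecI)
    fix i assume "i < dim_vec (\<delta> \<cdot>\<^sub>v w)"
    then have i: "i < d" using w by simp
    then have "vec_index ((A ^\<^sub>m k) *\<^sub>v w + (- \<delta>) \<cdot>\<^sub>v w) i = 0" unfolding eq by simp
    then show "vec_index ((A ^\<^sub>m k) *\<^sub>v w) i = vec_index (\<delta> \<cdot>\<^sub>v w) i"
      using i A w by simp
  qed (use A w in simp)
  then show ?thesis using w by blast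
qed

lemma mat_form_anti:
  assumes J: "symplectic_form n J"
  shows "mat_form (2 * n) J f g = - mat_form (2 * n) J g f"
proof -
  have J': "J \<in> carrier_mat (2 * n) (2 * n)" using J by (simp add: symplectic_form_def)
  have "mat_form (2 * n) J (f + g) f + mat_form (2 * n) J (f + g) g = 0"
    by (simp only: mat_form_alt[OF J] flip: mat_form_bilinear(2)[OF J'])
  then show ?thesis
    by (simp add: mat_form_bilinear[OF J'] mat_form_alt[OF J] eq_neg_iff_add_eq_0 add.commute)
qed

locale homogeneous_sp =
  fixes n b D :: nat and m :: int and \<alpha> :: "nat \<Rightarrow> 'k::alg_closed_field" and J N :: "'k fls mat"
  assumes two: "(2 :: 'k) \<noteq> 0" and J: "symplectic_form n J" and N: "N \<in> sp n J"
    and b_pos: "b > 0" and n: "n = b * D" and coprime: "coprime m (int b)"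
    and inj: "inj_on \<alpha> {..<D}" and \<alpha>_nz: "\<And>j. j < D \<Longrightarrow> \<alpha> j \<noteq> 0"
    and char_poly: "char_poly N =
      (\<Prod>j<D. Polynomial.monom 1 (2 * b) - [:fls_const (\<alpha> j) * fls_X_intpow m:])"
begin

lemma J_carrier: "J \<in> carrier_mat (2 * n) (2 * n)"
  using J by (simp add: symplectic_form_def)

lemma N_carrier: "N \<in> carrier_mat (2 * n) (2 * n)"
  using N by (simp add: sp_def)

definition \<delta> :: "nat \<Rightarrow> 'k fls" where
  "\<delta> j = fls_const (\<alpha> j) * fls_X_intpow m"

abbreviation op where "op \<equiv> mat_op (2 * n) N"
abbreviation B where "B \<equiv> mat_form (2 * n) J"

sublocale L: linear_endomorphism fscale op
  by (rule linear_endomorphism_mat_op[OF N_carrier])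

lemma \<delta>_eq_iff: "\<delta> i = \<delta> j \<longleftrightarrow> \<alpha> i = \<alpha> j"
proof
  assume "\<delta> i = \<delta> j"
  then have "fls_nth (1 * \<delta> i) m = fls_nth (1 * \<delta> j) m" by simp
  then show "\<alpha> i = \<alpha> j" unfolding \<delta>_def fls_nth_mult_monom by simp
qed (simp add: \<delta>_def)

definition W :: "nat \<Rightarrow> (nat \<Rightarrow> 'k fls) set" where
  "W j = {f. (\<forall>i\<ge>2*n. f i = 0) \<and> (op ^^ (2 * b)) f = fscale (\<delta> j) f}"

lemma B_anti: "B f g = - B g f"
  by (rule mat_form_anti[OF J])

lemma B_op_pow: "B ((op ^^ i) f) g = (- 1) ^ i * B f ((op ^^ i) g)"
proof (induction i arbitrary: g)
  case (Suc i)
  have "B ((op ^^ Suc i) f) g = - B ((op ^^ i) f) (op g)"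
    by (simp add: mat_form_skew[OF J_carrier N])
  also have "\<dots> = (- 1) ^ Suc i * B f ((op ^^ Suc i) g)"
    by (simp add: Suc funpow_swap1)
  finally show ?case .
qed simp

lemma op_pow_eq_0: "(\<And>i. i \<ge> 2 * n \<Longrightarrow> f i = 0) \<Longrightarrow> i \<ge> 2 * n \<Longrightarrow> (op ^^ k) f i = 0"
  by (cases k) (simp_all add: mat_op_eq_0[OF N_carrier])

lemma op_W: "f \<in> W j \<Longrightarrow> op f \<in> W j"
  by (simp add: W_def mat_op_eq_0[OF N_carrier] L.N_scale[symmetric] flip: funpow_swap1)

lemma op_pow_W: "f \<in> W j \<Longrightarrow> (op ^^ k) f \<in> W j"
  by (induction k) (simp_all add: op_W)

text \<open>As an even power of a skew operator \<open>N^(2b)\<close> is self-adjoint, and it has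
  different eigenvalues on the two spaces.\<close>

lemma W_orthogonal:
  assumes "f \<in> W i" "g \<in> W j" "i < D" "j < D" "i \<noteq> j"
  shows "B f g = 0"
proof -
  have "\<delta> i * B f g = B ((op ^^ (2 * b)) f) g"
    using assms by (simp add: W_def mat_form_bilinear[OF J_carrier])
  also have "\<dots> = B f ((op ^^ (2 * b)) g)" by (simp add: B_op_pow)
  also have "\<dots> = \<delta> j * B f g"
    using assms by (simp add: W_def mat_form_bilinear[OF J_carrier])
  finally show ?thesis
    using assms inj by (auto simp: \<delta>_eq_iff inj_on_def)
qed

lemma peval_factor: "L.peval (Polynomial.monom 1 k - [:c:]) f = (op ^^ k) f - fscale c f"
  by (simp add: L.peval_diff L.peval_monom L.N.zero)

lemma B_peval_prod:
  assumes "finite S"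
  shows "B (L.peval (\<Prod>i\<in>S. Polynomial.monom 1 (2 * b) - [:\<delta> i:]) f) g =
    B f (L.peval (\<Prod>i\<in>S. Polynomial.monom 1 (2 * b) - [:\<delta> i:]) g)"
  using assms
proof (induction S arbitrary: f g)
  case (insert j S)
  let ?q = "\<Prod>i\<in>S. Polynomial.monom 1 (2 * b) - [:\<delta> i:]" and ?p = "Polynomial.monom 1 (2 * b) - [:\<delta> j:]"
  have diff: "B (x - y) z = B x z - B y z" "B z (x - y) = B z x - B z y" for x y z
    using mat_form_bilinear(1,2)[OF J_carrier] by (metis add_diff_cancel diff_add_cancel)+
  have p: "B (L.peval ?p f) g = B f (L.peval ?p g)" for f g
    unfolding peval_factor by (simp add: diff B_op_pow mat_form_bilinear[OF J_carrier])
  have "B (L.peval (?p * ?q) f) g = B f (L.peval (?q * ?p) g)"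
    unfolding L.peval_mult p insert.IH ..
  then show ?case using insert.hyps by (simp add: mult.commute)
qed (simp add: one_pCons L.N.zero)

lemma peval_prod_W:
  assumes "finite S" "f \<in> W j"
  shows "L.peval (\<Prod>i\<in>S. Polynomial.monom 1 (2 * b) - [:\<delta> i:]) f = fscale (\<Prod>i\<in>S. \<delta> j - \<delta> i) f"
  using assms(1)
proof (induction S)
  case empty
  then show ?case by (simp add: L.N.zero one_pCons)
next
  case (insert k S)
  have "L.peval (Polynomial.monom 1 (2 * b) - [:\<delta> k:]) f = fscale (\<delta> j - \<delta> k) f"
    using assms(2) unfolding peval_factor by (simp add: W_def fscale.scale_left_diff_distrib)
  then show ?case
    using insert by (simp add: L.peval_mult mult.commute[of _ "\<Prod>i\<in>S. _ i :: 'k fls poly"] L.peval_scale_right)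
qed

text \<open>By Cayley-Hamilton the product of the other factors maps any \<open>g\<close> into
  \<open>W j\<close>. It is self-adjoint and acts on \<open>f\<close> by the nonzero scalar
  \<open>\<Prod>i. \<delta> j - \<delta> i\<close>, so a vector pairing nontrivially with
  \<open>f\<close> in the whole space can be replaced by one in \<open>W j\<close>.\<close>

lemma W_nondeg:
  assumes j: "j < D" and f: "f \<in> W j" "f \<noteq> 0"
  shows "\<exists>g\<in>W j. B g f \<noteq> 0"
proof -
  obtain g where g: "\<And>i. i \<ge> 2 * n \<Longrightarrow> g i = 0" "B f g \<noteq> 0"
    using mat_form_nondeg[OF J, of f] f unfolding W_def by blast
  let ?S = "{..<D} - {j}"
  let ?q = "\<Prod>i\<in>?S. Polynomial.monom 1 (2 * b) - [:\<delta> i:]"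
  let ?h = "L.peval ?q g"
  have supp: "L.peval p g i = 0" if "i \<ge> 2 * n" for p i
    using g(1) that by (induction p) (simp_all add: zero_fun_def plus_fun_def fscale_def mat_op_eq_0[OF N_carrier])
  have "char_poly N = (Polynomial.monom 1 (2 * b) - [:\<delta> j:]) * ?q"
    using j unfolding char_poly by (simp add: \<delta>_def prod.remove)
  then have "L.peval (Polynomial.monom 1 (2 * b) - [:\<delta> j:]) ?h = 0"
    using peval_char_poly_mat_op[OF N_carrier g(1)] by (simp only: L.peval_mult)
  then have "?h \<in> W j"
    unfolding peval_factor using supp by (simp add: W_def)
  moreover have "B ?h f = (\<Prod>i\<in>?S. \<delta> j - \<delta> i) * B g f"
    by (simp add: B_peval_prod peval_prod_W[OF _ f(1)] mat_form_bilinear[OF J_carrier])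
  moreover have "(\<Prod>i\<in>?S. \<delta> j - \<delta> i) \<noteq> 0"
    using j inj by (auto simp: \<delta>_eq_iff inj_on_def)
  moreover have "B g f \<noteq> 0" using g(2) B_anti[of f g] by auto
  ultimately show ?thesis by (intro bexI[of _ ?h]) auto
qed

lemma W_nontrivial:
  assumes j: "j < D"
  shows "\<exists>f\<in>W j. f \<noteq> 0"
proof -
  have "(Polynomial.monom 1 (2 * b) - [:\<delta> j:]) dvd char_poly N"
    using j unfolding char_poly \<delta>_def by (intro dvd_prodI) auto
  then obtain w where w: "w \<in> carrier_vec (2 * n)" "w \<noteq> 0\<^sub>v (2 * n)"
      "(N ^\<^sub>m (2 * b)) *\<^sub>v w = \<delta> j \<cdot>\<^sub>v w"
    using exists_pow_eigenvector[OF N_carrier] b_pos by (metis mult_pos_pos zero_less_numeral)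
  let ?f = "fun_of_vec w"
  have supp: "?f i = 0" if "i \<ge> 2 * n" for i using w(1) that by (simp add: fun_of_vec_def)
  have "vec (2 * n) ((op ^^ (2 * b)) ?f) = vec (2 * n) (fscale (\<delta> j) ?f)"
    using w by (simp add: vec_mat_op_pow[OF N_carrier] vec_fun_of_vec vec_fscale)
  then have "fun_of_vec (vec (2 * n) ((op ^^ (2 * b)) ?f)) = fun_of_vec (vec (2 * n) (fscale (\<delta> j) ?f))"
    by (rule arg_cong)
  then have "(op ^^ (2 * b)) ?f = fscale (\<delta> j) ?f"
    using supp by (subst (asm) (1 2) fun_of_vec_vec) (auto simp: op_pow_eq_0 fscale_def)
  then have "?f \<in> W j" using supp by (simp add: W_def)
  moreover have "?f \<noteq> 0"
  proof
    assume "?f = 0"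
    then have "vec (2 * n) ?f = 0\<^sub>v (2 * n)" by (simp add: vec_zero_fun)
    with w show False by (simp add: vec_fun_of_vec)
  qed
  ultimately show ?thesis by blast
qed

lemma exists_normalized:
  assumes j: "j < D"
  shows "\<exists>f\<in>W j. \<forall>i<2*b. B f ((op ^^ i) f) = (if i = 2 * b - 1 then 1 else 0)"
proof -
  interpret P: pure_skew_operator fscale op B "W j" b m "\<alpha> j"
  proof
    show "\<exists>f\<in>W j. f \<noteq> 0" by (rule W_nontrivial[OF j])
    show "f \<in> W j \<Longrightarrow> f \<noteq> 0 \<Longrightarrow> \<exists>g\<in>W j. B g f \<noteq> 0" for f by (rule W_nondeg[OF j])
    show "f \<in> W j \<Longrightarrow> op f \<in> W j" for f by (rule op_W)
    show "f + g \<in> W j" if "f \<in> W j" "g \<in> W j" for f g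
      using that by (simp add: W_def L.Npow_add fscale.scale_right_distrib)
    show "fscale c f \<in> W j" if "f \<in> W j" for f c
      using that by (simp add: W_def L.Npow_scale fscale.scale_left_commute fscale_apply)
  qed (use two b_pos coprime \<alpha>_nz[OF j] in
      \<open>auto simp: mat_form_bilinear[OF J_carrier] mat_form_alt[OF J] mat_form_skew[OF J_carrier N]
        L.N_add L.N_scale W_def \<delta>_def\<close>)
  show ?thesis by (rule P.exists_normalized_cyclic)
qed

text \<open>Column \<open>2bj + i\<close> of \<open>g\<close> is \<open>N^i v_j\<close> for the
  normalized cyclic vector \<open>v_j\<close> of block \<open>j\<close>. Invertibility of
  \<open>g\<close> is read off later from its Gram matrix.\<close>

theorem exists_graded_basis:
  "\<exists>g\<in>carrier_mat (2 * n) (2 * n).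
     transpose_mat g * J * g = block_form n b \<and> N * g = g * block_shift n b \<delta>"
proof -
  let ?k = "2 * b" and ?d = "2 * n"
  have "\<forall>j\<in>{..<D}. \<exists>f. f \<in> W j \<and> (\<forall>i<?k. B f ((op ^^ i) f) = (if i = ?k - 1 then 1 else 0))"
    using exists_normalized by blast
  then obtain v where v: "\<And>j. j < D \<Longrightarrow> v j \<in> W j"
      "\<And>j i. j < D \<Longrightarrow> i < ?k \<Longrightarrow> B (v j) ((op ^^ i) (v j)) = (if i = ?k - 1 then 1 else 0)"
    by (metis lessThan_iff)
  define e where "e c = (op ^^ (c mod ?k)) (v (c div ?k))" for c
  define g where "g = mat ?d ?d (\<lambda>(r, c). e c r)"
  have g: "g \<in> carrier_mat ?d ?d" by (simp add: g_def)
  have col_g: "col g c = vec ?d (e c)" if "c < ?d" for c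
    using that by (auto simp: g_def)
  have d: "?d = ?k * D" by (simp add: n)
  have div_lt: "c div ?k < D" if "c < ?d" for c
    using that d by (simp add: less_mult_imp_div_less mult.commute)
  have gram: "B (e r) (e c) = (if c = mirror b r then (- 1) ^ (r mod ?k) else 0)" if rc: "r < ?d" "c < ?d" for r c
  proof -
    let ?p = "r div ?k" and ?q = "c div ?k" and ?i = "r mod ?k" and ?j = "c mod ?k"
    have lt: "?p < D" "?q < D" "?i < ?k" "?j < ?k" using div_lt rc b_pos by auto
    have "B (e r) (e c) = (if ?p = ?q \<and> ?i + ?j = ?k - 1 then (- 1) ^ ?i else 0)"
    proof (cases "?p = ?q")
      case False
      then show ?thesis
        unfolding e_def by (auto intro: W_orthogonal op_pow_W v lt)
    next
      case True
      have eq: "B (e r) (e c) = (- 1) ^ ?i * B (v ?p) ((op ^^ (?i + ?j)) (v ?p))"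
        unfolding e_def B_op_pow True by (simp add: funpow_add)
      show ?thesis
      proof (cases "?i + ?j < ?k")
        case True': True
        then show ?thesis unfolding eq using v(2)[OF lt(1) True'] True by simp
      next
        case False
        \<comment> \<open>Here \<open>N^(2b)\<close> splits off as a scalar. The remaining exponent
          is at most \<open>2b - 2\<close>, so it misses the one exponent \<open>2b - 1\<close> with
          nonzero pairing.\<close>
        then obtain s where s: "?i + ?j = s + ?k" by (metis add.commute le_iff_add not_less)
        then have "(op ^^ (?i + ?j)) (v ?p) = fscale (\<delta> ?p) ((op ^^ s) (v ?p))"
          using v(1)[OF lt(1)] by (simp add: funpow_add W_def L.Npow_scale)
        moreover have "Suc s < ?k" using s lt(3,4) by linarith
        ultimately show ?thesis
          unfolding eq using v(2)[OF lt(1)] False by (auto simp: mat_form_bilinear[OF J_carrier])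
      qed
    qed
    then show ?thesis by (auto simp: eq_mirror_iff[OF b_pos])
  qed
  have 1: "transpose_mat g * J * g = block_form n b"
    unfolding g_def using gram_mat_of_family[OF J_carrier, of e]
    by (auto simp: block_form_def gram intro!: eq_matI)
  have 2: "N * g = g * block_shift n b \<delta>"
  proof (rule eq_matI)
    fix r c assume "r < dim_row (g * block_shift n b \<delta>)" "c < dim_col (g * block_shift n b \<delta>)"
    then have rc: "r < ?d" "c < ?d" using g by (auto simp: block_shift_def)
    let ?q = "c div ?k"
    have q: "?q < D" using div_lt rc by simp
    have "(N * g) $$ (r, c) = vec_index (N *\<^sub>v col g c) r"
      using g N_carrier rc by simp
    also have "\<dots> = op (e c) r"
      using rc by (simp add: col_g vec_mat_op[OF N_carrier, symmetric])
    also have "op (e c) = (op ^^ Suc (c mod ?k)) (v ?q)"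
      by (simp add: e_def)
    also have "\<dots> r = (\<Sum>i<?d. g $$ (r, i) * block_shift n b \<delta> $$ (i, c))"
    proof (cases "Suc c mod ?k = 0")
      case False
      then have "Suc c mod ?k = Suc (c mod ?k)" "Suc c div ?k = ?q"
        by (auto simp: mod_Suc div_Suc split: if_splits)
      then have e: "e (Suc c) = (op ^^ Suc (c mod ?k)) (v ?q)" by (simp only: e_def)
      have "Suc c \<noteq> ?d" using False d by (metis mod_mult_self1_is_0)
      then have lt: "Suc c < ?d" using rc by simp
      have "(\<Sum>i<?d. g $$ (r, i) * block_shift n b \<delta> $$ (i, c)) = (\<Sum>i<?d. if i = Suc c then e (Suc c) r else 0)"
        using rc False by (intro sum.cong) (auto simp: block_shift_def g_def)
      also have "\<dots> = e (Suc c) r" using lt by simp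
      finally show ?thesis unfolding e ..
    next
      case True
      then have mod: "Suc (c mod ?k) = ?k" using b_pos by (simp add: mod_Suc split: if_splits)
      \<comment> \<open>The last vector of a block is sent to \<open>N^(2b) v_j\<close>, a multiple
        of the first vector, whose index is \<open>i\<close>.\<close>
      define i where "i = ?q * ?k"
      have "c = ?q * ?k + c mod ?k" by (rule div_mult_mod_eq[symmetric])
      then have i: "i + ?k = Suc c" using mod unfolding i_def by linarith
      have e: "e i = v ?q" using b_pos by (simp add: e_def i_def)
      have "(\<Sum>i<?d. g $$ (r, i) * block_shift n b \<delta> $$ (i, c)) = (\<Sum>l<?d. if l = i then \<delta> ?q * e i r else 0)"
        using rc True i by (intro sum.cong) (auto simp: block_shift_def g_def)
      also have "\<dots> = \<delta> ?q * v ?q r" using i rc b_pos by (simp add: e)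
      also have "\<dots> = (op ^^ Suc (c mod ?k)) (v ?q) r"
        using v(1)[OF q] unfolding mod by (simp add: W_def fscale_def)
      finally show ?thesis ..
    qed
    also have "\<dots> = (g * block_shift n b \<delta>) $$ (r, c)"
      using g rc by (simp add: scalar_prod_def lessThan_atLeast0)
    finally show "(N * g) $$ (r, c) = (g * block_shift n b \<delta>) $$ (r, c)" .
  qed (use g N_carrier in auto)
  show ?thesis using g 1 2 by blast
qed

end

subsection \<open>Symplectic bases\<close>

lemma mirror_less:
  assumes "b > 0" "b dvd n" "r < 2 * n"
  shows "mirror b r < 2 * n"
proof -
  obtain D where n: "n = b * D" using assms(2) by blast
  have "r div (2 * b) < D" using assms(3) n by (simp add: less_mult_imp_div_less mult_ac)
  then have "(r div (2 * b) + 1) * (2 * b) \<le> D * (2 * b)" by (intro mult_right_mono) auto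
  moreover have "mirror b r < (r div (2 * b) + 1) * (2 * b)"
    unfolding mirror_def using assms(1) by simp
  ultimately show ?thesis using n by (simp add: mult_ac)
qed

lemma mirror_mirror: "b > 0 \<Longrightarrow> mirror b (mirror b r) = r"
  using eq_mirror_iff[of b "mirror b r" r] eq_mirror_iff[of b r "mirror b r"] by (simp add: add.commute)

text \<open>Mirrored positions add up to the odd number \<open>2 * b - 1\<close>, so their parities
  differ.\<close>

lemma mirror_sign:
  assumes "b > 0"
  shows "(- 1) ^ (mirror b r mod (2 * b)) = - ((- 1) ^ (r mod (2 * b)) :: 'a::comm_ring_1)"
proof -
  have "r mod (2 * b) + mirror b r mod (2 * b) = 2 * b - 1"
    using eq_mirror_iff[OF assms, of "mirror b r" r] by simp
  moreover have "odd (2 * b - 1)" using assms by simp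
  ultimately have "odd (r mod (2 * b) + mirror b r mod (2 * b))" by simp
  then show ?thesis by (cases "even (r mod (2 * b))") auto
qed

text \<open>Mirroring twice returns to the start with opposite sign. The resulting explicit inverse
  yields both nondegeneracy of the form and invertibility of any basis with this Gram
  matrix.\<close>

lemma block_form_sq:
  assumes "b > 0" "b dvd n"
  shows "block_form n b * block_form n b = - (1\<^sub>m (2 * n) :: 'a::comm_ring_1 mat)"
proof (rule eq_matI)
  let ?J = "block_form n b :: 'a mat"
  fix r c assume "r < dim_row (- (1\<^sub>m (2 * n) :: 'a mat))" "c < dim_col (- (1\<^sub>m (2 * n) :: 'a mat))"
  then have rc: "r < 2 * n" "c < 2 * n" by auto
  have "(?J * ?J) $$ (r, c) = (\<Sum>i<2*n. ?J $$ (r, i) * ?J $$ (i, c))"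
    using rc by (simp add: scalar_prod_def lessThan_atLeast0 block_form_def)
  also have "\<dots> = (\<Sum>i<2*n. if i = mirror b r then (- 1) ^ (r mod (2 * b)) * ?J $$ (mirror b r, c) else 0)"
    using rc by (intro sum.cong) (auto simp: block_form_def)
  also have "\<dots> = (- 1) ^ (r mod (2 * b)) * ?J $$ (mirror b r, c)"
    using mirror_less[OF assms rc(1)] by simp
  also have "\<dots> = (if r = c then - 1 else 0)"
    using rc mirror_less[OF assms rc(1)]
    by (auto simp: block_form_def mirror_mirror[OF assms(1)] mirror_sign[OF assms(1)] simp flip: power_add mult_2)
  finally show "(?J * ?J) $$ (r, c) = (- (1\<^sub>m (2 * n) :: 'a mat)) $$ (r, c)"
    using rc by simp
qed (auto simp: block_form_def)

lemma transpose_block_form: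
  assumes "b > 0"
  shows "transpose_mat (block_form n b) = - (block_form n b :: 'a::comm_ring_1 mat)"
proof (rule eq_matI)
  fix r c assume "r < dim_row (- (block_form n b :: 'a mat))" "c < dim_col (- (block_form n b :: 'a mat))"
  then have rc: "r < 2 * n" "c < 2 * n" by (auto simp: block_form_def)
  have "r = mirror b c \<longleftrightarrow> c = mirror b r" using mirror_mirror[OF assms] by metis
  then show "transpose_mat (block_form n b) $$ (r, c) = (- (block_form n b :: 'a mat)) $$ (r, c)"
    using rc by (auto simp: block_form_def mirror_sign[OF assms])
qed (auto simp: block_form_def)

lemma symplectic_block_form:
  assumes b: "b > 0" "b dvd n" and two: "(2 :: 'a::field) \<noteq> 0"
  shows "symplectic_form n (block_form n b :: 'a mat)"
  unfolding symplectic_form_def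
proof (intro conjI ballI impI)
  let ?J = "block_form n b :: 'a mat" and ?d = "2 * n"
  have J: "?J \<in> carrier_mat ?d ?d" by (rule block_form_carrier)
  fix v :: "'a vec" assume v: "v \<in> carrier_vec ?d"
  have "v \<bullet> (?J *\<^sub>v v) = (transpose_mat ?J *\<^sub>v v) \<bullet> v"
    using v J by (simp add: transpose_vec_mult_scalar[of _ ?d ?d])
  also have "\<dots> = - ((?J *\<^sub>v v) \<bullet> v)"
    unfolding transpose_block_form[OF b(1)] using v J by (simp add: uminus_mult_mat_vec)
  also have "(?J *\<^sub>v v) \<bullet> v = v \<bullet> (?J *\<^sub>v v)"
    by (rule comm_scalar_prod[of _ ?d]) (use v J in auto)
  finally have "2 * (v \<bullet> (?J *\<^sub>v v)) = 0" by (simp add: eq_neg_iff_add_eq_0)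
  then show "v \<bullet> (?J *\<^sub>v v) = 0" using two by simp
  assume orth: "\<forall>w\<in>carrier_vec ?d. v \<bullet> (?J *\<^sub>v w) = 0"
  show "v = 0\<^sub>v ?d"
  proof (rule eq_vecI)
    fix i assume "i < dim_vec (0\<^sub>v ?d :: 'a vec)"
    then have i: "i < ?d" by simp
    let ?w = "?J *\<^sub>v unit_vec ?d i"
    have "0 = v \<bullet> (?J *\<^sub>v ?w)" using orth J by simp
    also have "?J *\<^sub>v ?w = (?J * ?J) *\<^sub>v unit_vec ?d i"
      using J by (simp add: assoc_mult_mat_vec[of _ ?d ?d _ ?d])
    also have "\<dots> = - unit_vec ?d i"
      unfolding block_form_sq[OF b] by (simp add: uminus_mult_mat_vec)
    also have "v \<bullet> (- unit_vec ?d i) = - vec_index v i"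
      using v i by simp
    finally show "vec_index v i = vec_index (0\<^sub>v ?d) i" using i by simp
  qed (use v in simp)
qed (rule block_form_carrier)

lemma mat_form_sum_right:
  assumes J: "J \<in> carrier_mat d d"
  shows "mat_form d J f (\<Sum>i\<in>A. g i) = (\<Sum>i\<in>A. mat_form d J f (g i))"
proof -
  interpret additive "mat_form d J f" by standard (rule mat_form_bilinear(2)[OF J])
  show ?thesis by (rule sum)
qed

text \<open>The \<open>k < d\<close> conditions are the rows of a square matrix padded with zero
  rows; a zero row forces a nontrivial kernel.\<close>

lemma exists_orthogonal:
  assumes J: "(J :: 'a::field mat) \<in> carrier_mat d d" and k: "k < d"
  shows "\<exists>x. (\<forall>i\<ge>d. x i = 0) \<and> x \<noteq> 0 \<and> (\<forall>r<k. mat_form d J (e r) x = 0)"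
proof -
  let ?c = "\<lambda>i. if i < k then transpose_mat J *\<^sub>v vec d (e i) else 0\<^sub>v d"
  let ?M = "mat\<^sub>r d d (\<lambda>i. if i = k then 0\<^sub>v d else ?c i)"
  have "det ?M = 0" using J k by (intro det_row_0) auto
  then obtain w where w: "w \<in> carrier_vec d" "w \<noteq> 0\<^sub>v d" "?M *\<^sub>v w = 0\<^sub>v d"
    using det_0_iff_vec_prod_zero[of ?M d] by auto
  have "mat_form d J (e r) (fun_of_vec w) = 0" if r: "r < k" for r
  proof -
    have "mat_form d J (e r) (fun_of_vec w) = (transpose_mat J *\<^sub>v vec d (e r)) \<bullet> w"
      using J w by (simp add: mat_form_def vec_fun_of_vec transpose_vec_mult_scalar[of _ d d])
    also have "\<dots> = vec_index (?M *\<^sub>v w) r"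
      using J r k by simp
    also have "\<dots> = 0" unfolding w(3) using r k by simp
    finally show ?thesis .
  qed
  moreover have "fun_of_vec w \<noteq> 0"
  proof
    assume "fun_of_vec w = 0"
    then have "vec d (fun_of_vec w) = 0\<^sub>v d" by (simp add: vec_zero_fun)
    with w show False by (simp add: vec_fun_of_vec)
  qed
  ultimately show ?thesis
    using w(1) by (intro exI[of _ "fun_of_vec w"]) (auto simp: fun_of_vec_def[of w])
qed

text \<open>Symplectic Gram-Schmidt: each step adds a hyperbolic pair \<open>x\<close>,
  \<open>y\<close> orthogonal to the previous vectors.\<close>

lemma exists_symplectic_family:
  assumes J: "symplectic_form n (J :: 'a::field mat)" and "m \<le> n"
  shows "\<exists>e. \<forall>r<2*m. \<forall>c<2*m. mat_form (2 * n) J (e r) (e c) =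
    (if c = mirror 1 r then (- 1) ^ (r mod 2) else 0)"
  using assms(2)
proof (induction m)
  case (Suc m)
  let ?B = "mat_form (2 * n) J" and ?p = "mirror 1" and ?s = "\<lambda>r. (- 1) ^ (r mod 2) :: 'a"
  have J': "J \<in> carrier_mat (2 * n) (2 * n)" using J by (simp add: symplectic_form_def)
  note bil = mat_form_bilinear[OF J']
  obtain e where e: "\<And>r c. r < 2 * m \<Longrightarrow> c < 2 * m \<Longrightarrow> ?B (e r) (e c) = (if c = ?p r then ?s r else 0)"
    using Suc by auto
  obtain x where x: "\<And>i. i \<ge> 2 * n \<Longrightarrow> x i = 0" "x \<noteq> 0" "\<And>r. r < 2 * m \<Longrightarrow> ?B (e r) x = 0"
    using exists_orthogonal[OF J', of "2 * m" e] Suc.prems by auto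
  obtain y0 where y0: "?B x y0 \<noteq> 0" using mat_form_nondeg[OF J x(1,2)] by blast
  \<comment> \<open>\<open>y1\<close> normalizes the pairing with \<open>x\<close> to 1. The sum
    added next cancels its pairings with the earlier vectors and leaves the pairing with
    \<open>x\<close> alone, because \<open>x\<close> is orthogonal to them.\<close>
  define y1 where "y1 = fscale (inverse (?B x y0)) y0"
  define y where "y = y1 + (\<Sum>s<2*m. fscale (?s s * ?B (e (?p s)) y1) (e s))"
  have xe: "?B x (e r) = 0" if "r < 2 * m" for r
    using x(3)[OF that] mat_form_anti[OF J, of x "e r"] by simp
  have xy: "?B x y = 1"
    using y0 by (simp add: y_def y1_def bil mat_form_sum_right[OF J'] xe)
  have ey: "?B (e r) y = 0" if r: "r < 2 * m" for r
  proof -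
    have p: "?p r < 2 * m" using mirror_less[of 1 m r] r by simp
    have "?B (e r) y = ?B (e r) y1 + (\<Sum>s<2*m. ?s s * ?B (e (?p s)) y1 * ?B (e r) (e s))"
      by (simp add: y_def bil mat_form_sum_right[OF J'])
    also have "(\<Sum>s<2*m. ?s s * ?B (e (?p s)) y1 * ?B (e r) (e s)) =
        (\<Sum>s<2*m. if s = ?p r then ?s (?p r) * ?B (e r) y1 * ?s r else 0)"
      using r by (intro sum.cong) (auto simp: e mirror_mirror)
    also have "\<dots> = ?s (?p r) * ?s r * ?B (e r) y1" using p by (simp add: mult_ac)
    also have "?s (?p r) * ?s r = - 1"
      using mirror_sign[of 1 r, where ?'a = 'a] by (cases "even (r mod 2)") auto
    finally show ?thesis by simp
  qed
  have ye: "?B y (e r) = 0" if "r < 2 * m" for r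
    using ey[OF that] mat_form_anti[OF J, of y "e r"] by simp
  have yx: "?B y x = - 1" using xy mat_form_anti[OF J, of y x] by simp
  define e' where "e' r = (if r < 2 * m then e r else if r = 2 * m then x else y)" for r
  have p1: "?p r < 2 * m" if "r < 2 * m" for r using mirror_less[of 1 m r] that by simp
  have p2: "?p (2 * m) = Suc (2 * m)" "?p (Suc (2 * m)) = 2 * m" by (simp_all add: mirror_def)
  have p3: "c < 2 * m \<Longrightarrow> ?p c \<noteq> 2 * m" "c < 2 * m \<Longrightarrow> ?p c \<noteq> Suc (2 * m)" for c using p1[of c] by auto
  have "?B (e' r) (e' c) = (if c = ?p r then ?s r else 0)" if "r < 2 * Suc m" "c < 2 * Suc m" for r c
  proof -
    have "r < 2 * m \<or> r = 2 * m \<or> r = Suc (2 * m)" "c < 2 * m \<or> c = 2 * m \<or> c = Suc (2 * m)"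
      using that by (auto simp: less_Suc_eq)
    then show ?thesis
      by (elim disjE) (auto simp: e'_def e x xe ye ey xy yx p2[unfolded One_nat_def] mat_form_alt[OF J] dest: p1[unfolded One_nat_def])
  qed
  then show ?case by blast
qed simp

lemma exists_congruence_std:
  assumes J: "symplectic_form n (J :: 'a::field mat)"
  shows "\<exists>g\<in>carrier_mat (2 * n) (2 * n). transpose_mat g * J * g = block_form n 1"
proof -
  let ?d = "2 * n"
  obtain e where e: "\<And>r c. r < ?d \<Longrightarrow> c < ?d \<Longrightarrow>
      mat_form ?d J (e r) (e c) = (if c = mirror 1 r then (- 1) ^ (r mod 2) else 0)"
    using exists_symplectic_family[OF J, of n] by auto
  have J': "J \<in> carrier_mat ?d ?d" using J by (simp add: symplectic_form_def)
  show ?thesis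
    using gram_mat_of_family[OF J', of e]
    by (intro bexI[of _ "mat ?d ?d (\<lambda>(r, c). e c r)"]) (auto simp: block_form_def e intro!: eq_matI)
qed

lemma mult_cancel_mat:
  assumes "a \<in> carrier_mat d d" "b \<in> carrier_mat d d" "x \<in> carrier_mat d d" "a * b = (1\<^sub>m d :: 'a::semiring_1 mat)"
  shows "a * (b * x) = x"
  using assms by (metis assoc_mult_mat left_mult_one_mat)

text \<open>Since \<open>block_form n b\<close> squares to \<open>-1\<close>, the Gram identity
  multiplied by its negative exhibits a left inverse of \<open>g\<close>, which for square matrices
  is two-sided.\<close>

lemma gram_imp_inverse:
  fixes J g :: "'a::field mat"
  assumes J: "J \<in> carrier_mat (2 * n) (2 * n)" and g: "g \<in> carrier_mat (2 * n) (2 * n)"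
    and b: "b > 0" "b dvd n" and gram: "transpose_mat g * J * g = block_form n b"
  shows "\<exists>h\<in>carrier_mat (2 * n) (2 * n). g * h = 1\<^sub>m (2 * n) \<and> h * g = 1\<^sub>m (2 * n)"
proof -
  let ?d = "2 * n" and ?S = "block_form n b :: 'a mat"
  let ?h = "(- ?S) * (transpose_mat g * J)"
  have S: "?S \<in> carrier_mat ?d ?d" by (rule block_form_carrier)
  have h: "?h \<in> carrier_mat ?d ?d"
    by (rule mult_carrier_mat[of _ _ ?d]) (use J g S in auto)
  have "?h * g = (- ?S) * ?S"
    unfolding gram[symmetric] using J g S
    by (simp add: assoc_mult_mat[of _ ?d ?d _ ?d _ ?d])
  also have "\<dots> = - (?S * ?S)" by (rule uminus_mult_left_mat) (use S in auto)
  also have "\<dots> = 1\<^sub>m ?d" unfolding block_form_sq[OF b] by (intro eq_matI) auto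
  finally have "?h * g = 1\<^sub>m ?d" .
  then show ?thesis using mat_mult_left_right_inverse[OF h g] h by blast
qed

text \<open>Both \<open>J\<close> and \<open>block_form n b\<close> are congruent to the block form
  with \<open>b = 1\<close>, hence to each other.\<close>

theorem exists_congruence:
  assumes J: "symplectic_form n (J :: 'a::field mat)" and b: "b > 0" "b dvd n" and two: "(2 :: 'a) \<noteq> 0"
  shows "\<exists>g\<in>carrier_mat (2 * n) (2 * n). transpose_mat g * J * g = block_form n b"
proof -
  let ?d = "2 * n" and ?S = "block_form n b :: 'a mat"
  have J': "J \<in> carrier_mat ?d ?d" using J by (simp add: symplectic_form_def)
  obtain g where g: "g \<in> carrier_mat ?d ?d" "transpose_mat g * J * g = block_form n 1"
    using exists_congruence_std[OF J] by blast
  obtain g0 where g0: "g0 \<in> carrier_mat ?d ?d" "transpose_mat g0 * ?S * g0 = block_form n 1"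
    using exists_congruence_std[OF symplectic_block_form[OF b two]] by blast
  obtain h where h: "h \<in> carrier_mat ?d ?d" "g0 * h = 1\<^sub>m ?d" "h * g0 = 1\<^sub>m ?d"
    using gram_imp_inverse[OF block_form_carrier g0(1) _ _ g0(2)] by auto
  have th: "transpose_mat h * transpose_mat g0 = 1\<^sub>m ?d"
    using transpose_mult[OF g0(1) h(1)] h by simp
  have "transpose_mat (g * h) * J * (g * h) = transpose_mat h * (transpose_mat g * J * g) * h"
    using g(1) h(1) J' by (simp add: transpose_mult[of _ ?d ?d _ ?d] assoc_mult_mat[of _ ?d ?d _ ?d _ ?d])
  also have "\<dots> = transpose_mat h * (transpose_mat g0 * ?S * g0) * h"
    by (simp only: g(2) g0(2))
  also have "\<dots> = (transpose_mat h * transpose_mat g0) * ?S * (g0 * h)"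
    using g0(1) h(1) block_form_carrier[of n b, where ?'a = 'a] by (simp add: assoc_mult_mat[of _ ?d ?d _ ?d _ ?d])
  also have "\<dots> = ?S" unfolding th h(2) using block_form_carrier[of n b, where ?'a = 'a] by (simp add: left_mult_one_mat[of _ ?d ?d] right_mult_one_mat[of _ ?d ?d])
  finally show ?thesis using g h by (intro bexI[of _ "g * h"]) auto
qed

subsection \<open>Conjugacy classes and rotations\<close>

lemma conj_class_iff:
  fixes J :: "'a::field mat" and N :: "'a fls mat"
  shows "N' \<in> conj_class n J N \<longleftrightarrow> (\<exists>g\<in>carrier_mat (2 * n) (2 * n). \<exists>h\<in>carrier_mat (2 * n) (2 * n).
     g * h = 1\<^sub>m (2 * n) \<and> h * g = 1\<^sub>m (2 * n) \<and>
     transpose_mat g * map_mat fls_const J * g = map_mat fls_const J \<and> N' = g * N * h)"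
    (is "?l \<longleftrightarrow> ?r")
proof
  assume ?l
  then obtain g where g: "g \<in> carrier (Sp n (map_mat fls_const J))" "N' = Ad n g N"
    by (auto simp: conj_class_def)
  then obtain h where h: "g \<in> carrier_mat (2 * n) (2 * n)" "h \<in> carrier_mat (2 * n) (2 * n)"
      "h * g = 1\<^sub>m (2 * n)" "g * h = 1\<^sub>m (2 * n)"
      "transpose_mat g * map_mat fls_const J * g = map_mat fls_const J"
    by (auto simp: Sp_def carrier_GL)
  moreover have "N' = g * N * h" using g(2) h by (simp add: Ad_def GL_inv_eqI)
  ultimately show ?r by blast
next
  assume ?r
  then obtain g h where h: "g \<in> carrier_mat (2 * n) (2 * n)" "h \<in> carrier_mat (2 * n) (2 * n)"
      "h * g = 1\<^sub>m (2 * n)" "g * h = 1\<^sub>m (2 * n)"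
      "transpose_mat g * map_mat fls_const J * g = map_mat fls_const J" "N' = g * N * h"
    by blast
  then have "g \<in> carrier (Sp n (map_mat fls_const J))" "N' = Ad n g N"
    by (auto simp: Sp_def carrier_GL Ad_def GL_inv_eqI)
  then show ?l by (auto simp: conj_class_def)
qed

lemma conj_class_refl:
  assumes J: "J \<in> carrier_mat (2 * n) (2 * n)" and N: "N \<in> carrier_mat (2 * n) (2 * n)"
  shows "N \<in> conj_class n J N"
  unfolding conj_class_iff using assms by (intro bexI[of _ "1\<^sub>m (2 * n)"]) auto

lemma conj_class_char_poly:
  assumes N: "N \<in> carrier_mat (2 * n) (2 * n)" and "N' \<in> conj_class n J N"
  shows "char_poly N' = char_poly N"
proof -
  obtain g h where gh: "g \<in> carrier_mat (2 * n) (2 * n)" "h \<in> carrier_mat (2 * n) (2 * n)"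
      "h * g = 1\<^sub>m (2 * n)" "g * h = 1\<^sub>m (2 * n)" "N' = g * N * h"
    using assms(2) unfolding conj_class_iff by blast
  then have "similar_mat_wit N' N g h"
    using N by (auto simp: similar_mat_wit_def Let_def)
  then show ?thesis by (intro char_poly_similar) (auto simp: similar_mat_def)
qed

lemma conj_class_sp:
  assumes J: "J \<in> carrier_mat (2 * n) (2 * n)" and N: "N \<in> sp_F n J" and N': "N' \<in> conj_class n J N"
  shows "N' \<in> sp_F n J"
proof -
  let ?d = "2 * n" and ?J = "map_mat fls_const J"
  have J': "?J \<in> carrier_mat ?d ?d" using J by simp
  have Nc: "N \<in> carrier_mat ?d ?d" and eq: "transpose_mat N * ?J + ?J * N = 0\<^sub>m ?d ?d"
    using N by (auto simp: sp_def)
  obtain g h where gh: "g \<in> carrier_mat ?d ?d" "h \<in> carrier_mat ?d ?d"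
      "g * h = 1\<^sub>m ?d" "h * g = 1\<^sub>m ?d" "transpose_mat g * ?J * g = ?J" "N' = g * N * h"
    using N' unfolding conj_class_iff by blast
  note assoc = assoc_mult_mat[of _ ?d ?d _ ?d _ ?d]
  have th: "transpose_mat h * transpose_mat g = 1\<^sub>m ?d"
    using transpose_mult[OF gh(1,2)] gh(3) by simp
  have gJ: "transpose_mat g * ?J = ?J * h"
  proof -
    have "transpose_mat g * ?J = transpose_mat g * ?J * (g * h)" using gh J' by simp
    also have "\<dots> = (transpose_mat g * ?J * g) * h" using gh(1,2) J' by (simp add: assoc)
    finally show ?thesis unfolding gh(5) .
  qed
  have Jg: "?J * g = transpose_mat h * ?J"
  proof -
    have "?J * g = (transpose_mat h * transpose_mat g) * (?J * g)" unfolding th using gh(1) J' by simp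
    also have "\<dots> = transpose_mat h * (transpose_mat g * ?J * g)" using gh(1,2) J' by (simp add: assoc)
    finally show ?thesis unfolding gh(5) .
  qed
  have "transpose_mat N' * ?J = transpose_mat h * (transpose_mat N * (transpose_mat g * ?J))"
    unfolding gh(6) using gh(1,2) Nc J' by (simp add: transpose_mult[of _ ?d ?d _ ?d] assoc)
  also have "\<dots> = transpose_mat h * (transpose_mat N * ?J) * h"
    unfolding gJ using gh(1,2) Nc J' by (simp add: assoc)
  finally have 1: "transpose_mat N' * ?J = transpose_mat h * (transpose_mat N * ?J) * h" .
  have "?J * N' = (?J * g) * N * h" unfolding gh(6) using gh(1,2) Nc J' by (simp add: assoc)
  also have "\<dots> = transpose_mat h * (?J * N) * h" unfolding Jg using gh(1,2) Nc J' by (simp add: assoc)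
  finally have 2: "?J * N' = transpose_mat h * (?J * N) * h" .
  have "transpose_mat N' * ?J + ?J * N' = transpose_mat h * (transpose_mat N * ?J + ?J * N) * h"
    unfolding 1 2 using gh(1,2) Nc J'
    by (simp add: mult_add_distrib_mat[of _ ?d ?d _ ?d] add_mult_distrib_mat[of _ ?d ?d _ _ ?d])
  also have "\<dots> = 0\<^sub>m ?d ?d" unfolding eq using gh(1,2) by simp
  finally show ?thesis using gh Nc by (simp add: sp_def)
qed

text \<open>This carries nondegeneracy of \<open>J\<close> from \<open>k\<close> to
  \<open>F\<close>: \<open>J\<close> is congruent over \<open>k\<close> to a
  \<open>block_form\<close>, which is symplectic over \<open>F\<close> by its explicit
  inverse.\<close>

lemma symplectic_congruent:
  assumes S: "symplectic_form n (S :: 'a::field mat)"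
    and gh: "g \<in> carrier_mat (2 * n) (2 * n)" "h \<in> carrier_mat (2 * n) (2 * n)" "h * g = 1\<^sub>m (2 * n)"
      "g * h = 1\<^sub>m (2 * n)"
  shows "symplectic_form n (transpose_mat h * S * h)"
  unfolding symplectic_form_def
proof (intro conjI ballI impI)
  let ?d = "2 * n" and ?J = "transpose_mat h * S * h"
  have S': "S \<in> carrier_mat ?d ?d" using S by (simp add: symplectic_form_def)
  show "?J \<in> carrier_mat ?d ?d" using S' gh by simp
  have form: "v \<bullet> (?J *\<^sub>v w) = (h *\<^sub>v v) \<bullet> (S *\<^sub>v (h *\<^sub>v w))"
    if "v \<in> carrier_vec ?d" "w \<in> carrier_vec ?d" for v w
  proof -
    have "?J *\<^sub>v w = transpose_mat h *\<^sub>v (S *\<^sub>v (h *\<^sub>v w))"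
      using S' gh that by (simp add: assoc_mult_mat_vec[of _ ?d ?d _ ?d])
    then have "v \<bullet> (?J *\<^sub>v w) = (transpose_mat h *\<^sub>v (S *\<^sub>v (h *\<^sub>v w))) \<bullet> v"
      using S' gh that by (simp add: comm_scalar_prod[of _ ?d])
    also have "\<dots> = (S *\<^sub>v (h *\<^sub>v w)) \<bullet> (h *\<^sub>v v)"
      by (rule transpose_vec_mult_scalar[of _ ?d ?d]) (use S' gh that in auto)
    finally show ?thesis using S' gh that by (simp add: comm_scalar_prod[of _ ?d])
  qed
  fix v :: "'a vec" assume v: "v \<in> carrier_vec ?d"
  show "v \<bullet> (?J *\<^sub>v v) = 0"
    using S gh v by (simp add: form symplectic_form_def)
  assume orth: "\<forall>w\<in>carrier_vec ?d. v \<bullet> (?J *\<^sub>v w) = 0"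
  have "(h *\<^sub>v v) \<bullet> (S *\<^sub>v u) = 0" if u: "u \<in> carrier_vec ?d" for u
  proof -
    have "h *\<^sub>v (g *\<^sub>v u) = u"
      using gh u assoc_mult_mat_vec[of h ?d ?d g ?d u] by simp
    then show ?thesis using orth form[OF v, of "g *\<^sub>v u"] gh u by auto
  qed
  then have "h *\<^sub>v v = 0\<^sub>v ?d"
    using S gh v unfolding symplectic_form_def by (metis mult_mat_vec_carrier)
  then have "g *\<^sub>v (h *\<^sub>v v) = 0\<^sub>v ?d" using gh by (auto intro!: eq_vecI)
  then show "v = 0\<^sub>v ?d"
    using gh v assoc_mult_mat_vec[of g ?d ?d h ?d v] by simp
qed

section \<open>Constants, power series and rotations as ring homomorphisms\<close>

interpretation fls_const: inj_comm_ring_hom "fls_const :: 'a::field \<Rightarrow> 'a fls"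
  by standard (auto simp: fls_plus_const)

interpretation fps_to_fls: inj_comm_ring_hom "fps_to_fls :: 'a::field fps \<Rightarrow> 'a fls"
  by standard (auto simp: fls_times_fps_to_fls)

lemma fls_subdegree_rotate:
  assumes "l \<noteq> 0"
  shows "fls_subdegree (fls_rotate l x) = fls_subdegree x"
proof (cases "x = 0")
  case True
  then have "fls_rotate l x = 0" by (intro fls_eqI) simp
  with True show ?thesis by simp
next
  case False
  then show ?thesis using assms by (intro fls_subdegree_eqI) auto
qed

lemma fls_rotate_hom:
  assumes l: "l \<noteq> (0 :: 'a::field)"
  shows "comm_ring_hom (fls_rotate l)"
proof
  fix x y :: "'a fls"
  show "fls_rotate l (x * y) = fls_rotate l x * fls_rotate l y"
  proof (rule fls_eqI)
    fix e
    have "fls_nth (fls_rotate l x * fls_rotate l y) e =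
        (\<Sum>i=fls_subdegree x..e - fls_subdegree y. l powi i * fls_nth x i * (l powi (e - i) * fls_nth y (e - i)))"
      by (subst fls_times_nth_bounds[where lo = "fls_subdegree x" and hi = "e - fls_subdegree y"])
        (simp_all add: fls_subdegree_rotate[OF l])
    also have "\<dots> = (\<Sum>i=fls_subdegree x..e - fls_subdegree y. l powi e * (fls_nth x i * fls_nth y (e - i)))"
    proof (intro sum.cong refl)
      fix i
      have "l powi e = l powi i * l powi (e - i)" using l by (simp flip: power_int_add)
      then show "l powi i * fls_nth x i * (l powi (e - i) * fls_nth y (e - i)) = l powi e * (fls_nth x i * fls_nth y (e - i))"
        by (simp add: mult_ac)
    qed
    also have "\<dots> = fls_nth (fls_rotate l (x * y)) e"
      by (simp add: fls_times_nth(2) sum_distrib_left)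
    finally show "fls_nth (fls_rotate l (x * y)) e = fls_nth (fls_rotate l x * fls_rotate l y) e" ..
  qed
qed (intro fls_eqI; simp add: algebra_simps)+

lemma fls_rotate_const: "fls_rotate l (fls_const c) = fls_const c"
  by (rule fls_eqI) simp

lemma fls_rotate_monom: "fls_rotate l (fls_const c * fls_X_intpow m) = fls_const (l powi m) * (fls_const c * fls_X_intpow m)"
proof (rule fls_eqI)
  fix e
  have "fls_nth (fls_const c * fls_X_intpow m) e = (if e = m then c else 0)" by simp
  then show "fls_nth (fls_rotate l (fls_const c * fls_X_intpow m)) e =
      fls_nth (fls_const (l powi m) * (fls_const c * fls_X_intpow m)) e"
    by (simp only: fls_rotate_nth fls_nth_mult_monom) simp
qed

section \<open>Diagonal matrices and powers of the truncated shift\<close>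

definition dmat :: "nat \<Rightarrow> (nat \<Rightarrow> 'a::comm_ring_1) \<Rightarrow> 'a mat" where
  "dmat d f = mat d d (\<lambda>(r, c). if r = c then f r else 0)"

lemma dmat_carrier [simp]: "dmat d f \<in> carrier_mat d d"
  by (simp add: dmat_def)

lemma dmat_dims [simp]: "dim_row (dmat d f) = d" "dim_col (dmat d f) = d"
  by (simp_all add: dmat_def)

lemma dmat_mult_left_nth:
  assumes "A \<in> carrier_mat d d" "r < d" "c < d"
  shows "(dmat d f * A) $$ (r, c) = f r * A $$ (r, c)"
proof -
  have "(dmat d f * A) $$ (r, c) = (\<Sum>i<d. dmat d f $$ (r, i) * A $$ (i, c))"
    using assms by (simp add: scalar_prod_def lessThan_atLeast0)
  also have "\<dots> = (\<Sum>i<d. if i = r then f r * A $$ (r, c) else 0)"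
    using assms(2) by (intro sum.cong) (auto simp: dmat_def)
  finally have "(dmat d f * A) $$ (r, c) = (\<Sum>i<d. if i = r then f r * A $$ (r, c) else 0)" .
  then show ?thesis using assms by simp
qed

lemma dmat_mult_right_nth:
  assumes "A \<in> carrier_mat d d" "r < d" "c < d"
  shows "(A * dmat d f) $$ (r, c) = A $$ (r, c) * f c"
proof -
  have "(A * dmat d f) $$ (r, c) = (\<Sum>i<d. A $$ (r, i) * dmat d f $$ (i, c))"
    using assms by (simp add: scalar_prod_def lessThan_atLeast0)
  also have "\<dots> = (\<Sum>i<d. if i = c then A $$ (r, c) * f c else 0)"
    using assms(3) by (intro sum.cong) (auto simp: dmat_def)
  finally have "(A * dmat d f) $$ (r, c) = (\<Sum>i<d. if i = c then A $$ (r, c) * f c else 0)" .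
  then show ?thesis using assms by simp
qed

lemma dmat_mult: "dmat d f * dmat d g = dmat d (\<lambda>i. f i * g i)"
  by (rule eq_matI) (simp_all add: dmat_mult_left_nth[OF dmat_carrier] del: index_mult_mat(1), simp add: dmat_def)

lemma dmat_one: "(\<And>i. i < d \<Longrightarrow> f i = 1) \<Longrightarrow> dmat d f = 1\<^sub>m d"
  by (rule eq_matI) (auto simp: dmat_def)

lemma transpose_dmat: "transpose_mat (dmat d f) = dmat d f"
  by (rule eq_matI) (auto simp: dmat_def)

lemma det_dmat: "det (dmat d f) = (\<Prod>i<d. f i :: 'a::idom)"
proof -
  have "det (dmat d f) = prod_list (diag_mat (dmat d f))"
    by (rule det_upper_triangular[OF _ dmat_carrier]) (auto simp: dmat_def)
  also have "diag_mat (dmat d f) = map f [0..<d]"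
    by (auto simp: diag_mat_def dmat_def)
  finally show ?thesis by (simp add: prod.list_conv_set_nth prod.distinct_set_conv_list[symmetric] lessThan_atLeast0)
qed

lemma map_mat_block_shift:
  assumes "\<phi> 0 = 0" "\<phi> 1 = 1"
  shows "map_mat \<phi> (block_shift n b \<delta>) = block_shift n b (\<lambda>j. \<phi> (\<delta> j))"
  using assms by (intro eq_matI) (auto simp: block_shift_def)

text \<open>With the corner entries zero the shift only raises the index by one, so its power
  \<open>k\<close> lives on the \<open>k\<close>-th subdiagonal and the power \<open>2 * n\<close>
  vanishes.\<close>

lemma block_shift_0_power:
  assumes "r < 2 * n" "c < 2 * n" "r \<noteq> c + k"
  shows "(block_shift n b (\<lambda>_. 0) ^\<^sub>m k) $$ (r, c) = (0 :: 'a::comm_ring_1)"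
  using assms
proof (induction k arbitrary: c)
  case (Suc k)
  let ?S = "block_shift n b (\<lambda>_. 0) :: 'a mat"
  have "(?S ^\<^sub>m Suc k) $$ (r, c) = (\<Sum>i<2*n. (?S ^\<^sub>m k) $$ (r, i) * ?S $$ (i, c))"
    using Suc.prems by (simp add: scalar_prod_def lessThan_atLeast0)
  also have "\<dots> = 0"
  proof (intro sum.neutral ballI)
    fix i assume "i \<in> {..<2 * n}"
    then have i: "i < 2 * n" by simp
    show "(?S ^\<^sub>m k) $$ (r, i) * ?S $$ (i, c) = 0"
    proof (cases "i = Suc c")
      case True
      then have "(?S ^\<^sub>m k) $$ (r, i) = 0" using Suc.prems i by (intro Suc.IH) auto
      then show ?thesis by simp
    next
      case False
      then have "?S $$ (i, c) = 0" using i Suc.prems by (simp add: block_shift_def)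
      then show ?thesis by simp
    qed
  qed
  finally show ?case .
qed simp

subsection \<open>The almost commuting representative\<close>

lemma map_mat_add:
  fixes A B :: "'a::field fps mat"
  assumes "A \<in> carrier_mat r c" "B \<in> carrier_mat r c"
  shows "map_mat fps_to_fls (A + B) = map_mat fps_to_fls A + map_mat fps_to_fls B"
  using assms by (intro eq_matI) auto

section \<open>Closure properties of Laurent polynomial functions on \<open>k^*\<close>\<close>

lemma regular_Gm_add: "regular_Gm f \<Longrightarrow> regular_Gm g \<Longrightarrow> regular_Gm (\<lambda>l. f l + g l)"
proof -
  assume "regular_Gm f" "regular_Gm g"
  then obtain p i q j where "\<forall>l\<in>carrier Gm. f l = poly p l / l ^ i" "\<forall>l\<in>carrier Gm. g l = poly q l / l ^ j"
    unfolding regular_Gm_def by blast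
  then have "\<forall>l\<in>carrier Gm. f l + g l = poly (Polynomial.monom 1 j * p + Polynomial.monom 1 i * q) l / l ^ (i + j)"
    by (auto simp: Gm_def poly_monom power_add field_simps)
  then show ?thesis unfolding regular_Gm_def by blast
qed

lemma regular_Gm_mult: "regular_Gm f \<Longrightarrow> regular_Gm g \<Longrightarrow> regular_Gm (\<lambda>l. f l * g l)"
proof -
  assume "regular_Gm f" "regular_Gm g"
  then obtain p i q j where "\<forall>l\<in>carrier Gm. f l = poly p l / l ^ i" "\<forall>l\<in>carrier Gm. g l = poly q l / l ^ j"
    unfolding regular_Gm_def by blast
  then have "\<forall>l\<in>carrier Gm. f l * g l = poly (p * q) l / l ^ (i + j)"
    by (auto simp: Gm_def power_add)
  then show ?thesis unfolding regular_Gm_def by blast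
qed

lemma regular_Gm_const: "regular_Gm (\<lambda>_. c)"
  unfolding regular_Gm_def by (intro exI[of _ "[:c:]"] exI[of _ 0]) simp

lemma regular_Gm_powi: "regular_Gm (\<lambda>l. l powi e)"
proof (cases "e \<ge> 0")
  case True
  then show ?thesis
    unfolding regular_Gm_def
    by (intro exI[of _ "Polynomial.monom 1 (nat e)"] exI[of _ 0]) (simp add: poly_monom power_int_def)
next
  case False
  then show ?thesis
    unfolding regular_Gm_def
    by (intro exI[of _ 1] exI[of _ "nat (- e)"]) (simp add: power_int_def field_simps power_inverse)
qed

lemma regular_Gm_sum: "(\<And>i. i \<in> A \<Longrightarrow> regular_Gm (f i)) \<Longrightarrow> regular_Gm (\<lambda>l. \<Sum>i\<in>A. f i l)"
  by (induction A rule: infinite_finite_induct) (simp_all add: regular_Gm_const regular_Gm_add)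

lemma regular_Gm_prod: "(\<And>i. i \<in> A \<Longrightarrow> regular_Gm (f i)) \<Longrightarrow> regular_Gm (\<lambda>l. \<Prod>i\<in>A. f i l)"
  by (induction A rule: infinite_finite_induct) (simp_all add: regular_Gm_const regular_Gm_mult)

text \<open>The frame \<open>g\<close> has entries in \<open>k\<close>, so rotations of
  \<open>F\<close> leave it fixed and only the blocks involve \<open>\<pi>\<close>.\<close>

locale graded_frame =
  fixes n b D :: nat and m :: int and \<alpha> :: "nat \<Rightarrow> 'k::alg_closed_field" and J g h :: "'k mat"
  assumes b_pos: "b > 0" and n: "n = b * D"
    and J: "J \<in> carrier_mat (2 * n) (2 * n)"
    and g: "g \<in> carrier_mat (2 * n) (2 * n)" and h: "h \<in> carrier_mat (2 * n) (2 * n)"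
    and gh: "g * h = 1\<^sub>m (2 * n)" and hg: "h * g = 1\<^sub>m (2 * n)"
    and gram: "transpose_mat g * J * g = block_form n b"
begin

abbreviation d where "d \<equiv> 2 * n"
abbreviation S :: "'a::comm_ring_1 mat" where "S \<equiv> block_form n b"
abbreviation cm :: "'k mat \<Rightarrow> 'k fls mat" where "cm \<equiv> map_mat fls_const"

definition \<delta> :: "nat \<Rightarrow> 'k fls" where
  "\<delta> j = fls_const (\<alpha> j) * fls_X_intpow m"

text \<open>The normal form written in the original coordinates. It depends only on the frame and on
  \<open>b\<close>, \<open>m\<close>, \<open>\<alpha>\<close>, so one matrix can represent the whole
  class.\<close>

definition rep :: "'k fls mat" where
  "rep = cm g * block_shift n b \<delta> * cm h"

lemmas assoc = assoc_mult_mat[of _ d d _ d _ d]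

lemma cm_carrier: "x \<in> carrier_mat d d \<Longrightarrow> cm x \<in> carrier_mat d d"
  by simp

lemma cm_mult: "x \<in> carrier_mat d d \<Longrightarrow> y \<in> carrier_mat d d \<Longrightarrow> cm (x * y) = cm x * cm y"
  by (rule fls_const.mat_hom_mult)

lemma cm_gh: "cm g * cm h = 1\<^sub>m d" "cm h * cm g = 1\<^sub>m d"
  using g h by (simp_all add: gh hg fls_const.mat_hom_one flip: cm_mult)

lemma cm_S: "cm S = S"
  by (intro eq_matI) (auto simp: block_form_def fls_const.hom_uminus fls_const_power)

lemma cm_transpose: "cm (transpose_mat x) = transpose_mat (cm x)"
  by (intro eq_matI) auto

lemma rep_carrier: "rep \<in> carrier_mat d d"
  unfolding rep_def using g h block_shift_carrier[of n b \<delta>] by (intro mult_carrier_mat[of _ _ d]) auto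

lemma J_eq: "J = transpose_mat h * S * h"
proof -
  have th: "transpose_mat h * transpose_mat g = 1\<^sub>m d"
    using transpose_mult[OF g h] gh by simp
  have "transpose_mat h * S * h = (transpose_mat h * transpose_mat g) * J * (g * h)"
    unfolding gram[symmetric] using g h J by (simp add: assoc)
  also have "\<dots> = J" unfolding th gh using J by simp
  finally show ?thesis ..
qed

text \<open>A graded basis \<open>g'\<close> for \<open>N\<close> over \<open>F\<close> and the
  constant frame \<open>g\<close> have the same Gram matrix, so the change from one to the other
  lies in \<open>Sp\<close>, and it carries \<open>N\<close> to \<open>rep\<close>.\<close>

lemma rep_in_conj_class:
  assumes g': "g' \<in> carrier_mat d d" "transpose_mat g' * cm J * g' = S"
    and N: "N \<in> carrier_mat d d" "N * g' = g' * block_shift n b \<delta>"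
  shows "rep \<in> conj_class n J N"
proof -
  let ?T = "block_shift n b \<delta>"
  have T: "?T \<in> carrier_mat d d" by (rule block_shift_carrier)
  obtain h' where h': "h' \<in> carrier_mat d d" "g' * h' = 1\<^sub>m d" "h' * g' = 1\<^sub>m d"
    using gram_imp_inverse[OF cm_carrier[OF J] g'(1) b_pos _ g'(2)] n by auto
  note c = g'(1) h' N(1) T cm_carrier[OF g] cm_carrier[OF h] cm_carrier[OF J] mult_cancel_mat[of _ d]
  let ?x = "cm g * h'" and ?y = "g' * cm h"
  have th': "transpose_mat h' * transpose_mat g' = 1\<^sub>m d"
    using transpose_mult[OF g'(1) h'(1)] h' by simp
  have xy: "?x \<in> carrier_mat d d" "?y \<in> carrier_mat d d"
    using c by (intro mult_carrier_mat[of _ _ d]; simp)+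
  have "?x * ?y = cm g * (h' * (g' * cm h))"
    using c by (simp add: assoc)
  also have "h' * (g' * cm h) = cm h" using c by (intro mult_cancel_mat[of _ d])
  finally have 1: "?x * ?y = 1\<^sub>m d" by (simp only: cm_gh)
  then have 2: "?y * ?x = 1\<^sub>m d" by (rule mat_mult_left_right_inverse[OF xy])
  have "transpose_mat ?x * cm J * ?x = transpose_mat h' * (cm (transpose_mat g * J * g)) * h'"
    using c g J by (simp add: transpose_mult[of _ d d _ d] cm_mult assoc cm_transpose)
  also have "\<dots> = transpose_mat h' * (transpose_mat g' * cm J * g') * h'"
    unfolding gram cm_S g'(2) ..
  also have "\<dots> = (transpose_mat h' * transpose_mat g') * cm J * (g' * h')"
    using c by (simp add: assoc)
  also have "\<dots> = cm J" unfolding th' h'(2) using c by simp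
  finally have 3: "transpose_mat ?x * cm J * ?x = cm J" .
  have "?x * N * ?y = cm g * (h' * ((N * g') * cm h))"
    using c by (simp add: assoc)
  also have "\<dots> = cm g * (h' * (g' * (?T * cm h)))"
    unfolding N(2) using c by (simp add: assoc)
  also have "h' * (g' * (?T * cm h)) = ?T * cm h" using c by (intro mult_cancel_mat[of _ d]) auto
  finally have 4: "?x * N * ?y = rep" unfolding rep_def using c by (simp add: assoc)
  show ?thesis unfolding conj_class_iff using xy 1 2 3 4 by metis
qed

definition wt :: "'k \<Rightarrow> 'k mat" where
  "wt l = dmat d (\<lambda>r. l powi (m * int (r mod (2 * b))))"

definition elt :: "'k \<Rightarrow> 'k mat" where
  "elt l = g * wt l * h"

text \<open>Scaling \<open>\<pi>\<close> by \<open>l ^ (2 * b)\<close> keeps all weights integral: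
  \<open>N^(2b)\<close> has weight \<open>2bm\<close>, and so has \<open>\<pi>^m\<close>.\<close>

definition action :: "'k \<Rightarrow> 'k mat set \<times> 'k" where
  "action l = (scalar_mats n #>\<^bsub>GSp n J\<^esub> elt l, l ^ (2 * b))"

lemma wt_carrier: "wt l \<in> carrier_mat d d"
  by (simp add: wt_def)

lemma elt_carrier: "elt l \<in> carrier_mat d d"
  unfolding elt_def using g h wt_carrier[of l] by (intro mult_carrier_mat[of _ _ d])

lemma wt_mult: "wt l * wt l' = wt (l * l')"
  by (simp add: wt_def dmat_mult power_int_mult_distrib)

lemma wt_1: "wt 1 = 1\<^sub>m d"
  unfolding wt_def by (rule dmat_one) simp

lemma elt_mult: "elt l * elt l' = elt (l * l')"
proof -
  note c = g h wt_carrier[of l] wt_carrier[of l']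
  have "elt l * elt l' = g * (wt l * (h * (g * (wt l' * h))))"
    unfolding elt_def using c by (simp add: assoc)
  also have "h * (g * (wt l' * h)) = wt l' * h"
    using c hg by (intro mult_cancel_mat[of _ d]) auto
  finally show ?thesis
    unfolding elt_def wt_mult[symmetric] using c by (simp add: assoc)
qed

lemma elt_1: "elt 1 = 1\<^sub>m d"
  unfolding elt_def wt_1 using g h gh by simp

text \<open>Positions paired by the form add up to \<open>2 * b - 1\<close>, so all nonzero entries
  acquire the same factor. In general \<open>wt l\<close> is thus a similitude and not an isometry,
  which is where \<open>GSp\<close> enters.\<close>

lemma wt_gram:
  assumes "l \<noteq> 0"
  shows "wt l * S * wt l = l powi (m * int (2 * b - 1)) \<cdot>\<^sub>m S"
proof (rule eq_matI)
  fix r c assume "r < dim_row (l powi (m * int (2 * b - 1)) \<cdot>\<^sub>m S :: 'k mat)"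
    "c < dim_col (l powi (m * int (2 * b - 1)) \<cdot>\<^sub>m S :: 'k mat)"
  then have rc: "r < d" "c < d" by auto
  have S: "(S :: 'k mat) \<in> carrier_mat d d" by (rule block_form_carrier)
  have WS: "wt l * S \<in> carrier_mat d d" using wt_carrier S by (rule mult_carrier_mat)
  have "(wt l * S * wt l) $$ (r, c) =
      l powi (m * int (r mod (2 * b))) * S $$ (r, c) * l powi (m * int (c mod (2 * b)))"
    using dmat_mult_right_nth[OF WS rc] dmat_mult_left_nth[OF S rc] by (simp only: wt_def)
  also have "\<dots> = l powi (m * int (2 * b - 1)) * S $$ (r, c)"
  proof (cases "c = mirror b r")
    case True
    then have "int (2 * b - 1) = int (r mod (2 * b)) + int (c mod (2 * b))"
      using eq_mirror_iff[OF b_pos] by simp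
    then show ?thesis using assms by (simp add: power_int_add distrib_left mult_ac)
  qed (use rc in \<open>simp add: block_form_def\<close>)
  also have "\<dots> = (l powi (m * int (2 * b - 1)) \<cdot>\<^sub>m S) $$ (r, c)" using rc by simp
  finally show "(wt l * S * wt l) $$ (r, c) = (l powi (m * int (2 * b - 1)) \<cdot>\<^sub>m S) $$ (r, c)" .
qed (simp_all add: wt_def)

lemma elt_GSp:
  assumes l: "l \<noteq> 0"
  shows "elt l \<in> carrier (GSp n J)"
proof -
  have "elt (inverse l) * elt l = 1\<^sub>m d" "elt l * elt (inverse l) = 1\<^sub>m d"
    using l by (simp_all add: elt_mult elt_1)
  then have GL: "elt l \<in> carrier (GL d)"
    unfolding carrier_GL using elt_carrier by blast
  note c = g h wt_carrier[of l] J block_form_carrier[of n b, where ?'a = 'k]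
  have "transpose_mat (elt l) * J * elt l = transpose_mat h * (wt l * (transpose_mat g * J * g) * wt l) * h"
    unfolding elt_def using c
    by (simp add: transpose_mult[of _ d d _ d] assoc) (simp add: wt_def transpose_dmat)
  also have "\<dots> = transpose_mat h * (l powi (m * int (2 * b - 1)) \<cdot>\<^sub>m S) * h"
    unfolding gram wt_gram[OF l] ..
  also have "\<dots> = l powi (m * int (2 * b - 1)) \<cdot>\<^sub>m J"
    unfolding J_eq using c by (simp add: mult_smult_distrib[of _ d d _ d] mult_smult_assoc_mat[of _ d d _ d])
  finally show ?thesis
    using GL l by (auto simp: GSp_def intro!: exI[of _ "l powi (m * int (2 * b - 1))"])
qed

text \<open>Within a block the shift raises the weight by \<open>m\<close>. At a corner the weight
  drops from \<open>m * (2b - 1)\<close> to \<open>0\<close>, and the rotation supplies the missing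
  factor \<open>l^(2bm)\<close> through \<open>\<pi>^m\<close>.\<close>

lemma wt_shift:
  assumes l: "l \<noteq> 0"
  shows "cm (wt l) * block_shift n b (\<lambda>j. fls_rotate (l ^ (2 * b)) (\<delta> j)) =
    fls_const (l powi m) \<cdot>\<^sub>m (block_shift n b \<delta> * cm (wt l))" (is "?L = ?R")
proof (rule eq_matI)
  let ?k = "2 * b"
  let ?w = "\<lambda>r. fls_const (l powi (m * int (r mod ?k)))"
  have cw: "cm (wt l) = dmat d ?w" by (intro eq_matI) (auto simp: wt_def dmat_def)
  fix r c assume "r < dim_row ?R" "c < dim_col ?R"
  then have rc: "r < d" "c < d" by (auto simp: wt_def)
  have "?L $$ (r, c) = ?w r * block_shift n b (\<lambda>j. fls_rotate (l ^ ?k) (\<delta> j)) $$ (r, c)"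
    unfolding cw by (rule dmat_mult_left_nth[OF block_shift_carrier rc])
  also have "\<dots> = fls_const (l powi m) * (block_shift n b \<delta> $$ (r, c) * ?w c)"
  proof (cases "Suc c mod ?k = 0")
    case False
    then have "int (Suc c mod ?k) = 1 + int (c mod ?k)" by (auto simp: mod_Suc split: if_splits)
    then have "?w (Suc c) = fls_const (l powi m) * ?w c"
      using l by (simp add: distrib_left power_int_add)
    then show ?thesis using rc False by (auto simp: block_shift_def)
  next
    case True
    then have mod: "int (c mod ?k) = int ?k - 1" using b_pos by (auto simp: mod_Suc split: if_splits)
    show ?thesis
    proof (cases "r + ?k = Suc c")
      case rk: True
      then have r0: "r mod ?k = 0" using True by (metis mod_add_self2)
      have "fls_rotate (l ^ ?k) (\<delta> j) = fls_const (l powi m * l powi (m * (int ?k - 1))) * \<delta> j" for j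
      proof -
        have "l powi m * l powi (m * (int ?k - 1)) = l powi (m * int ?k)"
          using l by (simp flip: power_int_add add: algebra_simps)
        also have "\<dots> = (l ^ ?k) powi m"
          using power_int_mult[of l "int ?k" m] by (simp only: power_int_of_nat mult.commute)
        finally show ?thesis unfolding \<delta>_def fls_rotate_monom by simp
      qed
      then show ?thesis using rc True rk r0 mod by (simp add: block_shift_def mult_ac flip: fls_const_mult_const)
    qed (use rc True in \<open>simp add: block_shift_def\<close>)
  qed
  also have "\<dots> = ?R $$ (r, c)"
    using dmat_mult_right_nth[OF block_shift_carrier rc, of b \<delta> ?w] rc
    by (simp add: cw del: index_mult_mat(1))
  finally show "?L $$ (r, c) = ?R $$ (r, c)" .
qed (simp_all add: wt_def)

lemma almost_commutes_rep:
  assumes "m \<noteq> 0"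
  shows "almost_commutes n action rep"
  unfolding almost_commutes_def
proof (intro exI[of _ m] conjI ballI)
  fix l assume "l \<in> carrier (Gm :: 'k monoid)"
  then have l: "l \<noteq> 0" by (simp add: Gm_def)
  then have l': "l ^ (2 * b) \<noteq> 0" by simp
  interpret rot: comm_ring_hom "fls_rotate (l ^ (2 * b))" by (rule fls_rotate_hom[OF l'])
  let ?T = "block_shift n b \<delta>" and ?T' = "block_shift n b (\<lambda>j. fls_rotate (l ^ (2 * b)) (\<delta> j))"
  let ?x = "cm (elt l)" and ?y = "cm (elt (inverse l))" and ?w = "cm (wt l)" and ?v = "cm (wt (inverse l))"
  note c = cm_carrier[OF g] cm_carrier[OF h] cm_carrier[OF wt_carrier[of l]] cm_carrier[OF wt_carrier[of "inverse l"]]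
    block_shift_carrier[of n b \<delta>] block_shift_carrier[of n b "\<lambda>j. fls_rotate (l ^ (2 * b)) (\<delta> j)"]
  \<comment> \<open>The frame is constant, so the rotation moves only the middle factor of
    \<open>rep\<close>.\<close>
  have rot_cm: "map_mat (fls_rotate (l ^ (2 * b))) (cm x) = cm x" for x
    by (intro eq_matI) (auto simp: fls_rotate_const)
  have "map_mat (fls_rotate (l ^ (2 * b))) (?T * cm h) = ?T' * cm h"
    using c by (subst rot.mat_hom_mult[of _ d d _ d]) (simp_all add: rot_cm map_mat_block_shift)
  moreover have "rep = cm g * (?T * cm h)" unfolding rep_def using c by (simp add: assoc)
  moreover have "?T * cm h \<in> carrier_mat d d" using c by simp
  ultimately have rot: "map_mat (fls_rotate (l ^ (2 * b))) rep = cm g * (?T' * cm h)"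
    using c by (simp add: rot.mat_hom_mult[of _ d d _ d] rot_cm)
  have xe: "?x = cm g * (?w * cm h)" and ye: "?y = cm g * (?v * cm h)"
    unfolding elt_def using g h wt_carrier by (simp_all add: assoc cm_mult mult_carrier_mat[of _ d d _ d])
  have inv: "?y * ?x = 1\<^sub>m d" "?x * ?y = 1\<^sub>m d"
    using l by (simp_all add: elt_mult elt_1 fls_const.mat_hom_one flip: cm_mult[OF elt_carrier elt_carrier])
  have wv: "?w * ?v = 1\<^sub>m d"
    using l by (simp add: wt_mult wt_1 fls_const.mat_hom_one flip: cm_mult[OF wt_carrier wt_carrier])
  have cancel: "cm h * (cm g * x) = x" if "x \<in> carrier_mat d d" for x
    using c that cm_gh by (intro mult_cancel_mat[of _ d]) auto
  have "Q_act n (action l) rep = Ad n ?x (map_mat (fls_rotate (l ^ (2 * b))) rep)"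
    unfolding action_def by (rule Q_act_eq[OF J rep_carrier elt_GSp[OF l]])
  also have "\<dots> = ?x * (cm g * (?T' * cm h)) * ?y"
    unfolding Ad_def rot using inv elt_carrier by (subst GL_inv_eqI[where h = ?y]) auto
  also have "\<dots> = cm g * ((?w * ?T') * (?v * cm h))"
    unfolding xe ye using c by (simp add: assoc cancel)
  also have "\<dots> = cm g * (fls_const (l powi m) \<cdot>\<^sub>m (?T * (?w * (?v * cm h))))"
    unfolding wt_shift[OF l] using c
    by (simp add: assoc mult_smult_assoc_mat[of _ d d _ d])
  also have "?w * (?v * cm h) = cm h" using c wv by (intro mult_cancel_mat[of _ d]) auto
  also have "cm g * (fls_const (l powi m) \<cdot>\<^sub>m (?T * cm h)) = fls_const (l powi m) \<cdot>\<^sub>m rep"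
    unfolding rep_def using c by (simp add: assoc mult_smult_distrib[of _ d d _ d])
  finally show "Q_act n (action l) rep = fls_const (l powi m) \<cdot>\<^sub>m rep" .
qed (rule assms)

lemma regular_Gm_elt:
  assumes "i < d" "j < d"
  shows "regular_Gm (\<lambda>l. elt l $$ (i, j))"
proof -
  have "elt l $$ (i, j) = (\<Sum>r<d. (g $$ (i, r) * l powi (m * int (r mod (2 * b)))) * h $$ (r, j))" for l
  proof -
    have "elt l $$ (i, j) = (\<Sum>r<d. (g * wt l) $$ (i, r) * h $$ (r, j))"
    proof -
      define gw where "gw = g * wt l"
      have "gw \<in> carrier_mat d d" unfolding gw_def using g wt_carrier by (rule mult_carrier_mat)
      then show ?thesis
        unfolding elt_def gw_def[symmetric] using h assms by (simp add: scalar_prod_def lessThan_atLeast0)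
    qed
    also have "\<dots> = (\<Sum>r<d. (g $$ (i, r) * l powi (m * int (r mod (2 * b)))) * h $$ (r, j))"
      unfolding wt_def using g assms by (intro sum.cong refl) (simp add: dmat_mult_right_nth del: index_mult_mat(1))
    finally show ?thesis .
  qed
  then show ?thesis
    by (simp only:) (intro regular_Gm_sum regular_Gm_mult regular_Gm_const regular_Gm_powi)
qed

lemma inverse_det_elt: "l \<noteq> 0 \<Longrightarrow> inverse (det (elt l)) = (\<Prod>r<d. l powi (- (m * int (r mod (2 * b)))))"
proof -
  assume l: "l \<noteq> 0"
  have "det g * det h = 1" using det_mult[OF g h] gh by simp
  moreover have "det (elt l) = det g * det (wt l) * det h"
    unfolding elt_def using g h wt_carrier[of l] by (simp add: det_mult[of _ d])
  ultimately have "det (elt l) = det (wt l)" by (simp add: mult_ac)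
  then show ?thesis unfolding wt_def det_dmat by (simp add: power_int_minus comp_def flip: prod_inversef)
qed

text \<open>This gives algebraicity of \<open>action\<close> through its lift to
  \<open>GSp(V) \<times> k^*\<close>: along the lift each generator of the coordinate ring becomes a
  Laurent polynomial.\<close>

lemma regular_Gm_pullback:
  assumes "p \<in> coord_ring d"
  shows "regular_Gm (\<lambda>l. p (elt l, l ^ (2 * b)))"
  using assms
proof induction
  case (entry i j)
  then show ?case using regular_Gm_elt[of i j] by simp
next
  case det_inv
  have "regular_Gm (\<lambda>l. \<Prod>r<d. l powi (- (m * int (r mod (2 * b)))))"
    by (intro regular_Gm_prod regular_Gm_powi)
  then show ?case unfolding regular_Gm_def by (simp add: Gm_def inverse_det_elt)
next
  case t
  show ?case using regular_Gm_powi[of "int (2 * b)"] by (simp del: of_nat_mult)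
next
  case t_inv
  have "inverse (l ^ (2 * b)) = l powi (- int (2 * b))" for l :: 'k
    by (simp add: power_int_minus del: of_nat_mult)
  then show ?case using regular_Gm_powi[of "- int (2 * b)"] by (simp del: of_nat_mult)
qed (auto intro: regular_Gm_const regular_Gm_add regular_Gm_mult)

lemma Q_action_action: "Q_action n J action"
  unfolding Q_action_def
proof (intro conjI allI impI)
  interpret normal "scalar_mats n" "GSp n J" by (rule normal_scalar_mats[OF J])
  show "action \<in> hom Gm (Q_Sp n J)"
  proof (rule homI)
    fix l assume "l \<in> carrier (Gm :: 'k monoid)"
    then have l: "l \<noteq> 0" by (simp add: Gm_def)
    then show "action l \<in> carrier (Q_Sp n J)"
      using elt_GSp[OF l]
      by (auto simp: action_def Q_Sp_def PGSp_def FactGroup_def Gm_def RCOSETS_def)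
  next
    fix l l' assume "l \<in> carrier (Gm :: 'k monoid)" "l' \<in> carrier (Gm :: 'k monoid)"
    then have l: "l \<noteq> 0" "l' \<noteq> 0" by (auto simp: Gm_def)
    show "action (l \<otimes>\<^bsub>Gm\<^esub> l') = action l \<otimes>\<^bsub>Q_Sp n J\<^esub> action l'"
      using rcos_sum[OF elt_GSp[OF l(1)] elt_GSp[OF l(2)]]
      by (simp add: action_def Q_Sp_def PGSp_def FactGroup_def Gm_def elt_mult power_mult_distrib DirProd_def)
  qed
  fix \<psi> assume "regular_Q n J \<psi>"
  then obtain p where p: "p \<in> coord_ring d"
      "\<And>x t. x \<in> carrier (GSp n J) \<Longrightarrow> t \<noteq> 0 \<Longrightarrow> \<psi> (scalar_mats n #>\<^bsub>GSp n J\<^esub> x, t) = p (x, t)"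
    unfolding regular_Q_def by (auto simp: Gm_def)
  have "regular_Gm (\<lambda>l. p (elt l, l ^ (2 * b)))" by (rule regular_Gm_pullback[OF p(1)])
  moreover have "\<psi> (action l) = p (elt l, l ^ (2 * b))" if "l \<noteq> 0" for l
    unfolding action_def using that by (intro p(2) elt_GSp) auto
  ultimately show "regular_Gm (\<lambda>l. \<psi> (action l))"
    unfolding regular_Gm_def by (simp add: Gm_def)
qed

text \<open>Since \<open>m > 0\<close> the entries \<open>\<delta> j\<close> lie in
  \<open>\<pi> A\<close>; modulo \<open>\<pi>\<close> only the truncated shift remains, which is
  nilpotent.\<close>

lemma rep_integral:
  assumes m: "m > 0" and rep: "rep \<in> sp_F n J"
  shows "\<exists>M\<in>sp_A n J. map_mat fps_to_fls M = rep \<and>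
    (\<exists>k. map_mat (\<lambda>x. fps_nth x 0) M ^\<^sub>m k = 0\<^sub>m d d)"
proof -
  let ?\<epsilon> = "\<lambda>j. fps_const (\<alpha> j) * fps_X ^ nat m"
  let ?T = "block_shift n b ?\<epsilon>"
  let ?c = "map_mat fps_const :: 'k mat \<Rightarrow> 'k fps mat"
  define M where "M = ?c g * ?T * ?c h"
  note c = g h block_shift_carrier[of n b ?\<epsilon>]
  have Mc: "M \<in> carrier_mat d d"
    unfolding M_def using c by (intro mult_carrier_mat[of _ _ d]) auto
  have cg: "map_mat fps_to_fls (?c x) = cm x" for x by (intro eq_matI) auto
  have "fps_to_fls (?\<epsilon> j) = \<delta> j" for j
    using m by (simp add: \<delta>_def fls_times_fps_to_fls fps_to_fls_power fls_X_power_conv_shift_1)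
  then have T: "map_mat fps_to_fls ?T = block_shift n b \<delta>"
    by (simp add: map_mat_block_shift)
  have gT: "?c g * ?T \<in> carrier_mat d d" using c by simp
  have MN: "map_mat fps_to_fls M = rep"
    unfolding M_def rep_def using c gT block_shift_carrier[of n b \<delta>]
    by (simp add: fps_to_fls.mat_hom_mult[of _ d d _ d] cg T assoc)
  have "map_mat fps_to_fls (transpose_mat M * ?c J + ?c J * M) = transpose_mat rep * cm J + cm J * rep"
  proof -
    have "map_mat fps_to_fls (transpose_mat M * ?c J) = transpose_mat rep * cm J"
      using Mc J by (simp add: fps_to_fls.mat_hom_mult[of _ d d _ d] cg MN flip: map_mat_transpose)
    moreover have "map_mat fps_to_fls (?c J * M) = cm J * rep"
      using Mc J by (simp add: fps_to_fls.mat_hom_mult[of _ d d _ d] cg MN)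
    ultimately show ?thesis
      using Mc J by (subst map_mat_add[of _ d d]) (auto simp: mult_carrier_mat[of _ d d _ d])
  qed
  also have "\<dots> = map_mat fps_to_fls (0\<^sub>m d d)" using rep by (auto simp: sp_def intro!: eq_matI)
  finally have M_sp: "M \<in> sp_A n J" using Mc fps_to_fls.mat_hom_inj by (auto simp: sp_def)
  interpret nth0: comm_ring_hom "\<lambda>x :: 'k fps. fps_nth x 0" by standard auto
  let ?r = "map_mat (\<lambda>x :: 'k fps. fps_nth x 0)"
  have rc: "?r (?c x) = x" for x by (intro eq_matI) auto
  let ?Z = "block_shift n b (\<lambda>_. 0) :: 'k mat"
  have T0: "?Z \<in> carrier_mat d d" by (rule block_shift_carrier)
  have "?r ?T = ?Z" using m by (simp add: map_mat_block_shift fps_mult_nth)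
  then have rM: "?r M = g * ?Z * h"
    unfolding M_def using c gT T0 by (simp add: nth0.mat_hom_mult[of _ d d _ d] rc assoc)
  have "similar_mat_wit (g * ?Z * h) ?Z g h"
    using g h gh hg T0 by (auto simp: similar_mat_wit_def Let_def)
  then have "similar_mat_wit ((g * ?Z * h) ^\<^sub>m d) (?Z ^\<^sub>m d) g h" by (rule similar_mat_wit_pow)
  then have "(g * ?Z * h) ^\<^sub>m d = g * (?Z ^\<^sub>m d) * h" by (auto simp: similar_mat_wit_def Let_def)
  also have "?Z ^\<^sub>m d = 0\<^sub>m d d"
    by (intro eq_matI) (use T0 in \<open>auto simp: block_shift_0_power\<close>)
  also have "g * 0\<^sub>m d d * h = 0\<^sub>m d d" using g h by simp
  finally have "?r M ^\<^sub>m d = 0\<^sub>m d d" unfolding rM .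
  then show ?thesis using MN M_sp by blast
qed

end

subsection \<open>Characteristic polynomials and characters\<close>

lemma coeff_pcompose_square:
  fixes p :: "'a::comm_semiring_1 poly"
  shows "poly.coeff (p \<circ>\<^sub>p Polynomial.monom 1 2) k = (if even k then poly.coeff p (k div 2) else 0)"
proof (induction p arbitrary: k)
  case (pCons a p)
  show ?case
  proof (cases "k < 2")
    case True
    then show ?thesis
      by (cases k) (auto simp: pcompose_pCons coeff_pCons coeff_monom_mult split: nat.splits)
  next
    case False
    then obtain j where "k = j + 2" by (metis add.commute le_add_diff_inverse not_less)
    then show ?thesis using pCons.IH[of j]
      by (simp add: pcompose_pCons coeff_pCons coeff_monom_mult)
  qed
qed simp

lemma two_alg_closure:
  assumes "(2 :: 'k::field) \<noteq> 0"
  shows "(2 :: 'k fls alg_closure) \<noteq> 0"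
proof -
  have "to_ac (fls_const (2 :: 'k)) \<noteq> 0" using assms by (simp only: to_ac_eq_0_iff fls_const_eq_0_iff not_False_eq_True)
  then show ?thesis by simp
qed

text \<open>In characteristic not 2 the numbers \<open>a i\<close> and \<open>- a i\<close> are
  \<open>2n\<close> distinct ones, so two monic polynomials of degree \<open>2n\<close> vanishing at
  all of them coincide.\<close>

lemma regular_semisimple_eigenvalues:
  fixes N :: "'k::field fls mat"
  assumes two: "(2 :: 'k) \<noteq> 0" and N: "N \<in> carrier_mat (2 * n) (2 * n)" and rs: "regular_semisimple n N"
  obtains a where "{x. poly (map_poly to_ac (char_poly N)) x = 0} = a ` {..<n} \<union> (\<lambda>i. - a i) ` {..<n}"
    "card (a ` {..<n} \<union> (\<lambda>i. - a i) ` {..<n}) = 2 * n" "\<And>i. i < n \<Longrightarrow> a i \<noteq> 0"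
    "map_poly to_ac (char_poly N) = (\<Prod>i<n. [:- (a i)\<^sup>2, 1:]) \<circ>\<^sub>p Polynomial.monom 1 2"
proof -
  obtain a :: "nat \<Rightarrow> 'k fls alg_closure" where a:
    "{x. eigenvalue (map_mat to_ac N) x} = a ` {..<n} \<union> (\<lambda>i. - a i) ` {..<n}"
    "inj_on (\<lambda>i. (a i)\<^sup>2) {..<n}" "\<And>i. i < n \<Longrightarrow> a i \<noteq> 0"
    using rs unfolding regular_semisimple_def by blast
  let ?E = "a ` {..<n} \<union> (\<lambda>i. - a i) ` {..<n}"
  have N': "map_mat to_ac N \<in> carrier_mat (2 * n) (2 * n)" using N by simp
  let ?p = "map_poly to_ac (char_poly N)"
  let ?q = "(\<Prod>i<n. [:- (a i)\<^sup>2, 1:]) \<circ>\<^sub>p Polynomial.monom 1 2"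
  have p: "?p = char_poly (map_mat to_ac N)" by (rule to_ac.char_poly_hom[OF N, symmetric])
  have E: "{x. poly ?p x = 0} = ?E"
    unfolding p using a(1) eigenvalue_root_char_poly[OF N'] by auto
  have inj: "inj_on a {..<n}" "inj_on (\<lambda>i. - a i) {..<n}"
    using a(2) by (auto simp: inj_on_def)
  have "a ` {..<n} \<inter> (\<lambda>i. - a i) ` {..<n} = {}"
  proof (rule ccontr)
    assume "\<not> ?thesis"
    then obtain i j where ij: "i < n" "j < n" "a i = - a j" by auto
    then have "(a i)\<^sup>2 = (a j)\<^sup>2" by simp
    then have "i = j" using a(2) ij by (auto simp: inj_on_def)
    then have "2 * a i = 0" using ij by simp
    then show False using a(3)[OF ij(1)] two_alg_closure[OF two] by simp
  qed
  then have card: "card ?E = 2 * n"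
    using inj by (simp add: card_Un_disjoint card_image)
  have mon: "Polynomial.degree ?p = 2 * n" "poly.coeff ?p (2 * n) = 1"
    unfolding p using degree_monic_char_poly[OF N'] by auto
  have q: "?q = (\<Prod>i<n. Polynomial.monom 1 2 + [:- (a i)\<^sup>2:])"
    by (simp add: pcompose_prod pcompose_pCons add.commute)
  have deg: "Polynomial.degree (\<Prod>i<n. [:- (a i)\<^sup>2, 1:]) = n"
    by (subst degree_prod_eq_sum_degree) auto
  have lc: "poly.coeff (\<Prod>i<n. [:- (a i)\<^sup>2, 1:]) n = 1"
    using lead_coeff_prod[of "\<lambda>i. [:- (a i)\<^sup>2, 1:]" "{..<n}"] unfolding deg by simp
  have "?p = ?q"
  proof (rule poly_eqI_degree_lead_coeff[where n = "2 * n" and A = ?E])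
    show "poly.coeff ?p (2 * n) = poly.coeff ?q (2 * n)"
      unfolding mon(2) coeff_pcompose_square using lc by simp
    show "Polynomial.degree ?q \<le> 2 * n"
      using deg by (simp add: degree_pcompose Polynomial.degree_monom_eq)
    fix z assume z: "z \<in> ?E"
    then have "poly ?p z = 0" using E by blast
    moreover have "poly ?q z = 0"
      using z by (auto simp: poly_pcompose poly_prod poly_monom)
    ultimately show "poly ?p z = poly ?q z" by simp
  qed (use card mon in auto)
  then show thesis using that E card a(3) by blast
qed

text \<open>Evenness of the characteristic polynomial is seen over the closure and descends because
  \<open>to_ac\<close> is injective. The constant term is nonzero because \<open>0\<close> is not an
  eigenvalue.\<close>

lemma regular_semisimple_h_poly:
  fixes N :: "'k::field fls mat"
  assumes two: "(2 :: 'k) \<noteq> 0" and N: "N \<in> carrier_mat (2 * n) (2 * n)" and rs: "regular_semisimple n N"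
  shows "h_poly N \<circ>\<^sub>p Polynomial.monom 1 2 = char_poly N"
    and "Polynomial.degree (h_poly N) = n" and "poly.coeff (h_poly N) n = 1" and "poly.coeff (h_poly N) 0 \<noteq> 0"
proof -
  obtain a where a: "{x. poly (map_poly to_ac (char_poly N)) x = 0} = a ` {..<n} \<union> (\<lambda>i. - a i) ` {..<n}"
    "\<And>i. i < n \<Longrightarrow> a i \<noteq> 0"
    "map_poly to_ac (char_poly N) = (\<Prod>i<n. [:- (a i)\<^sup>2, 1:]) \<circ>\<^sub>p Polynomial.monom 1 2"
    using regular_semisimple_eigenvalues[OF assms] by metis
  let ?\<chi> = "char_poly N"
  have mon: "Polynomial.degree ?\<chi> = 2 * n" "poly.coeff ?\<chi> (2 * n) = 1"
    using degree_monic_char_poly[OF N] by auto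
  have odd: "poly.coeff ?\<chi> k = 0" if "odd k" for k
  proof -
    have "to_ac (poly.coeff ?\<chi> k) = poly.coeff (map_poly to_ac ?\<chi>) k" by (simp add: coeff_map_poly)
    also have "\<dots> = 0" unfolding a(3) using that by (simp add: coeff_pcompose_square)
    finally show ?thesis by simp
  qed
  define h where "h = (\<Sum>i\<le>n. Polynomial.monom (poly.coeff ?\<chi> (2 * i)) i)"
  have h_coeff: "poly.coeff h i = poly.coeff ?\<chi> (2 * i)" for i
  proof (cases "i \<le> n")
    case False
    then have "poly.coeff ?\<chi> (2 * i) = 0" using mon(1) by (intro coeff_eq_0) simp
    then show ?thesis by (simp add: h_def coeff_sum)
  qed (simp add: h_def coeff_sum)
  have h: "h \<circ>\<^sub>p Polynomial.monom 1 2 = ?\<chi>"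
    by (rule poly_eqI) (auto simp: coeff_pcompose_square h_coeff odd elim!: oddE)
  then have hN: "h_poly N = h" by (rule h_poly_eqI)
  show "h_poly N \<circ>\<^sub>p Polynomial.monom 1 2 = ?\<chi>" unfolding hN by (rule h)
  have "Polynomial.degree (h \<circ>\<^sub>p Polynomial.monom 1 2) = 2 * n" unfolding h by (rule mon(1))
  then show "Polynomial.degree (h_poly N) = n" unfolding hN by (simp add: degree_pcompose Polynomial.degree_monom_eq)
  show "poly.coeff (h_poly N) n = 1" unfolding hN h_coeff by (rule mon(2))
  have "0 \<notin> a ` {..<n} \<union> (\<lambda>i. - a i) ` {..<n}" using a(2) by auto
  then have "poly (map_poly to_ac ?\<chi>) 0 \<noteq> 0" using a(1) by blast
  then have "poly.coeff (map_poly to_ac ?\<chi>) 0 \<noteq> 0" by (simp add: poly_0_coeff_0)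
  then show "poly.coeff (h_poly N) 0 \<noteq> 0" unfolding hN h_coeff by (simp add: coeff_map_poly)
qed

lemma coeff_homogeneous:
  "poly.coeff (\<Sum>i\<le>n. Polynomial.monom (f i) (n - i)) k = (if k \<le> n then f (n - k) else 0)"
  for f :: "nat \<Rightarrow> 'a::comm_monoid_add"
proof -
  have "poly.coeff (\<Sum>i\<le>n. Polynomial.monom (f i) (n - i)) k = (\<Sum>i\<le>n. if i = n - k \<and> k \<le> n then f (n - k) else 0)"
    unfolding coeff_sum by (intro sum.cong) auto
  then show ?thesis by (cases "k \<le> n") auto
qed

text \<open>From \<open>det (X - c A) = c^d det (X / c - A)\<close>.\<close>

lemma char_poly_smult:
  fixes A :: "'a::field mat"
  assumes A: "A \<in> carrier_mat d d" and c: "c \<noteq> 0"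
  shows "poly.coeff (char_poly (c \<cdot>\<^sub>m A)) i = c ^ d * inverse c ^ i * poly.coeff (char_poly A) i"
proof -
  have "char_poly_matrix (c \<cdot>\<^sub>m A) = [:c:] \<cdot>\<^sub>m map_mat (\<lambda>p. p \<circ>\<^sub>p [:0, inverse c:]) (char_poly_matrix A)"
    using A c by (intro eq_matI) (auto simp: char_poly_matrix_def pcompose_pCons pcompose_add)
  then have "char_poly (c \<cdot>\<^sub>m A) = [:c:] ^ d * (char_poly A \<circ>\<^sub>p [:0, inverse c:])"
    using carrier_matD(2)[OF char_poly_matrix_closed[OF A]]
    by (simp add: char_poly_def comm_ring_hom.hom_det[OF pcompose_hom.comm_ring_hom_axioms])
  also have "[:c:] ^ d = [:c ^ d:]" by (induction d) (simp_all add: one_pCons)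
  finally show ?thesis by (simp add: coeff_pcompose_linear mult.assoc)
qed

section \<open>Algebraic characters of \<open>k^*\<close>\<close>

lemma infinite_UNIV_alg_closed: "infinite (UNIV :: 'a::alg_closed_field set)"
proof
  assume fin: "finite (UNIV :: 'a set)"
  let ?q = "\<Prod>x\<in>(UNIV :: 'a set). [:- x, 1:]"
  have "Polynomial.degree ?q = card (UNIV :: 'a set)"
    by (subst degree_prod_eq_sum_degree) auto
  moreover have "card (UNIV :: 'a set) > 0" using fin by (simp add: card_gt_0_iff)
  ultimately have "Polynomial.degree (?q + 1) > 0" by (subst degree_add_eq_left) auto
  then obtain x where "poly (?q + 1) x = 0" using alg_closed_imp_poly_has_root by blast
  moreover have "poly ?q x = 0" using fin by (auto simp: poly_prod)
  ultimately show False by simp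
qed

text \<open>Clearing the denominator leaves a polynomial with \<open>p(xy) = p(x) p(y)\<close>. For
  fixed \<open>y\<close> this is an identity of polynomials in \<open>x\<close>, the field being
  infinite, and comparing one nonzero coefficient, of degree \<open>i\<close>, gives
  \<open>p(y) = y^i\<close>.\<close>

lemma regular_character_is_power:
  fixes \<phi> :: "'a::alg_closed_field \<Rightarrow> 'a"
  assumes two: "(2 :: 'a) \<noteq> 0" and reg: "regular_Gm \<phi>"
    and mult: "\<And>x y. x \<noteq> 0 \<Longrightarrow> y \<noteq> 0 \<Longrightarrow> \<phi> (x * y) = \<phi> x * \<phi> y" and nz: "\<And>x. x \<noteq> 0 \<Longrightarrow> \<phi> x \<noteq> 0"
  shows "\<exists>r. \<forall>x. x \<noteq> 0 \<longrightarrow> \<phi> x = x powi r"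
proof -
  obtain p m where p: "\<And>x. x \<noteq> 0 \<Longrightarrow> \<phi> x = poly p x / x ^ m"
    using reg unfolding regular_Gm_def Gm_def by auto
  have pm: "poly p (x * y) = poly p x * poly p y" if "x \<noteq> 0" "y \<noteq> 0" for x y
    using mult[OF that] that by (simp add: p power_mult_distrib field_simps)
  have "poly p 1 \<noteq> 0" using nz[of 1] p[of 1] by simp
  then have "p \<noteq> 0" by auto
  then obtain i where i: "poly.coeff p i \<noteq> 0" using leading_coeff_neq_0 by blast
  have py: "poly p y = y ^ i" if y: "y \<noteq> 0" for y
  proof -
    let ?q = "p \<circ>\<^sub>p [:0, y:] - Polynomial.smult (poly p y) p"
    have "UNIV - {0} \<subseteq> {x. poly ?q x = 0}"
      using pm[OF _ y] by (auto simp: poly_pcompose mult.commute)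
    moreover have "infinite (UNIV - {0 :: 'a})" using infinite_UNIV_alg_closed by (simp add: infinite_remove)
    ultimately have "?q = 0" using poly_roots_finite finite_subset by blast
    then have "poly.coeff (p \<circ>\<^sub>p [:0, y:]) i = poly.coeff (Polynomial.smult (poly p y) p) i" by simp
    then show ?thesis using i by (simp add: coeff_pcompose_linear)
  qed
  have "\<phi> x = x powi (int i - int m)" if "x \<noteq> 0" for x
    using that by (simp add: p py power_int_diff)
  then show ?thesis by blast
qed

text \<open>Otherwise a solution of \<open>x^c = -1\<close> with \<open>c = |i - j|\<close> would
  also satisfy \<open>x^c = 1\<close>.\<close>

lemma powi_eq_imp_eq:
  assumes two: "(2 :: 'a::alg_closed_field) \<noteq> 0" and eq: "\<And>x :: 'a. x \<noteq> 0 \<Longrightarrow> x powi i = x powi j"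
  shows "i = j"
proof (rule ccontr)
  assume "i \<noteq> j"
  define c where "c = nat \<bar>i - j\<bar>"
  have "c > 0" using \<open>i \<noteq> j\<close> by (simp add: c_def)
  then obtain x :: 'a where x: "x ^ c = - 1" using nth_root_exists[of c "- 1 :: 'a"] by auto
  then have "x \<noteq> 0" using \<open>c > 0\<close> by (auto simp: zero_power)
  then have "x powi (i - j) = 1" "x powi (j - i) = 1" using eq[of x] by (simp_all add: power_int_diff)
  then have "x ^ c = 1" by (cases "i \<ge> j") (auto simp: c_def power_int_def split: if_splits)
  then have "(2 :: 'a) = 0" using x by (metis add_eq_0_iff one_add_one)
  with two show False by simp
qed

subsection \<open>Homogeneity of \<open>h\<close>\<close>

lemma almost_commuting_imp_homogeneous:
  fixes N :: "'k::alg_closed_field fls mat" and J :: "'k mat"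
  assumes two: "(2 :: 'k) \<noteq> 0" and "n \<ge> 1" and J: "J \<in> carrier_mat (2 * n) (2 * n)"
    and N: "N \<in> carrier_mat (2 * n) (2 * n)"
    and h: "h \<circ>\<^sub>p Polynomial.monom 1 2 = char_poly N" "Polynomial.degree h = n" "poly.coeff h 0 \<noteq> 0"
    and f: "Q_action n J f" "almost_commutes n f N"
  shows "\<exists>q::rat. q \<noteq> 0 \<and> of_nat n * q \<in> \<int> \<and> homogeneous_in_pi_pow n q h"
proof -
  let ?d = "2 * n"
  have f_hom: "f \<in> hom Gm (Q_Sp n J)"
    and f_reg: "\<And>\<psi>. regular_Q n J \<psi> \<Longrightarrow> regular_Gm (\<lambda>l. \<psi> (f l))"
    using f(1) by (auto simp: Q_action_def)
  obtain s where s: "s \<noteq> 0" "\<And>l. l \<noteq> 0 \<Longrightarrow> Q_act n (f l) N = fls_const (l powi s) \<cdot>\<^sub>m N"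
    using f(2) by (auto simp: almost_commutes_def Gm_def)
  have f_closed: "f l \<in> carrier (Q_Sp n J)" if "l \<noteq> 0" for l
    using that f_hom by (intro hom_in_carrier[of f Gm]) (auto simp: Gm_def)
  have f_mult: "f (l * l') = f l \<otimes>\<^bsub>Q_Sp n J\<^esub> f l'" if "l \<noteq> 0" "l' \<noteq> 0" for l l'
    using hom_mult[OF f_hom, of l l'] that by (simp add: Gm_def)
  \<comment> \<open>The second component is a regular function on \<open>Q'\<close>, so it is an
    algebraic character and hence a power \<open>l^r\<close>.\<close>
  have "regular_Gm (\<lambda>l. snd (f l))"
  proof (rule f_reg)
    show "regular_Q n J snd"
      unfolding regular_Q_def by (intro bexI[OF _ coord_ring.t]) simp
  qed
  then have "\<exists>r. \<forall>l. l \<noteq> 0 \<longrightarrow> snd (f l) = l powi r"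
  proof (rule regular_character_is_power[OF two])
    show "snd (f (x * y)) = snd (f x) * snd (f y)" if "x \<noteq> 0" "y \<noteq> 0" for x y
      using f_mult[OF that] by (cases "f x"; cases "f y") (simp add: Q_Sp_def DirProd_def Gm_def)
    show "snd (f x) \<noteq> 0" if "x \<noteq> 0" for x
      using f_closed[OF that] by (auto simp: Q_Sp_def Gm_def)
  qed
  then obtain r where r: "\<And>l. l \<noteq> 0 \<Longrightarrow> snd (f l) = l powi r" by blast
  \<comment> \<open>The matrix \<open>l^s N\<close> is similar to the rotation of \<open>N\<close>
    by \<open>l^r\<close>. In the coefficient of \<open>\<mu>^(2i)\<close>, at
    \<open>\<pi>^e\<close>, the former contributes \<open>l^(2s(n - i))\<close> and the latter
    \<open>l^(re)\<close>.\<close>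
  have exps: "r * e = 2 * s * (int n - int i)" if nz: "fls_nth (poly.coeff h i) e \<noteq> 0" for i e
  proof (rule powi_eq_imp_eq[OF two])
    fix l :: 'k assume l: "l \<noteq> 0"
    let ?t = "l powi r" and ?c = "fls_const (l powi s)"
    have t: "?t \<noteq> 0" using l by simp
    interpret rot: comm_ring_hom "fls_rotate ?t" by (rule fls_rotate_hom[OF t])
    have "i \<le> n" using nz h(2) by (metis coeff_eq_0 fls_zero_nth not_less)
    obtain x where x: "x \<in> carrier (GSp n J)" "f l = (scalar_mats n #>\<^bsub>GSp n J\<^esub> x, ?t)"
      using f_closed[OF l] r[OF l] by (cases "f l") (auto simp: Q_Sp_def PGSp_def FactGroup_def RCOSETS_def)
    have "x \<in> carrier (GL ?d)" using x(1) by (auto simp: GSp_def)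
    then have "map_mat fls_const x \<in> carrier (GL ?d)" by (rule map_fls_const_GL)
    then obtain y where y: "map_mat fls_const x \<in> carrier_mat ?d ?d" "y \<in> carrier_mat ?d ?d"
        "y * map_mat fls_const x = 1\<^sub>m ?d" "map_mat fls_const x * y = 1\<^sub>m ?d"
      unfolding carrier_GL by blast
    let ?R = "map_mat (fls_rotate ?t) N"
    have "?c \<cdot>\<^sub>m N = map_mat fls_const x * ?R * y"
      using s(2)[OF l] Q_act_eq[OF J N x(1)] GL_inv_eqI[OF y] by (simp add: x(2) Ad_def)
    then have "similar_mat_wit (?c \<cdot>\<^sub>m N) ?R (map_mat fls_const x) y"
      using y N by (auto simp: similar_mat_wit_def Let_def)
    then have "char_poly (?c \<cdot>\<^sub>m N) = char_poly ?R"
      by (intro char_poly_similar) (auto simp: similar_mat_def)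
    also have "\<dots> = map_poly (fls_rotate ?t) (char_poly N)" by (rule rot.char_poly_hom[OF N])
    finally have "poly.coeff (char_poly (?c \<cdot>\<^sub>m N)) (2 * i) = fls_rotate ?t (poly.coeff (char_poly N) (2 * i))"
      by (simp add: coeff_map_poly)
    moreover have "?c \<noteq> 0" using l by simp
    ultimately have eq: "?c ^ ?d * inverse ?c ^ (2 * i) * poly.coeff h i = fls_rotate ?t (poly.coeff h i)"
      using char_poly_smult[OF N, of ?c "2 * i"] by (simp flip: h(1) add: coeff_pcompose_square)
    have "?c ^ ?d * inverse ?c ^ (2 * i) = ?c powi int ?d / ?c powi int (2 * i)"
      by (simp only: power_int_of_nat divide_inverse power_inverse)
    also have "\<dots> = ?c powi (int ?d - int (2 * i))"
      using \<open>?c \<noteq> 0\<close> by (intro power_int_diff[symmetric]) simp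
    also have "\<dots> = fls_const (l powi (2 * s * (int n - int i)))"
      by (simp add: power_int_mult[symmetric] algebra_simps flip: fls_const_power_int)
    finally have "fls_nth (fls_const (l powi (2 * s * (int n - int i))) * poly.coeff h i) e =
        fls_nth (fls_rotate ?t (poly.coeff h i)) e" using eq by simp
    then have "l powi (2 * s * (int n - int i)) = ?t powi e" using nz by simp
    then show "l powi (r * e) = l powi (2 * s * (int n - int i))" by (simp add: power_int_mult)
  qed
  \<comment> \<open>Since \<open>h(0) \<noteq> 0\<close>, some exponent occurs for
    \<open>i = 0\<close>; as \<open>s\<close> and \<open>n\<close> are nonzero this forces
    \<open>r \<noteq> 0\<close>, so that \<open>q = 2s/r\<close> makes sense.\<close>
  obtain e0 where e0: "fls_nth (poly.coeff h 0) e0 \<noteq> 0" using h(3) by (auto simp: fls_eq_iff)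
  have re0: "r * e0 = 2 * s * int n" using exps[OF e0] by simp
  then have r0: "r \<noteq> 0" using s(1) \<open>n \<ge> 1\<close> by auto
  define q :: rat where "q = of_int (2 * s) / of_int r"
  have q0: "q \<noteq> 0" using s(1) r0 by (simp add: q_def)
  have q_eq: "of_int e = q * of_nat j \<longleftrightarrow> r * e = 2 * s * int j" for e :: int and j
  proof -
    have "of_int e = q * of_nat j \<longleftrightarrow> (of_int (r * e) :: rat) = of_int (2 * s * int j)"
      using r0 by (simp add: q_def field_simps)
    then show ?thesis by (simp only: of_int_eq_iff)
  qed
  \<comment> \<open>By \<open>exps\<close> the coefficient of index \<open>n - j\<close> involves no
    power of \<open>\<pi>\<close> other than \<open>q * j\<close>. If that is not an integer the
    coefficient is zero, hence the default 0.\<close>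
  define c where "c j = (if q * of_nat j \<in> \<int> then fls_nth (poly.coeff h (n - j)) \<lfloor>q * of_nat j\<rfloor> else 0)" for j
  have "homogeneous_in_pi_pow n q h"
    unfolding homogeneous_in_pi_pow_def
  proof (intro exI[of _ c] conjI allI impI)
    fix j assume "c j \<noteq> 0"
    then show "q * of_nat j \<in> \<int>" by (auto simp: c_def split: if_splits)
  next
    show "h = (\<Sum>i\<le>n. Polynomial.monom (fls_const (c i) * fls_X_intpow \<lfloor>q * of_nat i\<rfloor>) (n - i))"
    proof (rule poly_eqI)
      fix k
      show "poly.coeff h k = poly.coeff (\<Sum>i\<le>n. Polynomial.monom (fls_const (c i) * fls_X_intpow \<lfloor>q * of_nat i\<rfloor>) (n - i)) k"
      proof (cases "k \<le> n")
        case False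
        then show ?thesis using h(2) by (simp add: coeff_homogeneous coeff_eq_0)
      next
        case True
        let ?j = "n - k"
        have "poly.coeff h k = fls_const (c ?j) * fls_X_intpow \<lfloor>q * of_nat ?j\<rfloor>"
        proof (rule fls_eqI)
          fix e
          have "fls_nth (fls_const (c ?j) * fls_X_intpow \<lfloor>q * of_nat ?j\<rfloor>) e = (if e = \<lfloor>q * of_nat ?j\<rfloor> then c ?j else 0)"
            by simp
          also have "\<dots> = fls_nth (poly.coeff h k) e"
          proof (cases "fls_nth (poly.coeff h k) e = 0")
            case z: True
            then show ?thesis using True by (auto simp: c_def)
          next
            case nz: False
            have "of_int e = q * of_nat ?j" unfolding q_eq using exps[OF nz] True by simp
            then have "q * of_nat ?j \<in> \<int>" "\<lfloor>q * of_nat ?j\<rfloor> = e" by (metis Ints_of_int, metis floor_of_int)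
            then show ?thesis using True by (simp add: c_def)
          qed
          finally show "fls_nth (poly.coeff h k) e = fls_nth (fls_const (c ?j) * fls_X_intpow \<lfloor>q * of_nat ?j\<rfloor>) e" ..
        qed
        then show ?thesis using True by (simp add: coeff_homogeneous)
      qed
    qed
  qed
  moreover have "of_nat n * q \<in> \<int>"
    using q_eq[of e0 n] re0 by (metis Ints_of_int mult.commute)
  ultimately show ?thesis using q0 by blast
qed

text \<open>Lowest terms leave only the indices \<open>i\<close> divisible by \<open>b\<close>, so
  with \<open>y = \<pi>^m\<close> the characteristic polynomial is \<open>y^D G(X^(2b) / y)\<close>
  for a monic \<open>G\<close> over \<open>k\<close>, which splits. Its roots are distinct by
  counting eigenvalues, and nonzero because \<open>h(0)\<close> is.\<close>

lemma homogeneous_factorization: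
  fixes N :: "'k::alg_closed_field fls mat"
  assumes two: "(2 :: 'k) \<noteq> 0" and "n \<ge> 1" and N: "N \<in> carrier_mat (2 * n) (2 * n)"
    and rs: "regular_semisimple n N"
    and q: "of_nat n * q \<in> \<int>" "homogeneous_in_pi_pow n q (h_poly N)"
    and mb: "quotient_of q = (m, int b)"
  obtains D \<alpha> where "n = b * D" "inj_on \<alpha> {..<D}" "\<And>j. j < D \<Longrightarrow> \<alpha> j \<noteq> 0"
    "char_poly N = (\<Prod>j<D. Polynomial.monom 1 (2 * b) - [:fls_const (\<alpha> j) * fls_X_intpow m:])"
proof -
  note h = regular_semisimple_h_poly[OF two N rs]
  have b: "b > 0" using quotient_of_denom_pos[OF mb] by simp
  have cop: "coprime m (int b)" by (rule quotient_of_coprime[OF mb])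
  have q_eq: "q = of_int m / of_nat b" using quotient_of_div[OF mb] by simp
  have q_int: "q * of_nat i \<in> \<int> \<longleftrightarrow> b dvd i" for i
  proof
    assume "q * of_nat i \<in> \<int>"
    then obtain z where "q * of_nat i = of_int z" by (elim Ints_cases)
    then have "(of_int (m * int i) :: rat) = of_int (z * int b)" using b by (simp add: q_eq field_simps)
    then have "m * int i = z * int b" by (simp only: of_int_eq_iff)
    then have "int b dvd m * int i" by simp
    then show "b dvd i" using cop by (metis coprime_commute coprime_dvd_mult_right_iff int_dvd_int_iff)
  next
    assume "b dvd i"
    then obtain l where "i = b * l" by blast
    then have "q * of_nat i = of_int (m * int l)" using b by (simp add: q_eq)
    then show "q * of_nat i \<in> \<int>" by (metis Ints_of_int)
  qed
  have q_floor: "\<lfloor>q * of_nat (b * l)\<rfloor> = m * int l" for l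
  proof -
    have "q * of_nat (b * l) = of_int (m * int l)" using b by (simp add: q_eq)
    then show ?thesis by (metis floor_of_int)
  qed
  have "b dvd n" using q(1) q_int[of n] by (simp add: mult.commute)
  then obtain D where n: "n = b * D" by blast
  obtain c where c: "\<And>i. i \<le> n \<Longrightarrow> c i \<noteq> 0 \<Longrightarrow> q * of_nat i \<in> \<int>"
      "h_poly N = (\<Sum>i\<le>n. Polynomial.monom (fls_const (c i) * fls_X_intpow \<lfloor>q * of_nat i\<rfloor>) (n - i))"
    using q(2) unfolding homogeneous_in_pi_pow_def by blast
  have c0: "c 0 = 1"
  proof -
    have "fls_const (c 0) = 1" using h(3) unfolding c(2) by (simp add: coeff_homogeneous)
    then show ?thesis by simp
  qed
  define G where "G = (\<Sum>l\<le>D. Polynomial.monom (c (b * l)) (D - l))"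
  have G_coeff: "poly.coeff G k = (if k \<le> D then c (b * (D - k)) else 0)" for k
    by (simp add: G_def coeff_homogeneous)
  have G_deg: "Polynomial.degree G = D"
    by (intro antisym degree_le le_degree) (auto simp: G_coeff c0)
  have lcG: "Polynomial.lead_coeff G = 1" by (simp add: G_deg G_coeff c0)
  then have "G \<noteq> 0" by auto
  then obtain A where A: "size A = D" "G = (\<Prod>x\<in>#A. [:- x, 1:])"
    using alg_closed_imp_factorization[of G] lcG G_deg by auto
  obtain xs where xs: "mset xs = A" using ex_mset by blast
  define \<alpha> where "\<alpha> j = xs ! j" for j
  have len: "length xs = D" using xs A(1) by auto
  have "G = prod_list (map (\<lambda>x. [:- x, 1:]) xs)"
    unfolding A(2) xs[symmetric] by (simp add: prod_mset_prod_list flip: mset_map)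
  then have G_prod: "G = (\<Prod>j<D. [:- \<alpha> j, 1:])"
    by (simp add: prod.list_conv_set_nth \<alpha>_def len lessThan_atLeast0)
  define y :: "'k fls" where "y = fls_X_intpow m"
  have y: "y \<noteq> 0" by (simp add: y_def)
  have y_pow: "y ^ l = fls_X_intpow (m * int l)" for l by (simp add: y_def fls_X_intpow_power mult.commute)
  let ?M = "Polynomial.monom (inverse y) (2 * b)"
  have char: "char_poly N = (\<Prod>j<D. Polynomial.monom 1 (2 * b) - [:fls_const (\<alpha> j) * y:])"
  proof -
    let ?t = "\<lambda>i. Polynomial.monom (fls_const (c i) * fls_X_intpow \<lfloor>q * of_nat i\<rfloor>) (2 * (n - i))"
    have mono: "Polynomial.monom x i \<circ>\<^sub>p Polynomial.monom z k = Polynomial.monom (x * z ^ i) (i * k)" for x z :: "'k fls" and i k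
      by (induction i) (simp_all add: monom_0 monom_Suc pcompose_pCons mult_monom mult_ac)
    have "char_poly N = (\<Sum>i\<le>n. ?t i)"
      unfolding h(1)[symmetric] c(2) pcompose_sum mono by (simp add: mult.commute)
    also have "\<dots> = (\<Sum>i\<in>(*) b ` {..D}. ?t i)"
    proof (rule sum.mono_neutral_right)
      show "\<forall>i\<in>{..n} - (*) b ` {..D}. ?t i = 0"
      proof
        fix i assume i: "i \<in> {..n} - (*) b ` {..D}"
        have "\<not> b dvd i"
        proof
          assume "b dvd i"
          then obtain l where l: "i = b * l" by blast
          then have "l \<le> D" using i b n by simp
          with i l show False by blast
        qed
        then have "c i = 0" using c(1)[of i] i q_int by auto
        then show "?t i = 0" by simp
      qed
    qed (use n b in auto)
    also have "\<dots> = (\<Sum>l\<le>D. ?t (b * l))"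
      using b by (subst sum.reindex) (auto simp: inj_on_def)
    also have "\<dots> = (\<Sum>l\<le>D. Polynomial.smult (y ^ D) (Polynomial.monom (fls_const (c (b * l))) (D - l) \<circ>\<^sub>p ?M))"
    proof (intro sum.cong refl)
      fix l assume l: "l \<in> {..D}"
      have "y ^ D = y ^ l * y ^ (D - l)" using l by (simp flip: power_add)
      then have "y ^ D * inverse y ^ (D - l) = y ^ l" using y by (simp add: power_inverse)
      then have "y ^ D * (fls_const (c (b * l)) * inverse y ^ (D - l)) = fls_const (c (b * l)) * y ^ l"
        by (metis mult.left_commute)
      moreover have "2 * (n - b * l) = (D - l) * (2 * b)" by (simp add: n algebra_simps)
      ultimately show "?t (b * l) = Polynomial.smult (y ^ D) (Polynomial.monom (fls_const (c (b * l))) (D - l) \<circ>\<^sub>p ?M)"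
        by (simp only: mono smult_monom q_floor y_pow)
    qed
    also have "\<dots> = Polynomial.smult (y ^ D) (map_poly fls_const G \<circ>\<^sub>p ?M)"
    proof -
      have "map_poly fls_const G = (\<Sum>l\<le>D. Polynomial.monom (fls_const (c (b * l))) (D - l))"
        by (rule poly_eqI) (simp add: coeff_map_poly G_coeff coeff_homogeneous)
      then show ?thesis by (simp add: pcompose_sum smult_sum2)
    qed
    also have "map_poly fls_const G = (\<Prod>j<D. [:- fls_const (\<alpha> j), 1:])"
    proof -
      interpret poly_hom: map_poly_comm_ring_hom "fls_const :: 'k \<Rightarrow> 'k fls" ..
      have "map_poly fls_const [:- \<alpha> j, 1:] = [:- fls_const (\<alpha> j), 1:]" for j
        by (simp add: map_poly_pCons)
      then show ?thesis unfolding G_prod poly_hom.hom_prod by simp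
    qed
    also have "Polynomial.smult (y ^ D) ((\<Prod>j<D. [:- fls_const (\<alpha> j), 1:]) \<circ>\<^sub>p ?M) =
        (\<Prod>j<D. Polynomial.smult y ([:- fls_const (\<alpha> j), 1:] \<circ>\<^sub>p ?M))"
      unfolding prod_smult pcompose_prod by simp
    also have "\<dots> = (\<Prod>j<D. Polynomial.monom 1 (2 * b) - [:fls_const (\<alpha> j) * y:])"
      using y by (intro prod.cong refl)
        (simp add: pcompose_pCons smult_monom smult_add_right mult.commute)
    finally show ?thesis .
  qed
  obtain a where a: "{x. poly (map_poly to_ac (char_poly N)) x = 0} = a ` {..<n} \<union> (\<lambda>i. - a i) ` {..<n}"
    "card (a ` {..<n} \<union> (\<lambda>i. - a i) ` {..<n}) = 2 * n"
    using regular_semisimple_eigenvalues[OF two N rs] by metis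
  let ?E = "a ` {..<n} \<union> (\<lambda>i. - a i) ` {..<n}"
  let ?Z = "\<lambda>z. {x. poly (Polynomial.monom 1 (2 * b) - [:to_ac (fls_const z * y):]) x = 0}"
  have degZ: "Polynomial.degree (Polynomial.monom 1 (2 * b) - [:z:]) = 2 * b" for z :: "'k fls alg_closure"
    unfolding diff_conv_add_uminus using b
    by (subst degree_add_eq_left) (auto simp: Polynomial.degree_monom_eq)
  have nzZ: "Polynomial.monom 1 (2 * b) - [:z:] \<noteq> 0" for z :: "'k fls alg_closure"
    using degZ[of z] b by auto
  have sub: "?E \<subseteq> (\<Union>z\<in>\<alpha> ` {..<D}. ?Z z)"
  proof
    fix x assume "x \<in> ?E"
    then have x: "poly (map_poly to_ac (char_poly N)) x = 0" using a(1) by blast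
    interpret poly_hom: map_poly_comm_ring_hom "to_ac :: 'k fls \<Rightarrow> 'k fls alg_closure" ..
    have "map_poly to_ac (Polynomial.monom 1 (2 * b) - [:w:]) = Polynomial.monom 1 (2 * b) - [:to_ac w:]" for w :: "'k fls"
      by (intro poly_eqI) (auto simp: coeff_map_poly coeff_pCons split: nat.split)
    then have "map_poly to_ac (char_poly N) = (\<Prod>j<D. Polynomial.monom 1 (2 * b) - [:to_ac (fls_const (\<alpha> j) * y):])"
      unfolding char poly_hom.hom_prod by simp
    then show "x \<in> (\<Union>z\<in>\<alpha> ` {..<D}. ?Z z)" using x by (auto simp: poly_prod)
  qed
  \<comment> \<open>Each distinct value of \<open>\<alpha>\<close> accounts for at most
    \<open>2b\<close> of the \<open>2n = 2bD\<close> different eigenvalues, so there must be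
    \<open>D\<close> distinct values.\<close>
  have "2 * n \<le> card (\<Union>z\<in>\<alpha> ` {..<D}. ?Z z)"
    unfolding a(2)[symmetric] by (intro card_mono sub finite_UN_I poly_roots_finite nzZ) auto
  also have "\<dots> \<le> (\<Sum>z\<in>\<alpha> ` {..<D}. card (?Z z))" by (intro card_UN_le) auto
  also have "\<dots> \<le> (\<Sum>z\<in>\<alpha> ` {..<D}. 2 * b)"
    using card_poly_roots_bound[OF nzZ] unfolding degZ by (intro sum_mono)
  also have "\<dots> = card (\<alpha> ` {..<D}) * (2 * b)" by simp
  finally have "D \<le> card (\<alpha> ` {..<D})" using b by (simp add: n)
  then have inj: "inj_on \<alpha> {..<D}"
    by (intro eq_card_imp_inj_on) (auto intro: antisym card_image_le[of "{..<D}", simplified])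
  have nz: "\<alpha> j \<noteq> 0" if "j < D" for j
  proof
    assume "\<alpha> j = 0"
    then have "poly (char_poly N) 0 = 0"
      unfolding char using that b by (auto simp: poly_prod poly_monom zero_power)
    moreover have "poly (char_poly N) 0 = poly.coeff (h_poly N) 0"
      unfolding h(1)[symmetric] by (simp add: poly_pcompose poly_monom poly_0_coeff_0)
    ultimately show False using h(4) by simp
  qed
  show thesis by (rule that[OF n inj nz char[unfolded y_def]])
qed

lemma nil_imp_pos:
  fixes N :: "'k::field fls mat" and J :: "'k mat"
  assumes "n \<ge> 1" and N: "N \<in> carrier_mat (2 * n) (2 * n)"
    and h: "h \<circ>\<^sub>p Polynomial.monom 1 2 = char_poly N" "poly.coeff h 0 \<noteq> 0"
    and hom: "homogeneous_in_pi_pow n q h" and q: "of_nat n * q \<in> \<int>" and nil: "nil_elem n J N"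
  shows "q > 0"
proof -
  obtain M k where M: "M \<in> sp_A n J" "map_mat fps_to_fls M \<in> conj_class n J N"
      "map_mat (\<lambda>x. fps_nth x 0) M ^\<^sub>m k = 0\<^sub>m (2 * n) (2 * n)"
    using nil unfolding nil_elem_def by blast
  have Mc: "M \<in> carrier_mat (2 * n) (2 * n)" using M(1) by (simp add: sp_def)
  interpret nth0: comm_ring_hom "\<lambda>x :: 'k fps. fps_nth x 0" by standard auto
  let ?M0 = "map_mat (\<lambda>x :: 'k fps. fps_nth x 0) M"
  let ?u = "poly.coeff (char_poly M) 0"
  have M0: "?M0 \<in> carrier_mat (2 * n) (2 * n)" using Mc by simp
  have "det ?M0 ^ k = det (?M0 ^\<^sub>m k)"
    using M0 by (induction k) (simp_all add: det_mult[of _ "2 * n"])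
  then have "det ?M0 ^ k = 0" unfolding M(3) using \<open>n \<ge> 1\<close> by simp
  then have "det ?M0 = 0" by simp
  then have "det (char_matrix ?M0 0) = 0"
  proof -
    have "char_matrix ?M0 0 = ?M0" unfolding char_matrix_def using M0 by (intro eq_matI) auto
    then show ?thesis using \<open>det ?M0 = 0\<close> by simp
  qed
  then have "poly (char_poly ?M0) 0 = 0"
    using eigenvalue_det[OF M0] eigenvalue_root_char_poly[OF M0] by blast
  then have u0: "fps_nth ?u 0 = 0"
    unfolding nth0.char_poly_hom[OF Mc] poly_0_coeff_0 by (simp add: coeff_map_poly)
  have "poly.coeff h 0 = poly.coeff (char_poly N) 0"
    using coeff_pcompose_square[of h 0] by (simp add: h(1))
  also have "\<dots> = fps_to_fls ?u"
    unfolding conj_class_char_poly[OF N M(2), symmetric] fps_to_fls.char_poly_hom[OF Mc] by (simp add: coeff_map_poly)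
  finally have hu: "poly.coeff h 0 = fps_to_fls ?u" .
  obtain c where c: "h = (\<Sum>i\<le>n. Polynomial.monom (fls_const (c i) * fls_X_intpow \<lfloor>q * of_nat i\<rfloor>) (n - i))"
    using hom unfolding homogeneous_in_pi_pow_def by blast
  obtain e where e: "\<lfloor>q * of_nat n\<rfloor> = e" by blast
  have h0: "poly.coeff h 0 = fls_const (c n) * fls_X_intpow e"
    unfolding e[symmetric] c coeff_homogeneous by simp
  then have "c n \<noteq> 0" using h(2) by auto
  then have "fls_nth (fps_to_fls ?u) e \<noteq> 0" unfolding hu[symmetric] h0 by simp
  \<comment> \<open>A nonzero monomial of exponent \<open>e\<close> that equals a power series
    without constant term has \<open>e > 0\<close>.\<close>
  then have "e \<ge> 0" "e \<noteq> 0" using u0 by (auto split: if_splits)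
  then have "\<lfloor>q * of_nat n\<rfloor> > 0" unfolding e by simp
  then have "q * of_nat n > 0" by linarith
  then show ?thesis by (simp add: zero_less_mult_iff)
qed

theorem theorem4p2:
  fixes n :: nat and J :: "'k::alg_closed_field mat" and C :: "'k fls mat set"
  assumes "CHAR('k) \<noteq> 2"
    and "n \<ge> 1"
    and "symplectic_form n J"
    and "regular_semisimple_class n J C"
  shows "((\<exists>N \<in> C. \<exists>f. Q_action n J f \<and> almost_commutes n f N) \<longleftrightarrow>
           (\<exists>q::rat. q \<noteq> 0 \<and> of_nat n * q \<in> \<int> \<and> homogeneous_in_pi_pow n q (h_class C))) \<and>
         (\<forall>q::rat. q \<noteq> 0 \<longrightarrow> of_nat n * q \<in> \<int> \<longrightarrow> homogeneous_in_pi_pow n q (h_class C) \<longrightarrow>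
           (nil_class n J C \<longleftrightarrow> q > 0))"
proof -
  have two: "(2 :: 'k) \<noteq> 0"
  proof
    assume "(2 :: 'k) = 0"
    then have "of_nat 2 = (0 :: 'k)" by simp
    then have "CHAR('k) dvd 2" by (simp only: of_nat_eq_0_iff_char_dvd)
    then have "CHAR('k) = 1 \<or> CHAR('k) = 2" by (metis prime_nat_iff two_is_prime_nat)
    then show False using assms(1) CHAR_not_1[where ?'a = 'k] by simp
  qed
  have two_F: "(2 :: 'k fls) \<noteq> 0" using two by (metis fls_const_eq_0_iff fls_const_numeral)
  have J: "J \<in> carrier_mat (2 * n) (2 * n)" using assms(3) by (simp add: symplectic_form_def)
  obtain N0 where N0: "N0 \<in> sp_F n J" "regular_semisimple n N0" "C = conj_class n J N0"
    using assms(4) unfolding regular_semisimple_class_def by blast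
  have N0c: "N0 \<in> carrier_mat (2 * n) (2 * n)" using N0(1) by (simp add: sp_def)
  have N0C: "N0 \<in> C" unfolding N0(3) by (rule conj_class_refl) (use J N0c in auto)
  have h: "h_class C = h_poly N0"
    unfolding N0(3) by (rule h_class_conj_class[OF N0c N0C[unfolded N0(3)]])
  note hN0 = regular_semisimple_h_poly[OF two N0c N0(2)]
  have C: "N \<in> sp_F n J" "N \<in> carrier_mat (2 * n) (2 * n)" "char_poly N = char_poly N0" if "N \<in> C" for N
  proof -
    show "N \<in> sp_F n J" using conj_class_sp[OF J N0(1)] that N0(3) by blast
    then show "N \<in> carrier_mat (2 * n) (2 * n)" by (simp add: sp_def)
    show "char_poly N = char_poly N0" using conj_class_char_poly[OF N0c] that N0(3) by blast
  qed
  \<comment> \<open>The representative is built before \<open>N\<close> is chosen, so one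
    \<open>R\<close> serves all of \<open>C\<close>. Membership is stated from the side of each
    \<open>N\<close> because \<open>nil_elem\<close> asks for an integral conjugate of every
    \<open>N\<close>.\<close>
  have main: "(\<exists>R f. (\<forall>N\<in>C. R \<in> conj_class n J N) \<and> Q_action n J f \<and> almost_commutes n f R) \<and>
      (q > 0 \<longrightarrow> (\<forall>N\<in>C. nil_elem n J N))"
    if q: "q \<noteq> 0" "of_nat n * q \<in> \<int>" "homogeneous_in_pi_pow n q (h_class C)" for q :: rat
  proof -
    define m b where "m = fst (quotient_of q)" and "b = nat (snd (quotient_of q))"
    have mb: "quotient_of q = (m, int b)"
      using quotient_of_denom_pos'[of q] by (simp add: m_def b_def)
    have b: "b > 0" using quotient_of_denom_pos[OF mb] by simp
    have q_eq: "q = of_int m / of_nat b" using quotient_of_div[OF mb] by simp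
    obtain D \<alpha> where \<alpha>: "n = b * D" "inj_on \<alpha> {..<D}" "\<And>j. j < D \<Longrightarrow> \<alpha> j \<noteq> 0"
      "char_poly N0 = (\<Prod>j<D. Polynomial.monom 1 (2 * b) - [:fls_const (\<alpha> j) * fls_X_intpow m:])"
      using homogeneous_factorization[OF two assms(2) N0c N0(2) q(2) q(3)[unfolded h] mb] by blast
    have "b dvd n" using \<alpha>(1) by simp
    obtain g where g: "g \<in> carrier_mat (2 * n) (2 * n)" "transpose_mat g * J * g = block_form n b"
      using exists_congruence[OF assms(3) b \<open>b dvd n\<close> two] by blast
    obtain g' where g': "g' \<in> carrier_mat (2 * n) (2 * n)" "g * g' = 1\<^sub>m (2 * n)" "g' * g = 1\<^sub>m (2 * n)"
      using gram_imp_inverse[OF J g(1) b \<open>b dvd n\<close> g(2)] by blast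
    interpret G: graded_frame n b D m \<alpha> J g g'
      by standard (use b \<alpha>(1) J g g' in auto)
    \<comment> \<open>Nondegeneracy of \<open>J\<close> over \<open>F\<close>, transported from the
      explicit block form by the constant frame.\<close>
    have "symplectic_form n (transpose_mat (map_mat fls_const g') * block_form n b * map_mat fls_const g' :: 'k fls mat)"
      by (rule symplectic_congruent[OF symplectic_block_form[OF b \<open>b dvd n\<close> two_F] G.cm_carrier[OF g(1)]
            G.cm_carrier[OF g'(1)] G.cm_gh(2,1)])
    also have "transpose_mat (map_mat fls_const g') * block_form n b * map_mat fls_const g' =
        map_mat fls_const (transpose_mat g' * block_form n b * g')"
      using g'(1) block_form_carrier[of n b, where ?'a = 'k] block_form_carrier[of n b, where ?'a = "'k fls"]
      by (simp add: G.cm_mult mult_carrier_mat[of _ "2 * n" "2 * n" _ "2 * n"] G.cm_transpose G.cm_S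
          assoc_mult_mat[of _ "2 * n" "2 * n" _ "2 * n" _ "2 * n"])
    also have "\<dots> = map_mat fls_const J" by (simp only: G.J_eq[symmetric])
    finally have JF: "symplectic_form n (map_mat fls_const J)" .
    have rep: "G.rep \<in> conj_class n J N" if "N \<in> C" for N
    proof -
      interpret H: homogeneous_sp n b D m \<alpha> "map_mat fls_const J" N
        by standard (use two JF C[OF that] b \<alpha> quotient_of_coprime[OF mb] in auto)
      have \<delta>: "H.\<delta> = G.\<delta>" by (rule ext) (simp add: H.\<delta>_def G.\<delta>_def)
      show ?thesis using H.exists_graded_basis C(2)[OF that] unfolding \<delta>
        by (auto intro: G.rep_in_conj_class)
    qed
    have "m \<noteq> 0" using q(1) q_eq by auto
    then have "almost_commutes n G.action G.rep" by (rule G.almost_commutes_rep)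
    moreover have "nil_elem n J N" if "q > 0" "N \<in> C" for N
    proof -
      have "m > 0" using that(1) b unfolding q_eq by (simp add: zero_less_divide_iff)
      moreover have "G.rep \<in> sp_F n J" using C(1) rep[OF N0C] N0(3) by blast
      ultimately show ?thesis
        using G.rep_integral rep[OF that(2)] unfolding nil_elem_def by metis
    qed
    ultimately show ?thesis using rep G.Q_action_action by blast
  qed
  have only_if: "\<exists>q::rat. q \<noteq> 0 \<and> of_nat n * q \<in> \<int> \<and> homogeneous_in_pi_pow n q (h_class C)"
    if "N \<in> C" "Q_action n J f" "almost_commutes n f N" for N f
    unfolding h
    by (rule almost_commuting_imp_homogeneous[OF two assms(2) J C(2)[OF that(1)] _ hN0(2,4) that(2,3)])
      (simp add: hN0(1) C(3)[OF that(1)])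
  have "if": "\<exists>N\<in>C. \<exists>f. Q_action n J f \<and> almost_commutes n f N"
    if "q \<noteq> 0" "of_nat n * q \<in> \<int>" "homogeneous_in_pi_pow n q (h_class C)" for q :: rat
    using main[OF that] N0C N0(3) by blast
  have pos: "q > 0"
    if "of_nat n * q \<in> \<int>" "homogeneous_in_pi_pow n q (h_class C)" "nil_class n J C" for q :: rat
    using nil_imp_pos[OF assms(2) N0c hN0(1,4) that(2)[unfolded h] that(1)] that(3) N0C
    unfolding nil_class_def by blast
  show ?thesis
  proof (intro conjI allI impI iffI)
    assume "\<exists>N\<in>C. \<exists>f. Q_action n J f \<and> almost_commutes n f N"
    then show "\<exists>q::rat. q \<noteq> 0 \<and> of_nat n * q \<in> \<int> \<and> homogeneous_in_pi_pow n q (h_class C)"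
      using only_if by blast
  next
    assume "\<exists>q::rat. q \<noteq> 0 \<and> of_nat n * q \<in> \<int> \<and> homogeneous_in_pi_pow n q (h_class C)"
    then show "\<exists>N\<in>C. \<exists>f. Q_action n J f \<and> almost_commutes n f N"
      using "if" by blast
  next
    fix q :: rat
    assume q: "q \<noteq> 0" "of_nat n * q \<in> \<int>" "homogeneous_in_pi_pow n q (h_class C)"
    show "q > 0" if "nil_class n J C" by (rule pos[OF q(2,3) that])
    show "nil_class n J C" if "q > 0" using main[OF q] that by (simp add: nil_class_def)
  qed
qed

end
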